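(* Suppose that Conditions 1 and 2 of the context hold. Then, for every $\beta>0$, $$\lim_{n\to\infty}E^*(n)=0,$$ where $$E^*(n)=2\left(r_n(\alpha_n^* )+\frac{1}{\alpha_n^*u_n^*}\,\frac{2b}{\beta\,\overline\phi_{\mathbb{C}}^{(\beta)}}\right),\qquad n\in\mathbb{Z}_+,$$ and thus, since $\|{}_{(n)}\widehat\pi^*-\pi\|\le E^*(n)$ for all $n\in\mathbb{Z}_+$, $$\lim_{n\to\infty}\|{}_{(n)}\widehat\pi^*-\pi\|=0.$$
   Context: Notation: $\mathbb{N}=\{1,2,\dots\}$, $\mathbb{Z}_+=\{0,1,2,\dots\}$, $\mathbb{Z}_n=\{0,1,\dots,n\}$. For each $k\in\mathbb{Z}_+$ let $M_k\in\mathbb{N}$, $\mathbb{M}_k=\{1,\dots,M_k\}$, $\mathbb{L}_k=\{k\}\times\mathbb{M}_k$, $\mathbb{S}=\bigcup_{k\ge0}\mathbb{L}_k$, $\mathbb{S}_n=\bigcup_{k=0}^n\mathbb{L}_k$. $e$ is the column vector of ones of appropriate size. Finite vectors are extended by zeros to infinite vectors when necessary. For a vector $m$, $\|m\|=\sum_i|m(i)|$. Standing assumptions: $Q=(q(k,i;\ell,j))$ is the stable, conservative ($Qe=0$) generator of a regular-jump (non-explosive) continuous-time Markov chain on $\mathbb{S}$; it is ergodic (irreducible and positive recurrent) and upper block-Hessenberg: writing $Q_{k,\ell}$ for the $\mathbb{L}_k\times\mathbb{L}_\ell$ block, $Q_{k,\ell}=O$ whenever $\ell<k-1$. $\pi=(\pi_0,\pi_1,\dots)$,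 with $\pi_k$ indexed by $\mathbb{M}_k$, is its unique stationary distribution (row) vector: $\pi Q=0$, $\pi e=1$, $\pi>0$. Truncation: ${}_{(n)}Q$ is the restriction of $Q$ to $\mathbb{S}_n\times\mathbb{S}_n$; the inverse $(-{}_{(n)}Q)^{-1}$ exists, and its $\mathbb{L}_k\times\mathbb{L}_\ell$ block is denoted ${}_{(n)}X_{k,\ell}$. Matrices: $U_n^*={}_{(n)}X_{n,n}$; $U_{n,k}=Q_{n,n-1}\,{}_{(n-1)}X_{n-1,k}$ for $0\le k\le n-1$ and $U_{n,n}=I$; $U_{n,k}^*=U_n^*U_{n,k}$ for $k\in\mathbb{Z}_n$; $u_n^*=(u_n^*(j))_{j\in\mathbb{M}_n}=\sum_{\ell=0}^nU_{n,\ell}^*e$ (one has $u_n^*>0$). Condition 1: $Q$ is irreducible, and there exist a constant $b\in(0,\infty)$, a finite set $\mathbb{C}\subset\mathbb{S}$ and a positive column vector $v=(v(k,i))_{(k,i)\in\mathbb{S}}$ with $\inf_{(k,i)\in\mathbb{S}}v(k,i)>0$ and $Qv\le -e+b\,1_{\mathbb{C}}$, where $1_{\mathbb{C}}$ is the column vector with entries $1$ on $\mathbb{C}$ and $0$ on $\mathbb{S}\setminus\mathbb{C}$. Write $v_n=(v(n,i))_{i\in\mathbb{M}_n}$. Condition 2 (for the same $v$): $\sum_{n=0}^\infty\pi_n\Delta_nv_n<\infty$, where $\Delta_n$ is the $M_n\times M_n$ diagonal matrix with $\Delta_n(i,i)=|q(n,i;n,i)|$. For $\beta>0$: $\Phi^{(\beta)}=(\phi^{(\beta)}(k,i;\ell,j))=\int_0^\infty\beta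 e^{-\beta t}P^{(t)}\,dt$, where $P^{(t)}$ is the transition matrix function of the chain with generator $Q$, and $\overline\phi_{\mathbb{C}}^{(\beta)}=\sup_{(\ell,j)\in\mathbb{S}}\min_{(k,i)\in\mathbb{C}}\phi^{(\beta)}(k,i;\ell,j)>0$. Optimal augmentation: $y_n=(y_n(j))_{j\in\mathbb{M}_n}=v_n+\sum_{k=0}^nU_{n,k}^*\sum_{\ell=n+1}^\infty Q_{k,\ell}v_\ell>0$; $r_n(\alpha)=\alpha y_n/(\alpha u_n^* )$ for probability row vectors $\alpha$ on $\mathbb{M}_n$; $j_n^*\in\operatorname{arg\,min}_{j\in\mathbb{M}_n}y_n(j)/u_n^*(j)$; $\alpha_n^*$ is the probability row vector on $\mathbb{M}_n$ with unit mass at $j_n^*$. Finally ${}_{(n)}\widehat\pi^*=({}_{(n)}\widehat\pi_0^*,\dots,{}_{(n)}\widehat\pi_n^* )$ is the probability vector on $\mathbb{S}_n$ with $${}_{(n)}\widehat\pi_k^*=\frac{\alpha_n^*U_{n,k}^*}{\alpha_n^*u_n^*},\qquad k\in\mathbb{Z}_n.$$ *)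

theory Defs
  imports "HOL-Probability.Probability"
begin

type_synonym state = "nat \<times> nat"

text \<open>
  A state is a pair of a level and a phase; level \<open>k\<close> has the phases \<open>1, ..., M k\<close>.
  Infinite vectors and matrices are functions on \<^typ>\<open>state\<close>; only their values on
  the state space are ever used.
\<close>

definition level :: "(nat \<Rightarrow> nat) \<Rightarrow> nat \<Rightarrow> state set" where
  "level M k = {k} \<times> {1..M k}"

definition states :: "(nat \<Rightarrow> nat) \<Rightarrow> state set" where
  "states M = (\<Union>k. level M k)"

definition states_upto :: "(nat \<Rightarrow> nat) \<Rightarrow> nat \<Rightarrow> state set" where
  "states_upto M n = (\<Union>k\<le>n. level M k)"

text \<open>Stability is implicit: all entries, in particular the diagonal ones, are real numbers.\<close>

definition conservative_generator :: "'s set \<Rightarrow> ('s \<Rightarrow> 's \<Rightarrow> real) \<Rightarrow> bool" where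
  "conservative_generator S q \<longleftrightarrow>
     (\<forall>x\<in>S. \<forall>y\<in>S. x \<noteq> y \<longrightarrow> 0 \<le> q x y) \<and>
     (\<forall>x\<in>S. (q x has_sum 0) S)"

definition irreducible_generator :: "'s set \<Rightarrow> ('s \<Rightarrow> 's \<Rightarrow> real) \<Rightarrow> bool" where
  "irreducible_generator S q \<longleftrightarrow>
     (\<forall>x\<in>S. \<forall>y\<in>S. (x, y) \<in> {(a, c). a \<in> S \<and> c \<in> S \<and> 0 < q a c}\<^sup>*)"

definition upper_block_Hessenberg ::
    "(nat \<Rightarrow> nat) \<Rightarrow> (state \<Rightarrow> state \<Rightarrow> real) \<Rightarrow> bool" where
  "upper_block_Hessenberg M q \<longleftrightarrow>
     (\<forall>k l. l + 1 < k \<longrightarrow> (\<forall>x\<in>level M k. \<forall>y\<in>level M l. q x y = 0))"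

definition stationary_distribution ::
    "'s set \<Rightarrow> ('s \<Rightarrow> 's \<Rightarrow> real) \<Rightarrow> ('s \<Rightarrow> real) \<Rightarrow> bool" where
  "stationary_distribution S q p \<longleftrightarrow>
     (\<forall>x\<in>S. 0 < p x) \<and> (p has_sum 1) S \<and>
     (\<forall>y\<in>S. ((\<lambda>x. p x * q x y) has_sum 0) S)"

text \<open>
  The chain is given by its jump chain \<open>Y\<close> and its holding times \<open>H\<close>: \<open>H n\<close> is the time
  spent in \<open>Y n\<close>, and the law of the chain started in \<open>x\<close> is \<open>Pr x\<close>.
\<close>

definition jump_time :: "(nat \<Rightarrow> 'w \<Rightarrow> real) \<Rightarrow> nat \<Rightarrow> 'w \<Rightarrow> real" where
  "jump_time H n \<omega> = (\<Sum>i<n. H i \<omega>)"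

definition chain_at :: "(nat \<Rightarrow> 'w \<Rightarrow> 's) \<Rightarrow> (nat \<Rightarrow> 'w \<Rightarrow> real) \<Rightarrow> real \<Rightarrow> 'w \<Rightarrow> 's" where
  "chain_at Y H t \<omega> = Y (LEAST n. t < jump_time H (Suc n) \<omega>) \<omega>"

definition jump_prob :: "('s \<Rightarrow> 's \<Rightarrow> real) \<Rightarrow> 's \<Rightarrow> 's \<Rightarrow> real" where
  "jump_prob q x y = (if x = y then 0 else q x y / \<bar>q x x\<bar>)"

text \<open>
  \<open>Y\<close> is a Markov chain with transition probabilities \<^const>\<open>jump_prob\<close>, and conditionally
  on \<open>Y 0, ..., Y n\<close> the times \<open>H 0, ..., H n\<close> are independent and exponentially distributed
  with the rates \<open>\<bar>q (Y i) (Y i)\<bar>\<close>; the joint law is written out through the tails of \<open>H\<close>.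
  This presupposes that there are no absorbing states, which holds for an irreducible
  generator on more than one state.
\<close>

definition markov_chain_with_generator ::
    "'s set \<Rightarrow> ('s \<Rightarrow> 's \<Rightarrow> real) \<Rightarrow> ('s \<Rightarrow> 'w measure) \<Rightarrow> (nat \<Rightarrow> 'w \<Rightarrow> 's) \<Rightarrow>
     (nat \<Rightarrow> 'w \<Rightarrow> real) \<Rightarrow> bool" where
  "markov_chain_with_generator S q Pr Y H \<longleftrightarrow>
     (\<forall>x\<in>S. prob_space (Pr x) \<and>
        (\<forall>n. Y n \<in> measurable (Pr x) (count_space S)) \<and>
        (\<forall>n. H n \<in> borel_measurable (Pr x)) \<and>
        (\<forall>n ys ts. (\<forall>i\<le>n. ys i \<in> S \<and> 0 \<le> ts i) \<longrightarrow>
           measure (Pr x) {\<omega> \<in> space (Pr x). \<forall>i\<le>n. Y i \<omega> = ys i \<and> ts i < H i \<omega>} =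
           (if ys 0 = x then 1 else 0) *
           (\<Prod>i<n. jump_prob q (ys i) (ys (Suc i))) *
           (\<Prod>i\<le>n. exp (- (\<bar>q (ys i) (ys i)\<bar> * ts i)))))"

text \<open>Regular-jump: almost surely only finitely many jumps occur in any bounded time interval.\<close>

definition regular_jump ::
    "'s set \<Rightarrow> ('s \<Rightarrow> 'w measure) \<Rightarrow> (nat \<Rightarrow> 'w \<Rightarrow> real) \<Rightarrow> bool" where
  "regular_jump S Pr H \<longleftrightarrow> (\<forall>x\<in>S. AE \<omega> in Pr x. \<forall>t. \<exists>n. t < jump_time H n \<omega>)"

text \<open>The first time at or after the first jump at which the chain is in \<open>x\<close>
  (infinite if there is none).\<close>

definition return_time ::
    "(nat \<Rightarrow> 'w \<Rightarrow> 's) \<Rightarrow> (nat \<Rightarrow> 'w \<Rightarrow> real) \<Rightarrow> 's \<Rightarrow> 'w \<Rightarrow> ennreal" where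
  "return_time Y H x \<omega> =
     (INF t \<in> {t. jump_time H 1 \<omega> \<le> t \<and> chain_at Y H t \<omega> = x}. ennreal t)"

definition positive_recurrent ::
    "'s set \<Rightarrow> ('s \<Rightarrow> 'w measure) \<Rightarrow> (nat \<Rightarrow> 'w \<Rightarrow> 's) \<Rightarrow> (nat \<Rightarrow> 'w \<Rightarrow> real) \<Rightarrow> bool" where
  "positive_recurrent S Pr Y H \<longleftrightarrow>
     (\<forall>x\<in>S. (\<integral>\<^sup>+ \<omega>. return_time Y H x \<omega> \<partial>Pr x) < \<infinity>)"

definition transition_prob ::
    "('s \<Rightarrow> 'w measure) \<Rightarrow> (nat \<Rightarrow> 'w \<Rightarrow> 's) \<Rightarrow> (nat \<Rightarrow> 'w \<Rightarrow> real) \<Rightarrow>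
     real \<Rightarrow> 's \<Rightarrow> 's \<Rightarrow> real" where
  "transition_prob Pr Y H t x y =
     measure (Pr x) {\<omega> \<in> space (Pr x). chain_at Y H t \<omega> = y}"

definition resolvent ::
    "(real \<Rightarrow> 's \<Rightarrow> 's \<Rightarrow> real) \<Rightarrow> real \<Rightarrow> 's \<Rightarrow> 's \<Rightarrow> real" where
  "resolvent P \<beta> x y = (LBINT t:{0..}. \<beta> * exp (- \<beta> * t) * P t x y)"

definition phi_bar ::
    "'s set \<Rightarrow> 's set \<Rightarrow> (real \<Rightarrow> 's \<Rightarrow> 's \<Rightarrow> real) \<Rightarrow> real \<Rightarrow> real" where
  "phi_bar S C P \<beta> = (SUP y\<in>S. Min ((\<lambda>x. resolvent P \<beta> x y) ` C))"

definition condition1 ::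
    "'s set \<Rightarrow> ('s \<Rightarrow> 's \<Rightarrow> real) \<Rightarrow> real \<Rightarrow> 's set \<Rightarrow> ('s \<Rightarrow> real) \<Rightarrow> bool" where
  "condition1 S q b C v \<longleftrightarrow>
     irreducible_generator S q \<and> 0 < b \<and> finite C \<and> C \<subseteq> S \<and>
     (\<forall>x\<in>S. 0 < v x) \<and> 0 < (INF x\<in>S. v x) \<and>
     (\<forall>x\<in>S. (\<lambda>y. q x y * v y) summable_on S \<and>
             (\<Sum>\<^sub>\<infinity>y\<in>S. q x y * v y) \<le> - 1 + b * indicator C x)"

definition condition2 ::
    "(nat \<Rightarrow> nat) \<Rightarrow> (state \<Rightarrow> state \<Rightarrow> real) \<Rightarrow> (state \<Rightarrow> real) \<Rightarrow> (state \<Rightarrow> real) \<Rightarrow> bool" where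
  "condition2 M q p v \<longleftrightarrow>
     summable (\<lambda>n. \<Sum>i=1..M n. p (n, i) * \<bar>q (n, i) (n, i)\<bar> * v (n, i))"

text \<open>
  The inverse of the \<open>A \<times> A\<close> matrix \<open>a\<close> for a finite index set \<open>A\<close>, extended by zeros;
  unspecified if \<open>a\<close> is singular.
\<close>

definition inverse_on :: "'s set \<Rightarrow> ('s \<Rightarrow> 's \<Rightarrow> real) \<Rightarrow> 's \<Rightarrow> 's \<Rightarrow> real" where
  "inverse_on A a = (THE x.
     (\<forall>i j. i \<notin> A \<or> j \<notin> A \<longrightarrow> x i j = 0) \<and>
     (\<forall>i\<in>A. \<forall>j\<in>A. (\<Sum>k\<in>A. a i k * x k j) = (if i = j then 1 else 0)) \<and>
     (\<forall>i\<in>A. \<forall>j\<in>A. (\<Sum>k\<in>A. x i k * a k j) = (if i = j then 1 else 0)))"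

definition trunc_inv ::
    "(nat \<Rightarrow> nat) \<Rightarrow> (state \<Rightarrow> state \<Rightarrow> real) \<Rightarrow> nat \<Rightarrow> state \<Rightarrow> state \<Rightarrow> real" where
  "trunc_inv M q n = inverse_on (states_upto M n) (\<lambda>x y. - q x y)"

text \<open>In the following, blocks and vectors are indexed by phases. The matrices
  \<open>U_mat M q n k\<close> and \<open>U_star M q n k\<close> are meaningful for \<open>k \<le> n\<close> only.\<close>

definition U_mat ::
    "(nat \<Rightarrow> nat) \<Rightarrow> (state \<Rightarrow> state \<Rightarrow> real) \<Rightarrow> nat \<Rightarrow> nat \<Rightarrow> nat \<Rightarrow> nat \<Rightarrow> real" where
  "U_mat M q n k i j =
     (if k = n then (if i = j then 1 else 0)
      else \<Sum>h=1..M (n - 1). q (n, i) (n - 1, h) * trunc_inv M q (n - 1) (n - 1, h) (k, j))"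

definition U_star ::
    "(nat \<Rightarrow> nat) \<Rightarrow> (state \<Rightarrow> state \<Rightarrow> real) \<Rightarrow> nat \<Rightarrow> nat \<Rightarrow> nat \<Rightarrow> nat \<Rightarrow> real" where
  "U_star M q n k i j = (\<Sum>h=1..M n. trunc_inv M q n (n, i) (n, h) * U_mat M q n k h j)"

definition u_star ::
    "(nat \<Rightarrow> nat) \<Rightarrow> (state \<Rightarrow> state \<Rightarrow> real) \<Rightarrow> nat \<Rightarrow> nat \<Rightarrow> real" where
  "u_star M q n j = (\<Sum>l\<le>n. \<Sum>i=1..M l. U_star M q n l j i)"

definition y_vec ::
    "(nat \<Rightarrow> nat) \<Rightarrow> (state \<Rightarrow> state \<Rightarrow> real) \<Rightarrow> (state \<Rightarrow> real) \<Rightarrow> nat \<Rightarrow> nat \<Rightarrow> real" where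
  "y_vec M q v n j =
     v (n, j) + (\<Sum>k\<le>n. \<Sum>i=1..M k. U_star M q n k j i *
       (\<Sum>\<^sub>\<infinity>z\<in>(\<Union>l\<in>{n+1..}. level M l). q (k, i) z * v z))"

definition phase_prod :: "(nat \<Rightarrow> nat) \<Rightarrow> nat \<Rightarrow> (nat \<Rightarrow> real) \<Rightarrow> (nat \<Rightarrow> real) \<Rightarrow> real" where
  "phase_prod M n a w = (\<Sum>j=1..M n. a j * w j)"

definition r_fun ::
    "(nat \<Rightarrow> nat) \<Rightarrow> (state \<Rightarrow> state \<Rightarrow> real) \<Rightarrow> (state \<Rightarrow> real) \<Rightarrow> nat \<Rightarrow> (nat \<Rightarrow> real) \<Rightarrow> real" where
  "r_fun M q v n a = phase_prod M n a (y_vec M q v n) / phase_prod M n a (u_star M q n)"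

definition optimal_phase ::
    "(nat \<Rightarrow> nat) \<Rightarrow> (state \<Rightarrow> state \<Rightarrow> real) \<Rightarrow> (state \<Rightarrow> real) \<Rightarrow> nat \<Rightarrow> nat \<Rightarrow> bool" where
  "optimal_phase M q v n j \<longleftrightarrow>
     is_arg_min (\<lambda>i. y_vec M q v n i / u_star M q n i) (\<lambda>i. i \<in> {1..M n}) j"

definition unit_mass :: "nat \<Rightarrow> nat \<Rightarrow> real" where
  "unit_mass j i = (if i = j then 1 else 0)"

text \<open>The approximation built from a phase distribution \<open>a\<close> on level \<open>n\<close>, extended by zeros
  to all states.\<close>

definition pi_hat ::
    "(nat \<Rightarrow> nat) \<Rightarrow> (state \<Rightarrow> state \<Rightarrow> real) \<Rightarrow> nat \<Rightarrow> (nat \<Rightarrow> real) \<Rightarrow> state \<Rightarrow> real" where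
  "pi_hat M q n a = (\<lambda>(k, i).
     if (k, i) \<in> states_upto M n
     then phase_prod M n a (\<lambda>j. U_star M q n k j i) / phase_prod M n a (u_star M q n)
     else 0)"

definition error_bound ::
    "(nat \<Rightarrow> nat) \<Rightarrow> (state \<Rightarrow> state \<Rightarrow> real) \<Rightarrow> (real \<Rightarrow> state \<Rightarrow> state \<Rightarrow> real) \<Rightarrow>
     real \<Rightarrow> state set \<Rightarrow> (state \<Rightarrow> real) \<Rightarrow> real \<Rightarrow> nat \<Rightarrow> (nat \<Rightarrow> real) \<Rightarrow> real" where
  "error_bound M q P b C v \<beta> n a =
     2 * (r_fun M q v n a +
          1 / phase_prod M n a (u_star M q n) *
          (2 * b / (\<beta> * phi_bar (states M) C P \<beta>)))"

definition norm1 :: "'s set \<Rightarrow> ('s \<Rightarrow> real) \<Rightarrow> real" where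
  "norm1 S m = (\<Sum>\<^sub>\<infinity>x\<in>S. \<bar>m x\<bar>)"

end

theory Submission
  imports Defs "Jordan_Normal_Form.Determinant"
begin

text \<open>
  Everything rests on the matrix \<open>X = (-Q\<^sub>A)\<inverse>\<close> for \<open>A\<close> the states up to level \<open>n\<close>: the last block
  row of \<open>X\<close> is \<open>U_star\<close>, so that \<open>u_star\<close> collects row sums of \<open>X\<close>, the approximation
  \<open>pi_hat\<close> is a normalised row of \<open>X\<close>, and \<open>y_vec\<close> is \<open>v\<close> plus that row applied to the
  outflow \<open>\<Sum>z\<notin>A. q x z * v z\<close> (\<open>level_chain.U_star_eq\<close> and its companions).

  Error bound. Let \<open>g = sgn (pi_hat - p)\<close> and let \<open>h\<close> solve the Poisson equation
  \<open>Q h = - (g - p g)\<close>, where \<open>p g\<close> is the mean of \<open>g\<close> under \<open>p\<close>. Pairing the equation with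
  \<open>pi_hat\<close>, and using that \<open>pi_hat Q\<close> is \<open>-1/u\<close> at the chosen state of level \<open>n\<close> and zero elsewhere
  in \<open>A\<close>, expresses the error through \<open>h\<close> at that state and the outflow of \<open>h\<close>
  (\<open>infinite_generator.augmentation_error\<close>). So it suffices to find \<open>h\<close> with
  \<open>\<bar>h\<bar> \<le> 2 * (v + b / (\<beta> \<psi>))\<close>, where \<open>\<psi>\<close> is the minimum over \<open>C\<close> of the resolvent kernel at a
  target state \<open>y\<^sub>0\<close>. Take for \<open>h\<close> the mean of the integral of \<open>g - p g\<close> along the chain until \<open>y\<^sub>0\<close>
  is hit. By the drift condition the mean hitting time of \<open>y\<^sub>0\<close> is at most \<open>v + b w\<close>, where \<open>w\<close> is the mean time
  spent in \<open>C\<close> before \<open>y\<^sub>0\<close> (\<open>infinite_generator.hit_iter_le_drift\<close>), and \<open>w \<le> 1 / (\<beta> \<psi>)\<close>: sample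
  the chain at the points of a Poisson process of rate \<open>\<beta>\<close>; from a point at which it is in \<open>C\<close> it is found
  in \<open>y\<^sub>0\<close> at the next point with probability at least \<open>\<psi>\<close>, so the mean number of sampling
  points in \<open>C\<close> before \<open>y\<^sub>0\<close> is at most \<open>1 / \<psi>\<close>. Analytically this is one application of the
  resolvent to a bounded subsolution (\<open>markov_jump_chain.resolvent_subsolution_bound\<close>), where
  non-explosion excludes spurious bounded solutions of the resolvent equation; irreducibility makes \<open>\<psi>\<close>
  positive (\<open>markov_jump_chain.resolvent_pos\<close>).
  At \<open>y\<^sub>0\<close> itself, where the hitting construction says nothing, Poisson's equation follows from
  \<open>p Q h = 0\<close>, which the moment condition permits. Taking the best \<open>y\<^sub>0\<close> turns \<open>\<psi>\<close> into
  \<open>phi_bar\<close>.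

  Convergence. For a phase distribution proportional to the flow of the stationary chain from above
  level \<open>n\<close> into level \<open>n\<close>, the augmented truncation reproduces \<open>p\<close> conditioned on \<open>A\<close>, and the
  ratio \<open>r\<close> becomes a sum of stationary flows, which is bounded by the tail of the series in the
  moment condition. The optimal phase does at least as well
  (\<open>infinite_generator.minimal_ratio_bound\<close>), so \<open>r\<close> tends to zero; and \<open>1 / u\<close> is dominated by
  \<open>r / inf v\<close> because \<open>y_vec\<close> is at least \<open>v\<close>.
\<close>

section \<open>Finite truncations of an irreducible generator\<close>

text \<open>
  The predicate described by \<^const>\<open>inverse_on\<close>, named so that its solution can be shown to be unique.
\<close>

definition is_inverse_on :: "'s set \<Rightarrow> ('s \<Rightarrow> 's \<Rightarrow> real) \<Rightarrow> ('s \<Rightarrow> 's \<Rightarrow> real) \<Rightarrow> bool" where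
  "is_inverse_on A a x \<longleftrightarrow>
     (\<forall>i j. i \<notin> A \<or> j \<notin> A \<longrightarrow> x i j = 0) \<and>
     (\<forall>i\<in>A. \<forall>j\<in>A. (\<Sum>k\<in>A. a i k * x k j) = (if i = j then 1 else 0)) \<and>
     (\<forall>i\<in>A. \<forall>j\<in>A. (\<Sum>k\<in>A. x i k * a k j) = (if i = j then 1 else 0))"

lemma is_inverse_on_unique:
  assumes "finite A" "is_inverse_on A a x" "is_inverse_on A a y"
  shows "x = y"
proof (intro ext)
  fix i j
  show "x i j = y i j"
  proof (cases "i \<in> A \<and> j \<in> A")
    case True
    then have ij: "i \<in> A" "j \<in> A" by auto
    have "x i j = (\<Sum>k\<in>A. x i k * (if k = j then 1 else 0))"
      using ij assms(1) by (simp add: if_distrib cong: if_cong)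
    also have "\<dots> = (\<Sum>k\<in>A. x i k * (\<Sum>l\<in>A. a k l * y l j))"
      using assms(3) ij by (intro sum.cong) (auto simp: is_inverse_on_def)
    also have "\<dots> = (\<Sum>l\<in>A. (\<Sum>k\<in>A. x i k * a k l) * y l j)"
      by (simp add: sum_distrib_left sum_distrib_right mult.assoc) (rule sum.swap)
    also have "\<dots> = (\<Sum>l\<in>A. (if i = l then 1 else 0) * y l j)"
      using assms(2) ij by (intro sum.cong) (auto simp: is_inverse_on_def)
    also have "\<dots> = y i j"
      using ij assms(1) by (simp add: if_distrib if_distribR cong: if_cong)
    finally show ?thesis .
  qed (use assms in \<open>auto simp: is_inverse_on_def\<close>)
qed

text \<open>
  For a square matrix a trivial kernel suffices. An enumeration of \<open>A\<close> transports this fact from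
  matrices with numbered rows.
\<close>

lemma inverse_on_is_inverse_on:
  fixes a :: "'s \<Rightarrow> 's \<Rightarrow> real"
  assumes fin: "finite A"
    and ker: "\<And>f. (\<And>i. i \<in> A \<Longrightarrow> (\<Sum>k\<in>A. a i k * f k) = 0) \<Longrightarrow> (\<And>k. k \<in> A \<Longrightarrow> f k = 0)"
  shows "is_inverse_on A a (inverse_on A a)"
proof -
  define n where "n = card A"
  obtain g where g: "bij_betw g {0..<n} A"
    using ex_bij_betw_nat_finite[OF fin] unfolding n_def by blast
  define m where "m = mat n n (\<lambda>(i, j). a (g i) (g j))"
  have m: "m \<in> carrier_mat n n" by (simp add: m_def)
  define g' where "g' = the_inv_into {0..<n} g"
  have g'g: "g' (g i) = i" if "i < n" for i
    using g that unfolding g'_def by (intro the_inv_into_f_f) (auto simp: bij_betw_def)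
  have gg': "g (g' k) = k" and g'_lt: "g' k < n" if "k \<in> A" for k
    using g that f_the_inv_into_f_bij_betw[of g "{0..<n}" A k]
      the_inv_into_into[of g "{0..<n}" k "{0..<n}"]
    unfolding g'_def by (auto simp: bij_betw_def)
  have gA: "g i \<in> A" if "i < n" for i using g that by (auto simp: bij_betw_def)
  have sum_g: "(\<Sum>k\<in>A. F k) = (\<Sum>k = 0..<n. F (g k))" for F :: "'s \<Rightarrow> real"
    using sum.reindex_bij_betw[OF g, of F] by simp
  have "det m \<noteq> 0"
  proof
    assume "det m = 0"
    then obtain u where u: "u \<in> carrier_vec n" "u \<noteq> 0\<^sub>v n" "m *\<^sub>v u = 0\<^sub>v n"
      using det_0_iff_vec_prod_zero_field[OF m] by auto
    have "(\<Sum>k\<in>A. a i k * u $ g' k) = 0" if i: "i \<in> A" for i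
    proof -
      have "0 = (m *\<^sub>v u) $ g' i" using u(3) g'_lt[OF i] by simp
      also have "\<dots> = (\<Sum>k = 0..<n. a i (g k) * u $ k)"
        using u(1) g'_lt[OF i] gg'[OF i] by (simp add: m_def scalar_prod_def)
      also have "\<dots> = (\<Sum>k = 0..<n. a i (g k) * u $ g' (g k))"
        by (intro sum.cong) (auto simp: g'g)
      finally show ?thesis by (simp add: sum_g)
    qed
    then have "u $ g' k = 0" if "k \<in> A" for k using ker[of "\<lambda>k. u $ g' k"] that by blast
    then have "u $ i = 0" if "i < n" for i using gA[OF that] g'g[OF that] by metis
    then have "u = 0\<^sub>v n" using u(1) by (intro eq_vecI) auto
    then show False using u(2) by simp
  qed
  then have "m \<in> Units (ring_mat TYPE(real) n ())" by (rule det_non_zero_imp_unit[OF m])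
  then obtain y where y: "y \<in> carrier_mat n n" "m * y = 1\<^sub>m n" "y * m = 1\<^sub>m n"
    by (auto simp: Units_def ring_mat_def)
  define x where "x i j = (if i \<in> A \<and> j \<in> A then y $$ (g' i, g' j) else 0)" for i j
  have inv: "is_inverse_on A a x"
    unfolding is_inverse_on_def
  proof (intro conjI ballI allI impI)
    fix i j assume ij: "i \<in> A" "j \<in> A"
    note lt = g'_lt[OF ij(1)] g'_lt[OF ij(2)]
    have eq: "(g' i = g' j) = (i = j)" using gg' ij by metis
    have "(m * y) $$ (g' i, g' j) = (\<Sum>k = 0..<n. a i (g k) * y $$ (k, g' j))"
      using lt y(1) ij by (simp add: m_def scalar_prod_def gg')
    also have "\<dots> = (\<Sum>k = 0..<n. a i (g k) * x (g k) j)"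
      using ij by (intro sum.cong) (auto simp: x_def gA g'g)
    finally show "(\<Sum>k\<in>A. a i k * x k j) = (if i = j then 1 else 0)"
      using lt eq by (simp add: sum_g y(2))
    have "(y * m) $$ (g' i, g' j) = (\<Sum>k = 0..<n. y $$ (g' i, k) * a (g k) j)"
      using lt y(1) ij by (simp add: m_def scalar_prod_def gg')
    also have "\<dots> = (\<Sum>k = 0..<n. x i (g k) * a (g k) j)"
      using ij by (intro sum.cong) (auto simp: x_def gA g'g)
    finally show "(\<Sum>k\<in>A. x i k * a k j) = (if i = j then 1 else 0)"
      using lt eq by (simp add: sum_g y(3))
  qed (auto simp: x_def)
  have "inverse_on A a = (THE x. is_inverse_on A a x)"
    by (simp add: inverse_on_def is_inverse_on_def)
  also have "\<dots> = x" using inv is_inverse_on_unique[OF fin] by (intro the_equality) auto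
  finally show ?thesis using inv by simp
qed

locale infinite_generator =
  fixes S :: "'s set" and q :: "'s \<Rightarrow> 's \<Rightarrow> real"
  assumes generator: "conservative_generator S q"
    and irreducible: "irreducible_generator S q"
    and infinite: "infinite S"
begin

lemma off_nonneg: "x \<in> S \<Longrightarrow> y \<in> S \<Longrightarrow> x \<noteq> y \<Longrightarrow> 0 \<le> q x y"
  using generator by (auto simp: conservative_generator_def)

lemma row_has_sum: "x \<in> S \<Longrightarrow> (q x has_sum 0) S"
  using generator by (auto simp: conservative_generator_def)

lemma off_has_sum: "x \<in> S \<Longrightarrow> (q x has_sum - q x x) (S - {x})"
  using has_sum_Diff[OF row_has_sum, of x "{x}" "q x x"] by (simp add: has_sum_finite_iff)

lemma partial_row_le_0:
  assumes "finite A" "A \<subseteq> S" "x \<in> A" shows "(\<Sum>y\<in>A. q x y) \<le> 0"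
proof -
  have x: "x \<in> S" using assms by auto
  have "(\<Sum>y\<in>A - {x}. q x y) \<le> - q x x"
    using off_has_sum[OF x] assms off_nonneg[OF x]
    by (intro has_sum_mono2[OF has_sum_finite]) auto
  moreover have "(\<Sum>y\<in>A. q x y) = q x x + (\<Sum>y\<in>A - {x}. q x y)"
    using assms by (intro sum.remove) auto
  ultimately show ?thesis by linarith
qed

lemma exit_row:
  assumes "finite A" "A \<subseteq> S" "x \<in> A" "z \<in> S - A" "0 < q x z"
  shows "(\<Sum>y\<in>A. q x y) < 0"
proof -
  have "(\<Sum>y\<in>insert z A. q x y) \<le> 0" using assms by (intro partial_row_le_0) auto
  then show ?thesis using assms by auto
qed

lemma exists_exit:
  assumes "D \<subseteq> S" "D \<noteq> {}" "D \<noteq> S"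
  shows "\<exists>x\<in>D. \<exists>z\<in>S - D. 0 < q x z"
proof (rule ccontr)
  assume no: "\<not> ?thesis"
  obtain x z where xz: "x \<in> D" "z \<in> S - D" using assms by blast
  have "(x, z) \<in> {(a, c). a \<in> S \<and> c \<in> S \<and> 0 < q a c}\<^sup>*"
    using irreducible xz assms(1) by (auto simp: irreducible_generator_def)
  then have "z \<in> D"
    by (induction rule: rtrancl_induct) (use xz no in auto)
  then show False using xz by simp
qed

lemma rate_neg: assumes "x \<in> S" shows "q x x < 0"
proof -
  have "S \<noteq> {x}" using infinite by auto
  then obtain z where "z \<in> S - {x}" "0 < q x z"
    using exists_exit[of "{x}"] assms by auto
  then show ?thesis using exit_row[of "{x}" x z] assms by auto
qed

text \<open>
  If \<open>f\<close> had a negative minimum \<open>m\<close> on \<open>A\<close>, then at each minimiser both the terms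
  \<open>q a y * (f y - m)\<close> and \<open>m\<close> times the (nonpositive) row sum would be nonnegative, hence zero. So no
  transition would leave the set of minimisers, neither inside \<open>A\<close> nor out of \<open>A\<close>.
\<close>

lemma truncation_minimum_principle:
  assumes A: "finite A" "A \<subseteq> S" and f: "\<And>x. x \<in> A \<Longrightarrow> (\<Sum>y\<in>A. q x y * f y) \<le> 0" and "x \<in> A"
  shows "0 \<le> f x"
proof (rule ccontr)
  assume "\<not> 0 \<le> f x"
  define m where "m = Min (f ` A)"
  have m_le: "m \<le> f y" if "y \<in> A" for y using A that by (simp add: m_def)
  have "m < 0" using m_le[OF \<open>x \<in> A\<close>] \<open>\<not> 0 \<le> f x\<close> by simp
  define D where "D = {y \<in> A. f y = m}"
  have "m \<in> f ` A" unfolding m_def using A \<open>x \<in> A\<close> by (intro Min_in) auto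
  then have "D \<noteq> {}" by (auto simp: D_def)
  have "D \<noteq> S" using A infinite by (auto simp: D_def dest: finite_subset[of _ A])
  then obtain a z where az: "a \<in> D" "z \<in> S - D" "0 < q a z"
    using exists_exit[of D] \<open>D \<noteq> {}\<close> A by (auto simp: D_def)
  then have a: "a \<in> A" "f a = m" by (auto simp: D_def)
  have split: "(\<Sum>y\<in>A. q a y * f y) = (\<Sum>y\<in>A. q a y * (f y - m)) + m * (\<Sum>y\<in>A. q a y)"
    by (simp add: algebra_simps sum_subtractf sum_distrib_left)
  have term_nonneg: "0 \<le> q a y * (f y - m)" if "y \<in> A" for y
  proof (cases "y = a")
    case False
    then have "0 \<le> q a y" using A a that by (intro off_nonneg) auto
    then show ?thesis using m_le[OF that] a by simp
  qed (use a in simp)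
  have row: "0 \<le> m * (\<Sum>y\<in>A. q a y)"
    using partial_row_le_0[OF A a(1)] \<open>m < 0\<close> by (simp add: mult_nonpos_nonpos)
  show False
  proof (cases "z \<in> A")
    case True
    then have "m < f z" using az m_le[OF True] by (auto simp: D_def)
    have "q a z * (f z - m) \<le> (\<Sum>y\<in>A. q a y * (f y - m))"
      using A True term_nonneg by (intro member_le_sum) auto
    moreover have "0 < q a z * (f z - m)" using az \<open>m < f z\<close> by simp
    ultimately show False using split row f[OF a(1)] by linarith
  next
    case False
    then have "(\<Sum>y\<in>A. q a y) < 0" using az a A by (intro exit_row[of A a z]) auto
    then have "0 < m * (\<Sum>y\<in>A. q a y)" using \<open>m < 0\<close> by (simp add: mult_neg_neg)
    moreover have "0 \<le> (\<Sum>y\<in>A. q a y * (f y - m))" by (intro sum_nonneg term_nonneg)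
    ultimately show False using split f[OF a(1)] by linarith
  qed
qed

text \<open>
  The minimum principle applied to \<open>f\<close> and to \<open>- f\<close> shows that the kernel is trivial.
\<close>

lemma truncated_inverse:
  assumes A: "finite A" "A \<subseteq> S"
  shows "is_inverse_on A (\<lambda>x y. - q x y) (inverse_on A (\<lambda>x y. - q x y))"
proof (rule inverse_on_is_inverse_on[OF A(1)])
  fix f k assume f: "\<And>i. i \<in> A \<Longrightarrow> (\<Sum>k\<in>A. - q i k * f k) = 0" and k: "k \<in> A"
  have "(\<Sum>k\<in>A. q i k * f k) = 0" if "i \<in> A" for i
    using f[OF that] by (simp add: sum_negf)
  then have "0 \<le> f k" "0 \<le> - f k"
    using truncation_minimum_principle[OF A, of f k] truncation_minimum_principle[OF A, of "\<lambda>y. - f y" k] k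
    by (auto simp: sum_negf)
  then show "f k = 0" by simp
qed

lemma truncated_inverse_nonneg:
  assumes A: "finite A" "A \<subseteq> S"
  shows "0 \<le> inverse_on A (\<lambda>x y. - q x y) x y"
proof (cases "x \<in> A \<and> y \<in> A")
  case True
  let ?X = "inverse_on A (\<lambda>x y. - q x y)"
  have "(\<Sum>k\<in>A. - q i k * ?X k y) = (if i = y then 1 else 0)" if "i \<in> A" for i
    using truncated_inverse[OF A] True that by (auto simp: is_inverse_on_def)
  then have "(\<Sum>k\<in>A. q i k * ?X k y) \<le> 0" if "i \<in> A" for i
    using that by (fastforce simp: sum_negf split: if_splits)
  then show ?thesis using truncation_minimum_principle[OF A, of "\<lambda>k. ?X k y" x] True by auto
qed (use truncated_inverse[OF A] in \<open>auto simp: is_inverse_on_def\<close>)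

lemma truncated_row_sum_pos:
  assumes A: "finite A" "A \<subseteq> S" and i: "i \<in> A"
  shows "0 < sum (inverse_on A (\<lambda>x y. - q x y) i) A"
proof -
  let ?X = "inverse_on A (\<lambda>x y. - q x y) i"
  have X0: "0 \<le> ?X x" for x by (rule truncated_inverse_nonneg[OF A])
  have "(\<Sum>k\<in>A. ?X k * - q k i) = 1"
    using truncated_inverse[OF A] i by (auto simp: is_inverse_on_def)
  then have "sum ?X A \<noteq> 0" using sum_nonneg_eq_0_iff[of A ?X] A X0 by auto
  moreover have "0 \<le> sum ?X A" by (intro sum_nonneg X0)
  ultimately show ?thesis by simp
qed

end

section \<open>Discounted functionals of the jump chain\<close>

lemma nn_integral_exp_density_Icc:
  fixes a c d :: real
  assumes "a \<le> c" "0 < d"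
  shows "(\<integral>\<^sup>+s. ennreal (d * exp (- (d * s))) * indicator {a..c} s \<partial>lborel) = ennreal (exp (- (d * a)) - exp (- (d * c)))"
proof -
  have "(\<integral>\<^sup>+s. ennreal (d * exp (- (d * s))) * indicator {a..c} s \<partial>lborel)
      = ennreal ((- exp (- (d * c))) - (- exp (- (d * a))))"
    using assms by (intro nn_integral_FTC_Icc) (auto intro!: derivative_eq_intros)
  then show ?thesis by simp
qed

lemma nn_integral_exp_density:
  fixes d :: real
  assumes "0 < d"
  shows "(\<integral>\<^sup>+s. ennreal (d * exp (- (d * s))) * indicator {0..} s \<partial>lborel) = 1"
proof -
  have "((\<lambda>x::real. - exp (- (d * x))) \<longlongrightarrow> 0) at_top"
    using \<open>0 < d\<close> by real_asymp
  then have "(\<integral>\<^sup>+s. ennreal (d * exp (- (d * s))) * indicator {0..} s \<partial>lborel) = ennreal (0 - (- exp (- (d * 0))))"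
    using assms
    by (intro nn_integral_FTC_atLeast[where F="\<lambda>x. - exp (- (d * x))"]) (auto intro!: derivative_eq_intros)
  then show ?thesis by simp
qed

text \<open>
  The factor \<open>1 - exp (- \<beta> T)\<close> is the integral of the density \<open>\<beta> exp (- \<beta> s)\<close> over \<open>0 \<le> s < T\<close>. By
  Tonelli's theorem only the weighted tails of \<open>T\<close> matter, which is the form in which the joint law
  of a chain and its holding times is given. The second equation is the complement of the first.
\<close>

lemma nn_integral_exp_mixture:
  fixes T :: "'w \<Rightarrow> real" and Z :: "'w \<Rightarrow> ennreal" and c r \<beta> :: real
  assumes [measurable]: "T \<in> borel_measurable N" "Z \<in> borel_measurable N"
    and N: "sigma_finite_measure N" and \<beta>: "0 < \<beta>" and r: "0 \<le> r" and c: "0 \<le> c"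
    and tail: "\<And>t. 0 \<le> t \<Longrightarrow> (\<integral>\<^sup>+\<omega>. Z \<omega> * indicator {t<..} (T \<omega>) \<partial>N) = ennreal (c * exp (- (r * t)))"
  shows "(\<integral>\<^sup>+\<omega>. Z \<omega> * (indicator {0<..} (T \<omega>) * ennreal (1 - exp (- (\<beta> * T \<omega>)))) \<partial>N) = ennreal (c * (\<beta> / (r + \<beta>)))"
    and "(\<integral>\<^sup>+\<omega>. Z \<omega> * (indicator {0<..} (T \<omega>) * ennreal (exp (- (\<beta> * T \<omega>)))) \<partial>N) = ennreal (c * (r / (r + \<beta>)))"
proof -
  interpret N: sigma_finite_measure N by (rule N)
  interpret pair_sigma_finite lborel N ..
  have "(\<integral>\<^sup>+\<omega>. Z \<omega> * (indicator {0<..} (T \<omega>) * ennreal (1 - exp (- (\<beta> * T \<omega>)))) \<partial>N)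
     = (\<integral>\<^sup>+\<omega>. (\<integral>\<^sup>+s. Z \<omega> * (ennreal (\<beta> * exp (- (\<beta> * s))) * indicator {0..} s * indicator {s<..} (T \<omega>)) \<partial>lborel) \<partial>N)"
  proof (rule nn_integral_cong)
    fix \<omega> assume "\<omega> \<in> space N"
    have "(\<integral>\<^sup>+s. (ennreal (\<beta> * exp (- (\<beta> * s))) * indicator {0..} s * indicator {s<..} (T \<omega>)) \<partial>lborel)
       = indicator {0<..} (T \<omega>) * ennreal (1 - exp (- (\<beta> * T \<omega>)))"
    proof (cases "0 < T \<omega>")
      case True
      have "AE s in lborel. s \<noteq> T \<omega>" by (rule AE_lborel_singleton)
      then have "(\<integral>\<^sup>+s. (ennreal (\<beta> * exp (- (\<beta> * s))) * indicator {0..} s * indicator {s<..} (T \<omega>)) \<partial>lborel)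
        = (\<integral>\<^sup>+s. (ennreal (\<beta> * exp (- (\<beta> * s))) * indicator {0..T \<omega>} s) \<partial>lborel)"
        by (intro nn_integral_cong_AE) (auto elim!: eventually_mono simp: indicator_def)
      then show ?thesis using True nn_integral_exp_density_Icc[of 0 "T \<omega>" \<beta>] \<beta> by simp
    next
      case False
      have "(\<integral>\<^sup>+s. (ennreal (\<beta> * exp (- (\<beta> * s))) * indicator {0..} s * indicator {s<..} (T \<omega>)) \<partial>lborel)
        = (\<integral>\<^sup>+(s::real). 0 \<partial>lborel)"
        by (intro nn_integral_cong) (use False in \<open>auto simp: indicator_def\<close>)
      then show ?thesis using False by simp
    qed
    then show "Z \<omega> * (indicator {0<..} (T \<omega>) * ennreal (1 - exp (- (\<beta> * T \<omega>))))
      = (\<integral>\<^sup>+s. Z \<omega> * (ennreal (\<beta> * exp (- (\<beta> * s))) * indicator {0..} s * indicator {s<..} (T \<omega>)) \<partial>lborel)"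
      by (subst nn_integral_cmult) (auto simp: greaterThan_def)
  qed
  also have "\<dots> = (\<integral>\<^sup>+s. (\<integral>\<^sup>+\<omega>. Z \<omega> * (ennreal (\<beta> * exp (- (\<beta> * s))) * indicator {0..} s * indicator {s<..} (T \<omega>)) \<partial>N) \<partial>lborel)"
    by (subst Fubini') (auto simp: greaterThan_def)
  also have "\<dots> = (\<integral>\<^sup>+s. ennreal (c * \<beta> / (r + \<beta>)) * (ennreal ((r + \<beta>) * exp (- ((r + \<beta>) * s))) * indicator {0..} s) \<partial>lborel)"
  proof (rule nn_integral_cong)
    fix s :: real
    show "(\<integral>\<^sup>+\<omega>. Z \<omega> * (ennreal (\<beta> * exp (- (\<beta> * s))) * indicator {0..} s * indicator {s<..} (T \<omega>)) \<partial>N)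
      = ennreal (c * \<beta> / (r + \<beta>)) * (ennreal ((r + \<beta>) * exp (- ((r + \<beta>) * s))) * indicator {0..} s)"
    proof (cases "0 \<le> s")
      case True
      have "(\<integral>\<^sup>+\<omega>. Z \<omega> * (ennreal (\<beta> * exp (- (\<beta> * s))) * indicator {0..} s * indicator {s<..} (T \<omega>)) \<partial>N)
        = (\<integral>\<^sup>+\<omega>. ennreal (\<beta> * exp (- (\<beta> * s))) * (Z \<omega> * indicator {s<..} (T \<omega>)) \<partial>N)"
        using True by (intro nn_integral_cong) (auto simp: mult_ac)
      also have "\<dots> = ennreal (\<beta> * exp (- (\<beta> * s))) * ennreal (c * exp (- (r * s)))"
        by (subst nn_integral_cmult) (auto simp: tail[OF True])
      also have "\<dots> = ennreal (c * \<beta> / (r + \<beta>)) * (ennreal ((r + \<beta>) * exp (- ((r + \<beta>) * s))))"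
      proof -
        have "\<beta> * exp (- (\<beta> * s)) * (c * exp (- (r * s))) = c * \<beta> / (r + \<beta>) * ((r + \<beta>) * exp (- ((r + \<beta>) * s)))"
        proof -
          have "exp (- ((r + \<beta>) * s)) = exp (- (\<beta> * s)) * exp (- (r * s))"
            by (simp add: exp_add[symmetric] algebra_simps)
          then show ?thesis using \<beta> r by simp
        qed
        moreover have "0 \<le> \<beta> * exp (- (\<beta> * s))" "0 \<le> c * exp (- (r * s))"
          "0 \<le> c * \<beta> / (r + \<beta>)" "0 \<le> (r + \<beta>) * exp (- ((r + \<beta>) * s))"
          using \<beta> r c by auto
        ultimately show ?thesis by (simp only: ennreal_mult[symmetric])
      qed
      finally show ?thesis using True by simp
    qed auto
  qed
  also have "\<dots> = ennreal (c * \<beta> / (r + \<beta>))"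
    using \<beta> r by (subst nn_integral_cmult) (auto simp: nn_integral_exp_density)
  finally have 1: "(\<integral>\<^sup>+\<omega>. Z \<omega> * (indicator {0<..} (T \<omega>) * ennreal (1 - exp (- (\<beta> * T \<omega>)))) \<partial>N) = ennreal (c * \<beta> / (r + \<beta>))" .
  then show "(\<integral>\<^sup>+\<omega>. Z \<omega> * (indicator {0<..} (T \<omega>) * ennreal (1 - exp (- (\<beta> * T \<omega>)))) \<partial>N) = ennreal (c * (\<beta> / (r + \<beta>)))"
    by simp
  have "ennreal (c * \<beta> / (r + \<beta>)) + (\<integral>\<^sup>+\<omega>. Z \<omega> * (indicator {0<..} (T \<omega>) * ennreal (exp (- (\<beta> * T \<omega>)))) \<partial>N)
    = (\<integral>\<^sup>+\<omega>. Z \<omega> * (indicator {0<..} (T \<omega>) * ennreal (1 - exp (- (\<beta> * T \<omega>)))) + Z \<omega> * (indicator {0<..} (T \<omega>) * ennreal (exp (- (\<beta> * T \<omega>)))) \<partial>N)"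
    unfolding 1[symmetric] by (subst nn_integral_add) auto
  also have "\<dots> = (\<integral>\<^sup>+\<omega>. Z \<omega> * indicator {0<..} (T \<omega>) \<partial>N)"
    using \<beta> by (intro nn_integral_cong)
       (auto simp: indicator_def distrib_left[symmetric] ennreal_plus[symmetric] simp del: ennreal_plus)
  also have "\<dots> = ennreal c" using tail[of 0] by simp
  also have "\<dots> = ennreal (c * \<beta> / (r + \<beta>)) + ennreal (c * (r / (r + \<beta>)))"
  proof -
    have "c * \<beta> / (r + \<beta>) + c * (r / (r + \<beta>)) = (c * \<beta> + c * r) / (r + \<beta>)"
      by (simp add: add_divide_distrib)
    also have "c * \<beta> + c * r = c * (r + \<beta>)" by (simp add: algebra_simps)
    also have "c * (r + \<beta>) / (r + \<beta>) = c" using \<beta> r by simp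
    finally show ?thesis using \<beta> r c by (subst ennreal_plus[symmetric]) auto
  qed
  finally show "(\<integral>\<^sup>+\<omega>. Z \<omega> * (indicator {0<..} (T \<omega>) * ennreal (exp (- (\<beta> * T \<omega>)))) \<partial>N) = ennreal (c * (r / (r + \<beta>)))"
    by (subst (asm) ennreal_add_left_cancel) auto
qed

lemma nn_integral_partition:
  fixes g :: "'w \<Rightarrow> 'b :: countable"
  assumes [measurable]: "f \<in> borel_measurable N" "\<And>l. {\<omega> \<in> space N. g \<omega> = l} \<in> sets N"
  shows "(\<integral>\<^sup>+\<omega>. f \<omega> \<partial>N) =
    (\<integral>\<^sup>+l. (\<integral>\<^sup>+\<omega>. indicator {\<omega> \<in> space N. g \<omega> = l} \<omega> * f \<omega> \<partial>N) \<partial>count_space UNIV)"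
proof -
  have "f \<omega> = (\<integral>\<^sup>+l. indicator {\<omega> \<in> space N. g \<omega> = l} \<omega> * f \<omega> \<partial>count_space UNIV)" if "\<omega> \<in> space N" for \<omega>
  proof -
    have "(\<integral>\<^sup>+l. indicator {\<omega> \<in> space N. g \<omega> = l} \<omega> * f \<omega> \<partial>count_space UNIV)
      = (\<integral>\<^sup>+l. f \<omega> * indicator {g \<omega>} l \<partial>count_space UNIV)"
      using that by (intro nn_integral_cong) (auto simp: indicator_def)
    then show ?thesis by (simp add: nn_integral_cmult_indicator)
  qed
  then have "(\<integral>\<^sup>+\<omega>. f \<omega> \<partial>N) = (\<integral>\<^sup>+\<omega>. (\<integral>\<^sup>+l. indicator {\<omega> \<in> space N. g \<omega> = l} \<omega> * f \<omega> \<partial>count_space UNIV) \<partial>N)"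
    by (intro nn_integral_cong) auto
  also have "\<dots> = (\<integral>\<^sup>+l. (\<integral>\<^sup>+\<omega>. indicator {\<omega> \<in> space N. g \<omega> = l} \<omega> * f \<omega> \<partial>N) \<partial>count_space UNIV)"
    by (intro nn_integral_count_space_nn_integral) auto
  finally show ?thesis .
qed

text \<open>
  The value \<open>exp (- \<beta> T)\<close> for the \<open>n\<close>-th jump time \<open>T\<close>, set to zero once a holding time fails to be
  positive. With this null event built into the weight, the estimates below hold for every sample point.
\<close>

definition discount :: "(nat \<Rightarrow> 'w \<Rightarrow> real) \<Rightarrow> real \<Rightarrow> nat \<Rightarrow> 'w \<Rightarrow> ennreal" where
  "discount H \<beta> n \<omega> = (\<Prod>i<n. indicator {0<..} (H i \<omega>) * ennreal (exp (- (\<beta> * H i \<omega>))))"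

text \<open>
  Transition probabilities of the jump chain that is killed when an independent exponential clock of
  rate \<open>\<beta>\<close> rings before the jump.
\<close>

definition killed_step :: "('s \<Rightarrow> 's \<Rightarrow> real) \<Rightarrow> real \<Rightarrow> 's \<Rightarrow> 's \<Rightarrow> real" where
  "killed_step q \<beta> x y = \<bar>q x x\<bar> / (\<bar>q x x\<bar> + \<beta>) * jump_prob q x y"

locale markov_jump_chain =
  fixes S :: "'s :: countable set" and q :: "'s \<Rightarrow> 's \<Rightarrow> real"
    and Pr :: "'s \<Rightarrow> 'w measure" and Y :: "nat \<Rightarrow> 'w \<Rightarrow> 's" and H :: "nat \<Rightarrow> 'w \<Rightarrow> real"
    and \<beta> :: real and x :: 's
  assumes generator: "conservative_generator S q"
    and chain: "markov_chain_with_generator S q Pr Y H"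
    and regular: "regular_jump S Pr H"
    and beta_pos: "0 < \<beta>"
    and start: "x \<in> S"
begin

sublocale prob_space "Pr x"
  using chain start by (simp add: markov_chain_with_generator_def)

lemma Y_measurable[measurable]: "Y n \<in> measurable (Pr x) (count_space S)"
  and H_measurable[measurable]: "H n \<in> borel_measurable (Pr x)"
  using chain start by (auto simp: markov_chain_with_generator_def)

lemma Y_in: "\<omega> \<in> space (Pr x) \<Longrightarrow> Y n \<omega> \<in> S"
  using measurable_space[OF Y_measurable] by simp

lemma Y_measurable_UNIV[measurable]: "Y n \<in> measurable (Pr x) (count_space UNIV)"
  using measurable_compose[OF Y_measurable, of "\<lambda>y. y" "count_space UNIV" n] by simp

lemma discount_measurable[measurable]: "discount H \<beta> n \<in> borel_measurable (Pr x)"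
  unfolding discount_def[abs_def] by measurable

lemma discount_Suc:
  "discount H \<beta> (Suc n) \<omega> = discount H \<beta> n \<omega> * (indicator {0<..} (H n \<omega>) * ennreal (exp (- (\<beta> * H n \<omega>))))"
  by (simp add: discount_def)

lemma jump_prob_nonneg: "a \<in> S \<Longrightarrow> c \<in> S \<Longrightarrow> 0 \<le> jump_prob q a c"
  using generator by (auto simp: jump_prob_def conservative_generator_def)

lemma path_set[measurable]: "{\<omega> \<in> space (Pr x). \<forall>i\<le>n. Y i \<omega> = ys i} \<in> sets (Pr x)"
  by measurable

text \<open>
  Starting from the joint tail probabilities (\<open>m = 0\<close>), the tail indicators of the holding times are
  exchanged one at a time for discount factors: each exchange is one use of the exponential mixture
  formula, the remaining factors being the weight \<open>Z\<close>.
\<close>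

lemma path_discount:
  assumes "\<And>i. i \<le> n \<Longrightarrow> ys i \<in> S" "\<And>i. i \<le> n \<Longrightarrow> 0 \<le> ts i" "m \<le> Suc n"
  shows "(\<integral>\<^sup>+\<omega>. indicator {\<omega> \<in> space (Pr x). \<forall>i\<le>n. Y i \<omega> = ys i} \<omega> * discount H \<beta> m \<omega> *
       (\<Prod>i\<in>{m..n}. indicator {ts i<..} (H i \<omega>)) \<partial>Pr x)
    = ennreal ((if ys 0 = x then 1 else 0) * (\<Prod>i<n. jump_prob q (ys i) (ys (Suc i))) *
       (\<Prod>i<m. \<bar>q (ys i) (ys i)\<bar> / (\<bar>q (ys i) (ys i)\<bar> + \<beta>)) *
       (\<Prod>i\<in>{m..n}. exp (- (\<bar>q (ys i) (ys i)\<bar> * ts i))))"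
  using assms(2,3)
proof (induction m arbitrary: ts)
  case 0
  let ?E = "{\<omega> \<in> space (Pr x). \<forall>i\<le>n. Y i \<omega> = ys i \<and> ts i < H i \<omega>}"
  have "(\<integral>\<^sup>+\<omega>. indicator {\<omega> \<in> space (Pr x). \<forall>i\<le>n. Y i \<omega> = ys i} \<omega> * discount H \<beta> 0 \<omega> *
       (\<Prod>i\<in>{0..n}. indicator {ts i<..} (H i \<omega>)) \<partial>Pr x) = (\<integral>\<^sup>+\<omega>. indicator ?E \<omega> \<partial>Pr x)"
  proof (intro nn_integral_cong)
    fix \<omega> assume "\<omega> \<in> space (Pr x)"
    have "(\<Prod>i\<in>{0..n}. indicator {ts i<..} (H i \<omega>)) = (if \<forall>i\<le>n. ts i < H i \<omega> then 1 else 0 :: ennreal)"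
    proof (cases "\<forall>i\<le>n. ts i < H i \<omega>")
      case False
      then obtain i where "i \<le> n" "\<not> ts i < H i \<omega>" by auto
      then have "(\<Prod>i\<in>{0..n}. indicator {ts i<..} (H i \<omega>)) = (0 :: ennreal)"
        by (intro prod_zero bexI[of _ i]) auto
      then show ?thesis using False by simp
    qed auto
    then show "indicator {\<omega> \<in> space (Pr x). \<forall>i\<le>n. Y i \<omega> = ys i} \<omega> * discount H \<beta> 0 \<omega> *
       (\<Prod>i\<in>{0..n}. indicator {ts i<..} (H i \<omega>)) = (indicator ?E \<omega> :: ennreal)"
      by (auto simp: discount_def indicator_def)
  qed
  also have "\<dots> = ennreal (measure (Pr x) ?E)"
    by (subst nn_integral_indicator) (auto simp: emeasure_eq_measure)
  also have "measure (Pr x) ?E = (if ys 0 = x then 1 else 0) *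
           (\<Prod>i<n. jump_prob q (ys i) (ys (Suc i))) *
           (\<Prod>i\<le>n. exp (- (\<bar>q (ys i) (ys i)\<bar> * ts i)))"
    using chain start assms(1) 0 unfolding markov_chain_with_generator_def by blast
  finally show ?case by (simp add: atLeast0AtMost)
next
  case (Suc m)
  then have m: "m \<le> n" by simp
  let ?c = "(if ys 0 = x then 1 else 0) * (\<Prod>i<n. jump_prob q (ys i) (ys (Suc i))) *
       (\<Prod>i<m. \<bar>q (ys i) (ys i)\<bar> / (\<bar>q (ys i) (ys i)\<bar> + \<beta>)) *
       (\<Prod>i\<in>{Suc m..n}. exp (- (\<bar>q (ys i) (ys i)\<bar> * ts i)))"
  let ?Z = "\<lambda>\<omega>. indicator {\<omega> \<in> space (Pr x). \<forall>i\<le>n. Y i \<omega> = ys i} \<omega> * discount H \<beta> m \<omega> *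
       (\<Prod>i\<in>{Suc m..n}. indicator {ts i<..} (H i \<omega>))"
  have "(\<integral>\<^sup>+\<omega>. ?Z \<omega> * (indicator {0<..} (H m \<omega>) * ennreal (exp (- (\<beta> * H m \<omega>)))) \<partial>Pr x)
     = ennreal (?c * (\<bar>q (ys m) (ys m)\<bar> / (\<bar>q (ys m) (ys m)\<bar> + \<beta>)))"
  proof (rule nn_integral_exp_mixture(2))
    show "0 \<le> ?c" using assms(1) beta_pos
      by (intro mult_nonneg_nonneg prod_nonneg) (auto intro!: jump_prob_nonneg)
    fix t :: real assume t: "0 \<le> t"
    have "\<And>i. i \<le> n \<Longrightarrow> 0 \<le> (ts(m := t)) i" using Suc.prems t by auto
    from Suc.IH[OF this] m
    have "(\<integral>\<^sup>+\<omega>. indicator {\<omega> \<in> space (Pr x). \<forall>i\<le>n. Y i \<omega> = ys i} \<omega> * discount H \<beta> m \<omega> *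
       (\<Prod>i\<in>{m..n}. indicator {(ts(m := t)) i<..} (H i \<omega>)) \<partial>Pr x)
    = ennreal ((if ys 0 = x then 1 else 0) * (\<Prod>i<n. jump_prob q (ys i) (ys (Suc i))) *
       (\<Prod>i<m. \<bar>q (ys i) (ys i)\<bar> / (\<bar>q (ys i) (ys i)\<bar> + \<beta>)) *
       (\<Prod>i\<in>{m..n}. exp (- (\<bar>q (ys i) (ys i)\<bar> * (ts(m := t)) i))))" by auto
    moreover have "(\<Prod>i\<in>{m..n}. exp (- (\<bar>q (ys i) (ys i)\<bar> * (ts(m := t)) i)))
       = exp (- (\<bar>q (ys m) (ys m)\<bar> * t)) * (\<Prod>i\<in>{Suc m..n}. exp (- (\<bar>q (ys i) (ys i)\<bar> * ts i)))"
      by (subst prod.atLeast_Suc_atMost[OF m]) (auto intro!: prod.cong)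
    moreover have "(\<Prod>i\<in>{m..n}. indicator {(ts(m := t)) i<..} (H i \<omega>))
       = (indicator {t<..} (H m \<omega>) * (\<Prod>i\<in>{Suc m..n}. indicator {ts i<..} (H i \<omega>)) :: ennreal)" for \<omega>
      by (subst prod.atLeast_Suc_atMost[OF m]) (auto intro!: prod.cong)
    ultimately show "(\<integral>\<^sup>+\<omega>. ?Z \<omega> * indicator {t<..} (H m \<omega>) \<partial>Pr x) = ennreal (?c * exp (- (\<bar>q (ys m) (ys m)\<bar> * t)))"
      by (simp add: mult_ac)
  qed (auto intro: sigma_finite_measure_axioms beta_pos)
  then show ?case by (simp add: discount_Suc mult_ac)
qed

text \<open>
  \<open>W n\<close> is the discount accumulated at the \<open>n\<close>-th jump, and \<open>\<theta> n\<close> is the part of it that is lost during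
  the sojourn that follows, that is, the mass that an exponential clock of rate \<open>\<beta>\<close> puts on that sojourn.
\<close>

abbreviation W :: "nat \<Rightarrow> 'w \<Rightarrow> ennreal" where
  "W n \<omega> \<equiv> discount H \<beta> n \<omega> * indicator {0<..} (H n \<omega>)"

abbreviation \<theta> :: "nat \<Rightarrow> 'w \<Rightarrow> ennreal" where
  "\<theta> n \<omega> \<equiv> discount H \<beta> n \<omega> * (indicator {0<..} (H n \<omega>) * ennreal (1 - exp (- (\<beta> * H n \<omega>))))"

abbreviation trajectory :: "nat \<Rightarrow> (nat \<Rightarrow> 's) \<Rightarrow> 'w set" where
  "trajectory n ys \<equiv> {\<omega> \<in> space (Pr x). \<forall>i\<le>n. Y i \<omega> = ys i}"

lemma path_W:
  assumes "\<And>i. i \<le> n \<Longrightarrow> ys i \<in> S"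
  shows "(\<integral>\<^sup>+\<omega>. indicator (trajectory n ys) \<omega> * W n \<omega> \<partial>Pr x)
    = ennreal ((if ys 0 = x then 1 else 0) * (\<Prod>i<n. jump_prob q (ys i) (ys (Suc i))) *
       (\<Prod>i<n. \<bar>q (ys i) (ys i)\<bar> / (\<bar>q (ys i) (ys i)\<bar> + \<beta>)))"
  using path_discount[of n ys "\<lambda>_. 0" n] assms by (simp add: mult_ac)

lemma path_W_Suc:
  assumes "\<And>i. i \<le> n \<Longrightarrow> ys i \<in> S" "z \<in> S"
  shows "(\<integral>\<^sup>+\<omega>. indicator (trajectory n ys) \<omega> * indicator {z} (Y (Suc n) \<omega>) * W (Suc n) \<omega> \<partial>Pr x)
    = (\<integral>\<^sup>+\<omega>. indicator (trajectory n ys) \<omega> * W n \<omega> \<partial>Pr x) * ennreal (killed_step q \<beta> (ys n) z)"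
proof -
  let ?ys = "ys(Suc n := z)"
  have eq: "indicator (trajectory n ys) \<omega> * indicator {z} (Y (Suc n) \<omega>) = (indicator (trajectory (Suc n) ?ys) \<omega> :: ennreal)" for \<omega>
    by (auto simp: indicator_def le_Suc_eq)
  have "(\<integral>\<^sup>+\<omega>. indicator (trajectory n ys) \<omega> * indicator {z} (Y (Suc n) \<omega>) * W (Suc n) \<omega> \<partial>Pr x)
    = ennreal ((if ys 0 = x then 1 else 0) * ((\<Prod>i<n. jump_prob q (ys i) (ys (Suc i))) * jump_prob q (ys n) z) *
       (\<Prod>i<Suc n. \<bar>q (ys i) (ys i)\<bar> / (\<bar>q (ys i) (ys i)\<bar> + \<beta>)))"
    unfolding eq using assms by (subst path_W) auto
  also have "\<dots> = ennreal ((if ys 0 = x then 1 else 0) * (\<Prod>i<n. jump_prob q (ys i) (ys (Suc i))) *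
       (\<Prod>i<n. \<bar>q (ys i) (ys i)\<bar> / (\<bar>q (ys i) (ys i)\<bar> + \<beta>)) * killed_step q \<beta> (ys n) z)"
    by (simp add: killed_step_def mult_ac)
  also have "\<dots> = (\<integral>\<^sup>+\<omega>. indicator (trajectory n ys) \<omega> * W n \<omega> \<partial>Pr x) * ennreal (killed_step q \<beta> (ys n) z)"
  proof -
    have "0 \<le> killed_step q \<beta> (ys n) z"
      unfolding killed_step_def using assms beta_pos
      by (intro mult_nonneg_nonneg jump_prob_nonneg) auto
    then show ?thesis by (simp add: path_W[of n ys] assms(1) ennreal_mult'')
  qed
  finally show ?thesis .
qed

lemma path_\<theta>:
  assumes "\<And>i. i \<le> n \<Longrightarrow> ys i \<in> S"
  shows "(\<integral>\<^sup>+\<omega>. indicator (trajectory n ys) \<omega> * \<theta> n \<omega> \<partial>Pr x)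
    = (\<integral>\<^sup>+\<omega>. indicator (trajectory n ys) \<omega> * W n \<omega> \<partial>Pr x) * ennreal (\<beta> / (\<bar>q (ys n) (ys n)\<bar> + \<beta>))"
proof -
  let ?c = "(if ys 0 = x then 1 else 0) * (\<Prod>i<n. jump_prob q (ys i) (ys (Suc i))) *
       (\<Prod>i<n. \<bar>q (ys i) (ys i)\<bar> / (\<bar>q (ys i) (ys i)\<bar> + \<beta>))"
  have c: "0 \<le> ?c" using assms beta_pos
    by (intro mult_nonneg_nonneg prod_nonneg) (auto intro!: jump_prob_nonneg)
  have "(\<integral>\<^sup>+\<omega>. indicator (trajectory n ys) \<omega> * discount H \<beta> n \<omega> * (indicator {0<..} (H n \<omega>) * ennreal (1 - exp (- (\<beta> * H n \<omega>)))) \<partial>Pr x)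
     = ennreal (?c * (\<beta> / (\<bar>q (ys n) (ys n)\<bar> + \<beta>)))"
  proof (rule nn_integral_exp_mixture(1))
    fix t :: real assume "0 \<le> t"
    then show "(\<integral>\<^sup>+\<omega>. indicator (trajectory n ys) \<omega> * discount H \<beta> n \<omega> * indicator {t<..} (H n \<omega>) \<partial>Pr x)
       = ennreal (?c * exp (- (\<bar>q (ys n) (ys n)\<bar> * t)))"
      using path_discount[of n ys "\<lambda>_. t" n] assms by simp
  qed (use c in \<open>auto intro: sigma_finite_measure_axioms beta_pos\<close>)
  then have "(\<integral>\<^sup>+\<omega>. indicator (trajectory n ys) \<omega> * \<theta> n \<omega> \<partial>Pr x) = ennreal (?c * (\<beta> / (\<bar>q (ys n) (ys n)\<bar> + \<beta>)))"
    by (simp only: mult.assoc)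
  also have "\<dots> = ennreal ?c * ennreal (\<beta> / (\<bar>q (ys n) (ys n)\<bar> + \<beta>))"
    by (rule ennreal_mult'') (use beta_pos in auto)
  also have "ennreal ?c = (\<integral>\<^sup>+\<omega>. indicator (trajectory n ys) \<omega> * W n \<omega> \<partial>Pr x)"
    using path_W[of n ys] assms by simp
  finally show ?thesis .
qed

text \<open>
  As the state space is countable, an integral is the sum of its parts over all possible initial
  segments of the jump chain, and on each part the law is explicit.
\<close>

lemma path_cong_nn_integral:
  assumes [measurable]: "f \<in> borel_measurable (Pr x)" "g \<in> borel_measurable (Pr x)"
  assumes eq: "\<And>ys. (\<And>i. i \<le> n \<Longrightarrow> ys i \<in> S) \<Longrightarrow>
     (\<integral>\<^sup>+\<omega>. indicator (trajectory n ys) \<omega> * f \<omega> \<partial>Pr x) = (\<integral>\<^sup>+\<omega>. indicator (trajectory n ys) \<omega> * g \<omega> \<partial>Pr x)"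
  shows "(\<integral>\<^sup>+\<omega>. f \<omega> \<partial>Pr x) = (\<integral>\<^sup>+\<omega>. g \<omega> \<partial>Pr x)"
proof -
  define h where "h \<omega> = map (\<lambda>i. Y i \<omega>) [0..<Suc n]" for \<omega>
  have h_eq: "h \<omega> = l \<longleftrightarrow> length l = Suc n \<and> (\<forall>i\<le>n. Y i \<omega> = l ! i)" for l \<omega>
    by (auto simp: h_def list_eq_iff_nth_eq simp del: upt_Suc)
  have set: "{\<omega> \<in> space (Pr x). h \<omega> = l} = (if length l = Suc n then trajectory n (\<lambda>i. l ! i) else {})" for l
    by (auto simp: h_eq)
  have "(\<integral>\<^sup>+\<omega>. indicator {\<omega> \<in> space (Pr x). h \<omega> = l} \<omega> * f \<omega> \<partial>Pr x)
    = (\<integral>\<^sup>+\<omega>. indicator {\<omega> \<in> space (Pr x). h \<omega> = l} \<omega> * g \<omega> \<partial>Pr x)" for l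
  proof (cases "length l = Suc n \<and> (\<forall>i\<le>n. l ! i \<in> S)")
    case True
    then show ?thesis using eq[of "\<lambda>i. l ! i"] by (simp add: set)
  next
    case False
    then have "{\<omega> \<in> space (Pr x). h \<omega> = l} = {}" by (auto simp: h_eq) (metis Y_in)
    then show ?thesis by simp
  qed
  moreover have "{\<omega> \<in> space (Pr x). h \<omega> = l} \<in> sets (Pr x)" for l
    unfolding set by auto
  ultimately show ?thesis
    by (subst (1 2) nn_integral_partition[where g = h]) auto
qed

text \<open>
  The Markov property of the discounted jump chain: one more step applies the kernel
  \<^const>\<open>killed_step\<close> to the test function.
\<close>

lemma W_step:
  fixes g :: "'s \<Rightarrow> ennreal"
  shows "(\<integral>\<^sup>+\<omega>. W (Suc n) \<omega> * g (Y (Suc n) \<omega>) \<partial>Pr x)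
    = (\<integral>\<^sup>+\<omega>. W n \<omega> * (\<integral>\<^sup>+z. ennreal (killed_step q \<beta> (Y n \<omega>) z) * g z \<partial>count_space S) \<partial>Pr x)"
proof (rule path_cong_nn_integral)
  fix ys assume ys: "\<And>i. i \<le> n \<Longrightarrow> ys i \<in> S"
  let ?Kg = "\<lambda>y. \<integral>\<^sup>+z. ennreal (killed_step q \<beta> y z) * g z \<partial>count_space S"
  have "(\<integral>\<^sup>+\<omega>. indicator (trajectory n ys) \<omega> * (W (Suc n) \<omega> * g (Y (Suc n) \<omega>)) \<partial>Pr x)
    = (\<integral>\<^sup>+\<omega>. (\<integral>\<^sup>+z. g z * (indicator (trajectory n ys) \<omega> * indicator {z} (Y (Suc n) \<omega>) * W (Suc n) \<omega>) \<partial>count_space S) \<partial>Pr x)"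
  proof (rule nn_integral_cong)
    fix \<omega> assume "\<omega> \<in> space (Pr x)"
    then have "Y (Suc n) \<omega> \<in> S" by (rule Y_in)
    have "(\<integral>\<^sup>+z. g z * (indicator (trajectory n ys) \<omega> * indicator {z} (Y (Suc n) \<omega>) * W (Suc n) \<omega>) \<partial>count_space S)
      = (\<integral>\<^sup>+z. g (Y (Suc n) \<omega>) * (indicator (trajectory n ys) \<omega> * W (Suc n) \<omega>) * indicator {Y (Suc n) \<omega>} z \<partial>count_space S)"
      by (intro nn_integral_cong) (auto simp: indicator_def)
    also have "\<dots> = g (Y (Suc n) \<omega>) * (indicator (trajectory n ys) \<omega> * W (Suc n) \<omega>)"
      using \<open>Y (Suc n) \<omega> \<in> S\<close> by (subst nn_integral_cmult_indicator) auto
    finally show "indicator (trajectory n ys) \<omega> * (W (Suc n) \<omega> * g (Y (Suc n) \<omega>)) =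
       (\<integral>\<^sup>+z. g z * (indicator (trajectory n ys) \<omega> * indicator {z} (Y (Suc n) \<omega>) * W (Suc n) \<omega>) \<partial>count_space S)"
      by (simp add: mult_ac)
  qed
  also have "\<dots> = (\<integral>\<^sup>+z. (\<integral>\<^sup>+\<omega>. g z * (indicator (trajectory n ys) \<omega> * indicator {z} (Y (Suc n) \<omega>) * W (Suc n) \<omega>) \<partial>Pr x) \<partial>count_space S)"
    by (intro nn_integral_count_space_nn_integral) auto
  also have "\<dots> = (\<integral>\<^sup>+z. (\<integral>\<^sup>+\<omega>. indicator (trajectory n ys) \<omega> * W n \<omega> \<partial>Pr x) * (ennreal (killed_step q \<beta> (ys n) z) * g z) \<partial>count_space S)"
  proof (rule nn_integral_cong)
    fix z assume "z \<in> space (count_space S)"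
    then have "z \<in> S" by simp
    have "(\<integral>\<^sup>+\<omega>. g z * (indicator (trajectory n ys) \<omega> * indicator {z} (Y (Suc n) \<omega>) * W (Suc n) \<omega>) \<partial>Pr x)
      = g z * (\<integral>\<^sup>+\<omega>. indicator (trajectory n ys) \<omega> * indicator {z} (Y (Suc n) \<omega>) * W (Suc n) \<omega> \<partial>Pr x)"
      by (rule nn_integral_cmult) measurable
    also have "\<dots> = (\<integral>\<^sup>+\<omega>. indicator (trajectory n ys) \<omega> * W n \<omega> \<partial>Pr x) * (ennreal (killed_step q \<beta> (ys n) z) * g z)"
      using path_W_Suc[of n ys z] ys \<open>z \<in> S\<close> by (simp add: mult_ac)
    finally show "(\<integral>\<^sup>+\<omega>. g z * (indicator (trajectory n ys) \<omega> * indicator {z} (Y (Suc n) \<omega>) * W (Suc n) \<omega>) \<partial>Pr x)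
      = (\<integral>\<^sup>+\<omega>. indicator (trajectory n ys) \<omega> * W n \<omega> \<partial>Pr x) * (ennreal (killed_step q \<beta> (ys n) z) * g z)" .
  qed
  also have "\<dots> = (\<integral>\<^sup>+\<omega>. indicator (trajectory n ys) \<omega> * W n \<omega> \<partial>Pr x) * ?Kg (ys n)"
    by (rule nn_integral_cmult) measurable
  also have "\<dots> = (\<integral>\<^sup>+\<omega>. indicator (trajectory n ys) \<omega> * W n \<omega> * ?Kg (ys n) \<partial>Pr x)"
    by (rule nn_integral_multc[symmetric]) measurable
  also have "\<dots> = (\<integral>\<^sup>+\<omega>. indicator (trajectory n ys) \<omega> * (W n \<omega> * ?Kg (Y n \<omega>)) \<partial>Pr x)"
    by (intro nn_integral_cong) (auto simp: indicator_def)
  finally show "(\<integral>\<^sup>+\<omega>. indicator (trajectory n ys) \<omega> * (W (Suc n) \<omega> * g (Y (Suc n) \<omega>)) \<partial>Pr x)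
    = (\<integral>\<^sup>+\<omega>. indicator (trajectory n ys) \<omega> * (W n \<omega> * ?Kg (Y n \<omega>)) \<partial>Pr x)" .
qed measurable

lemma \<theta>_eq_W:
  fixes g :: "'s \<Rightarrow> ennreal"
  shows "(\<integral>\<^sup>+\<omega>. \<theta> n \<omega> * g (Y n \<omega>) \<partial>Pr x)
    = (\<integral>\<^sup>+\<omega>. W n \<omega> * (ennreal (\<beta> / (\<bar>q (Y n \<omega>) (Y n \<omega>)\<bar> + \<beta>)) * g (Y n \<omega>)) \<partial>Pr x)"
proof (rule path_cong_nn_integral)
  fix ys assume ys: "\<And>i. i \<le> n \<Longrightarrow> ys i \<in> S"
  let ?e = "\<lambda>y. ennreal (\<beta> / (\<bar>q y y\<bar> + \<beta>)) * g y"
  have "(\<integral>\<^sup>+\<omega>. indicator (trajectory n ys) \<omega> * (\<theta> n \<omega> * g (Y n \<omega>)) \<partial>Pr x)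
    = (\<integral>\<^sup>+\<omega>. indicator (trajectory n ys) \<omega> * \<theta> n \<omega> * g (ys n) \<partial>Pr x)"
    by (intro nn_integral_cong) (auto simp: indicator_def)
  also have "\<dots> = (\<integral>\<^sup>+\<omega>. indicator (trajectory n ys) \<omega> * W n \<omega> \<partial>Pr x) * ?e (ys n)"
    using path_\<theta>[of n ys] ys by (subst nn_integral_multc) (auto simp: mult_ac)
  also have "\<dots> = (\<integral>\<^sup>+\<omega>. indicator (trajectory n ys) \<omega> * W n \<omega> * ?e (ys n) \<partial>Pr x)"
    by (rule nn_integral_multc[symmetric]) measurable
  also have "\<dots> = (\<integral>\<^sup>+\<omega>. indicator (trajectory n ys) \<omega> * (W n \<omega> * ?e (Y n \<omega>)) \<partial>Pr x)"
    by (intro nn_integral_cong) (auto simp: indicator_def)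
  finally show "(\<integral>\<^sup>+\<omega>. indicator (trajectory n ys) \<omega> * (\<theta> n \<omega> * g (Y n \<omega>)) \<partial>Pr x)
    = (\<integral>\<^sup>+\<omega>. indicator (trajectory n ys) \<omega> * (W n \<omega> * ?e (Y n \<omega>)) \<partial>Pr x)" .
qed measurable

lemma jump_time_measurable[measurable]: "jump_time H n \<in> borel_measurable (Pr x)"
  unfolding jump_time_def[abs_def] by measurable

lemma chain_at_measurable_pair[measurable]:
  "(\<lambda>(t, \<omega>). chain_at Y H t \<omega>) \<in> measurable (lborel \<Otimes>\<^sub>M Pr x) (count_space UNIV)"
  unfolding chain_at_def split_beta' by measurable

lemma chain_at_measurable[measurable]: "chain_at Y H t \<in> measurable (Pr x) (count_space UNIV)"
  unfolding chain_at_def by measurable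

lemma discount_eq:
  assumes "\<And>i. i < n \<Longrightarrow> 0 < H i \<omega>"
  shows "discount H \<beta> n \<omega> = ennreal (exp (- (\<beta> * jump_time H n \<omega>)))"
  using assms
proof (induction n)
  case (Suc n)
  then show ?case
    by (simp add: discount_Suc ennreal_mult[symmetric] exp_add[symmetric] jump_time_def distrib_left)
qed (simp add: discount_def jump_time_def)

lemma discount_eq_0: "i < n \<Longrightarrow> H i \<omega> \<le> 0 \<Longrightarrow> discount H \<beta> n \<omega> = 0"
  unfolding discount_def by (intro prod_zero bexI[of _ i]) (auto simp: indicator_def)

lemma jump_time_mono:
  assumes "\<And>i. i < n \<Longrightarrow> 0 < H i \<omega>" "m \<le> n"
  shows "jump_time H m \<omega> \<le> jump_time H n \<omega>"
  unfolding jump_time_def using assms by (intro sum_mono2) (auto intro: less_imp_le)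

lemma chain_at_eq:
  assumes "\<And>i. i \<le> n \<Longrightarrow> 0 < H i \<omega>" "jump_time H n \<omega> \<le> t" "t < jump_time H (Suc n) \<omega>"
  shows "(LEAST n. t < jump_time H (Suc n) \<omega>) = n"
proof (rule Least_equality)
  fix m assume m: "t < jump_time H (Suc m) \<omega>"
  show "n \<le> m"
  proof (rule ccontr)
    assume "\<not> n \<le> m"
    then have "jump_time H (Suc m) \<omega> \<le> jump_time H n \<omega>"
      using assms(1) by (intro jump_time_mono) auto
    then show False using m assms(2) by simp
  qed
qed (use assms in simp)

lemma \<theta>_eq_integral:
  "\<theta> n \<omega> = (\<integral>\<^sup>+t. ennreal (\<beta> * exp (- (\<beta> * t))) * indicator {0..} t *
     indicator {t. (\<forall>i\<le>n. 0 < H i \<omega>) \<and> jump_time H n \<omega> \<le> t \<and> t < jump_time H (Suc n) \<omega>} t \<partial>lborel)"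
proof (cases "\<forall>i\<le>n. 0 < H i \<omega>")
  case True
  let ?a = "jump_time H n \<omega>" and ?b = "jump_time H (Suc n) \<omega>"
  have "0 \<le> ?a" unfolding jump_time_def using True by (intro sum_nonneg) (auto intro: less_imp_le)
  moreover have "?b = ?a + H n \<omega>" by (simp add: jump_time_def)
  moreover have "0 < H n \<omega>" using True by simp
  ultimately have ab: "0 \<le> ?a" "?a \<le> ?b" "?b = ?a + H n \<omega>" by simp_all
  have "AE t in lborel. t \<noteq> ?b" by (rule AE_lborel_singleton)
  then have "(\<integral>\<^sup>+t. ennreal (\<beta> * exp (- (\<beta> * t))) * indicator {0..} t *
     indicator {t. (\<forall>i\<le>n. 0 < H i \<omega>) \<and> ?a \<le> t \<and> t < ?b} t \<partial>lborel)
    = (\<integral>\<^sup>+t. ennreal (\<beta> * exp (- (\<beta> * t))) * indicator {?a..?b} t \<partial>lborel)"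
    using True ab
    by (intro nn_integral_cong_AE) (auto elim!: eventually_mono simp: indicator_def)
  also have "\<dots> = ennreal (exp (- (\<beta> * ?a)) - exp (- (\<beta> * ?b)))"
    by (rule nn_integral_exp_density_Icc[OF ab(2) beta_pos])
  also have "exp (- (\<beta> * ?a)) - exp (- (\<beta> * ?b)) = exp (- (\<beta> * ?a)) * (1 - exp (- (\<beta> * H n \<omega>)))"
    by (simp add: ab(3) algebra_simps exp_add[symmetric])
  also have "ennreal \<dots> = ennreal (exp (- (\<beta> * ?a))) * ennreal (1 - exp (- (\<beta> * H n \<omega>)))"
    using beta_pos True by (intro ennreal_mult) auto
  finally show ?thesis using True by (simp add: discount_eq)
next
  case False
  then obtain i where i: "i \<le> n" "H i \<omega> \<le> 0" by (auto simp: not_less)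
  then have "\<theta> n \<omega> = 0" using discount_eq_0[of i n \<omega>] by (cases "i = n") auto
  then show ?thesis using False by simp
qed

text \<open>
  The law of the chain at an independent exponential time of rate \<open>\<beta>\<close>, that is, a row of the resolvent
  kernel evaluated at a set.
\<close>

definition occ :: "'s set \<Rightarrow> ennreal" where
  "occ B = (\<integral>\<^sup>+t. ennreal (\<beta> * exp (- (\<beta> * t))) * indicator {0..} t *
     emeasure (Pr x) {\<omega> \<in> space (Pr x). chain_at Y H t \<omega> \<in> B} \<partial>lborel)"

lemma nn_integral_chain_at:
  "(\<integral>\<^sup>+\<omega>. indicator B (chain_at Y H t \<omega>) \<partial>Pr x) = emeasure (Pr x) {\<omega> \<in> space (Pr x). chain_at Y H t \<omega> \<in> B}"
proof -
  have "(\<integral>\<^sup>+\<omega>. indicator B (chain_at Y H t \<omega>) \<partial>Pr x)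
    = (\<integral>\<^sup>+\<omega>. indicator {\<omega> \<in> space (Pr x). chain_at Y H t \<omega> \<in> B} \<omega> \<partial>Pr x)"
    by (intro nn_integral_cong) (simp add: indicator_def)
  also have "\<dots> = emeasure (Pr x) {\<omega> \<in> space (Pr x). chain_at Y H t \<omega> \<in> B}"
    by (rule nn_integral_indicator) measurable
  finally show ?thesis .
qed

lemma emeasure_chain_at_measurable[measurable]:
  "(\<lambda>t. emeasure (Pr x) {\<omega> \<in> space (Pr x). chain_at Y H t \<omega> \<in> B}) \<in> borel_measurable lborel"
proof -
  have [measurable]: "B \<in> sets (count_space UNIV)" by simp
  have "(\<lambda>t. \<integral>\<^sup>+\<omega>. indicator B (chain_at Y H t \<omega>) \<partial>Pr x) \<in> borel_measurable lborel"
    using measurable_compose[OF chain_at_measurable_pair, of "indicator B" borel]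
    by (intro borel_measurable_nn_integral) (simp add: split_beta')
  then show ?thesis by (simp add: nn_integral_chain_at)
qed

lemma occ_UNIV: "occ UNIV = 1"
  by (simp add: occ_def emeasure_space_1 nn_integral_exp_density beta_pos)

lemma occ_insert: "y \<notin> B \<Longrightarrow> occ (insert y B) = occ {y} + occ B"
proof -
  assume "y \<notin> B"
  have "emeasure (Pr x) {\<omega> \<in> space (Pr x). chain_at Y H t \<omega> \<in> insert y B}
     = emeasure (Pr x) {\<omega> \<in> space (Pr x). chain_at Y H t \<omega> \<in> {y}}
     + emeasure (Pr x) {\<omega> \<in> space (Pr x). chain_at Y H t \<omega> \<in> B}" for t
    using \<open>y \<notin> B\<close> by (subst plus_emeasure) (auto intro!: arg_cong[where f="emeasure (Pr x)"])
  then show ?thesis unfolding occ_def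
    by (subst nn_integral_add[symmetric]) (auto simp: distrib_left)
qed

lemma occ_resolvent: "occ {y} = ennreal (resolvent (transition_prob Pr Y H) \<beta> x y)"
proof -
  let ?f = "\<lambda>t. \<beta> * exp (- \<beta> * t) * transition_prob Pr Y H t x y"
  have eq: "ennreal (\<beta> * exp (- (\<beta> * t))) * indicator {0..} t * emeasure (Pr x) {\<omega> \<in> space (Pr x). chain_at Y H t \<omega> \<in> {y}}
     = ennreal (indicator {0..} t *\<^sub>R ?f t)" for t
    using beta_pos by (auto simp: transition_prob_def emeasure_eq_measure ennreal_mult indicator_def)
  have [measurable]: "(\<lambda>t. transition_prob Pr Y H t x y) \<in> borel_measurable borel"
    using emeasure_chain_at_measurable[of "{y}"] unfolding transition_prob_def measure_def by simp
  have "occ {y} \<le> occ UNIV"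
    unfolding occ_def by (intro nn_integral_mono mult_left_mono emeasure_mono) auto
  then have le: "occ {y} \<le> 1" by (simp add: occ_UNIV)
  have "resolvent (transition_prob Pr Y H) \<beta> x y = enn2real (\<integral>\<^sup>+t. ennreal (indicator {0..} t *\<^sub>R ?f t) \<partial>lborel)"
    unfolding resolvent_def set_lebesgue_integral_def
    using beta_pos by (intro integral_eq_nn_integral) (auto simp: transition_prob_def)
  also have "\<dots> = enn2real (occ {y})"
    by (simp only: occ_def eq)
  finally have "ennreal (resolvent (transition_prob Pr Y H) \<beta> x y) = ennreal (enn2real (occ {y}))"
    by simp
  also have "\<dots> = occ {y}"
    using le by (intro ennreal_enn2real) (auto intro: le_less_trans)
  finally show ?thesis ..
qed

text \<open>
  The intervals between successive jump times are disjoint, and on each of them the chain stays in the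
  state of the jump chain; so the masses \<open>\<theta>\<close> are disjoint pieces of the exponential law.
\<close>

lemma sum_\<theta>_le_occ: "(\<Sum>n<N. \<integral>\<^sup>+\<omega>. \<theta> n \<omega> * indicator B (Y n \<omega>) \<partial>Pr x) \<le> occ B"
proof -
  interpret pair_sigma_finite lborel "Pr x" ..
  let ?J = "\<lambda>n \<omega>. {t. (\<forall>i\<le>n. 0 < H i \<omega>) \<and> jump_time H n \<omega> \<le> t \<and> t < jump_time H (Suc n) \<omega>}"
  let ?d = "\<lambda>t. ennreal (\<beta> * exp (- (\<beta> * t))) * indicator {0..} t"
  have J[measurable]: "(\<lambda>(\<omega>, t). indicator (?J n \<omega>) t) \<in> borel_measurable (Pr x \<Otimes>\<^sub>M lborel)" for n
    unfolding indicator_def by measurable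
  have "(\<Sum>n<N. \<integral>\<^sup>+\<omega>. \<theta> n \<omega> * indicator B (Y n \<omega>) \<partial>Pr x)
    = (\<integral>\<^sup>+\<omega>. (\<Sum>n<N. \<theta> n \<omega> * indicator B (Y n \<omega>)) \<partial>Pr x)"
    by (intro nn_integral_sum[symmetric]) measurable
  also have "\<dots> \<le> (\<integral>\<^sup>+\<omega>. (\<integral>\<^sup>+t. ?d t * indicator B (chain_at Y H t \<omega>) \<partial>lborel) \<partial>Pr x)"
  proof (rule nn_integral_mono)
    fix \<omega> assume "\<omega> \<in> space (Pr x)"
    have "(\<Sum>n<N. \<theta> n \<omega> * indicator B (Y n \<omega>))
      = (\<Sum>n<N. (\<integral>\<^sup>+t. ?d t * indicator (?J n \<omega>) t * indicator B (Y n \<omega>) \<partial>lborel))"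
      unfolding \<theta>_eq_integral by (intro sum.cong nn_integral_multc[symmetric]) auto
    also have "\<dots> = (\<integral>\<^sup>+t. (\<Sum>n<N. ?d t * indicator (?J n \<omega>) t * indicator B (Y n \<omega>)) \<partial>lborel)"
      by (intro nn_integral_sum[symmetric]) auto
    also have "\<dots> \<le> (\<integral>\<^sup>+t. ?d t * indicator B (chain_at Y H t \<omega>) \<partial>lborel)"
    proof (rule nn_integral_mono)
      fix t :: real
      let ?L = "LEAST n. t < jump_time H (Suc n) \<omega>"
      have le: "indicator (?J n \<omega>) t * indicator B (Y n \<omega>) \<le> (if n = ?L then indicator B (chain_at Y H t \<omega>) else 0 :: ennreal)" for n
        using chain_at_eq[of n \<omega> t] by (auto simp: indicator_def chain_at_def)
      have "(\<Sum>n<N. ?d t * indicator (?J n \<omega>) t * indicator B (Y n \<omega>))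
        \<le> (\<Sum>n<N. if n = ?L then ?d t * indicator B (chain_at Y H t \<omega>) else 0)"
      proof (intro sum_mono)
        fix n
        have "?d t * (indicator (?J n \<omega>) t * indicator B (Y n \<omega>)) \<le> ?d t * (if n = ?L then indicator B (chain_at Y H t \<omega>) else 0)"
          by (rule mult_left_mono[OF le]) simp
        then show "?d t * indicator (?J n \<omega>) t * indicator B (Y n \<omega>) \<le> (if n = ?L then ?d t * indicator B (chain_at Y H t \<omega>) else 0)"
          by (simp add: mult.assoc split: if_splits)
      qed
      also have "\<dots> \<le> ?d t * indicator B (chain_at Y H t \<omega>)"
        by (subst sum.delta) auto
      finally show "(\<Sum>n<N. ?d t * indicator (?J n \<omega>) t * indicator B (Y n \<omega>)) \<le> ?d t * indicator B (chain_at Y H t \<omega>)" .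
    qed
    finally show "(\<Sum>n<N. \<theta> n \<omega> * indicator B (Y n \<omega>)) \<le> (\<integral>\<^sup>+t. ?d t * indicator B (chain_at Y H t \<omega>) \<partial>lborel)" .
  qed
  also have "\<dots> = (\<integral>\<^sup>+t. (\<integral>\<^sup>+\<omega>. ?d t * indicator B (chain_at Y H t \<omega>) \<partial>Pr x) \<partial>lborel)"
  proof (rule Fubini')
    have "(\<lambda>z. indicator B (chain_at Y H (fst z) (snd z))) \<in> borel_measurable (lborel \<Otimes>\<^sub>M Pr x)"
      using measurable_compose[OF chain_at_measurable_pair, of "indicator B" borel] by (simp add: split_beta')
    then show "(\<lambda>(t, \<omega>). ?d t * indicator B (chain_at Y H t \<omega>)) \<in> borel_measurable (lborel \<Otimes>\<^sub>M Pr x)"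
      by (simp add: split_beta')
  qed
  also have "\<dots> = occ B"
    unfolding occ_def
  proof (rule nn_integral_cong)
    fix t :: real
    have "(\<integral>\<^sup>+\<omega>. ?d t * indicator B (chain_at Y H t \<omega>) \<partial>Pr x) = ?d t * (\<integral>\<^sup>+\<omega>. indicator B (chain_at Y H t \<omega>) \<partial>Pr x)"
      by (intro nn_integral_cmult) measurable
    then show "(\<integral>\<^sup>+\<omega>. ?d t * indicator B (chain_at Y H t \<omega>) \<partial>Pr x)
      = ?d t * emeasure (Pr x) {\<omega> \<in> space (Pr x). chain_at Y H t \<omega> \<in> B}"
      by (simp only: nn_integral_chain_at)
  qed
  finally show ?thesis .
qed

text \<open>
  Here non-explosion enters: the jump times tend to infinity almost surely.
\<close>

lemma W_tendsto_0: "(\<lambda>n. \<integral>\<^sup>+\<omega>. W n \<omega> \<partial>Pr x) \<longlonglongrightarrow> 0"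
proof -
  have le1: "discount H \<beta> n \<omega> \<le> 1" for n \<omega>
  proof (induction n)
    case (Suc n)
    have "indicator {0<..} (H n \<omega>) * ennreal (exp (- (\<beta> * H n \<omega>))) \<le> 1"
      using beta_pos by (auto simp: indicator_def)
    from mult_mono[OF Suc this] show ?case by (simp add: discount_Suc)
  qed (simp add: discount_def)
  have "(\<lambda>n. \<integral>\<^sup>+\<omega>. W n \<omega> \<partial>Pr x) \<longlonglongrightarrow> (\<integral>\<^sup>+\<omega>. 0 \<partial>Pr x)"
  proof (rule nn_integral_dominated_convergence[where w = "\<lambda>_. 1"])
    show "AE \<omega> in Pr x. W n \<omega> \<le> 1" for n
      using le1 by (auto simp: indicator_def)
    have "AE \<omega> in Pr x. \<forall>t. \<exists>n. t < jump_time H n \<omega>"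
      using regular start by (simp add: regular_jump_def)
    then show "AE \<omega> in Pr x. (\<lambda>n. W n \<omega>) \<longlonglongrightarrow> 0"
    proof eventually_elim
      fix \<omega> assume unb: "\<forall>t. \<exists>n. t < jump_time H n \<omega>"
      show "(\<lambda>n. W n \<omega>) \<longlonglongrightarrow> 0"
      proof (cases "\<forall>i. 0 < H i \<omega>")
        case True
        have "filterlim (\<lambda>n. jump_time H n \<omega>) at_top sequentially"
          unfolding filterlim_at_top
        proof (intro allI)
          fix t
          obtain m where "t < jump_time H m \<omega>" using unb by blast
          then have "t \<le> jump_time H n \<omega>" if "m \<le> n" for n
            using jump_time_mono[of n \<omega> m] True that by fastforce
          then show "\<forall>\<^sub>F n in sequentially. t \<le> jump_time H n \<omega>"
            by (auto simp: eventually_sequentially)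
        qed
        moreover have "((\<lambda>t::real. exp (- (\<beta> * t))) \<longlongrightarrow> 0) at_top"
          using beta_pos by real_asymp
        ultimately have "(\<lambda>n. exp (- (\<beta> * jump_time H n \<omega>))) \<longlonglongrightarrow> 0"
          by (rule filterlim_compose[rotated])
        then have "(\<lambda>n. ennreal (exp (- (\<beta> * jump_time H n \<omega>)))) \<longlonglongrightarrow> ennreal 0"
          by (rule tendsto_ennrealI)
        then show ?thesis using True by (simp add: discount_eq)
      next
        case False
        then obtain i where "H i \<omega> \<le> 0" by (auto simp: not_less)
        then have "W n \<omega> = 0" if "Suc i \<le> n" for n
          using discount_eq_0[of i n \<omega>] that by simp
        then show ?thesis
          by (intro tendsto_eventually) (auto simp: eventually_sequentially)
      qed
    qed
  qed (auto simp: emeasure_space_1)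
  then show ?thesis by simp
qed

lemma W_0: "(\<integral>\<^sup>+\<omega>. W 0 \<omega> * g (Y 0 \<omega>) \<partial>Pr x) = g x"
proof -
  have "(\<integral>\<^sup>+\<omega>. W 0 \<omega> * g (Y 0 \<omega>) \<partial>Pr x) = (\<integral>\<^sup>+\<omega>. g x \<partial>Pr x)"
  proof (rule path_cong_nn_integral[where n = 0])
    fix ys :: "nat \<Rightarrow> 's" assume ys: "\<And>i. i \<le> 0 \<Longrightarrow> ys i \<in> S"
    have "(\<integral>\<^sup>+\<omega>. indicator (trajectory 0 ys) \<omega> * (W 0 \<omega> * g (Y 0 \<omega>)) \<partial>Pr x)
      = (\<integral>\<^sup>+\<omega>. indicator (trajectory 0 ys) \<omega> * W 0 \<omega> * g (ys 0) \<partial>Pr x)"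
      by (intro nn_integral_cong) (auto simp: indicator_def)
    also have "\<dots> = (if ys 0 = x then 1 else 0) * g (ys 0)"
      using path_W[of 0 ys] ys by (subst nn_integral_multc) auto
    also have "\<dots> = (if ys 0 = x then 1 else 0) * g x" by simp
    also have "(if ys 0 = x then 1 else 0 :: ennreal) = emeasure (Pr x) (trajectory 0 ys)"
    proof -
      have P: "trajectory 0 (\<lambda>_. z) = {\<omega> \<in> space (Pr x). Y 0 \<omega> = z}" for z by auto
      have "trajectory 0 ys = trajectory 0 (\<lambda>_. ys 0)" by auto
      moreover have one: "emeasure (Pr x) (trajectory 0 (\<lambda>_. x)) = 1"
      proof -
        have "1 = (\<integral>\<^sup>+\<omega>. indicator (trajectory 0 (\<lambda>_. x)) \<omega> * W 0 \<omega> \<partial>Pr x)"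
          using path_W[of 0 "\<lambda>_. x"] start by simp
        also have "\<dots> \<le> (\<integral>\<^sup>+\<omega>. indicator (trajectory 0 (\<lambda>_. x)) \<omega> \<partial>Pr x)"
          by (intro nn_integral_mono) (auto simp: discount_def indicator_def)
        finally have "1 \<le> emeasure (Pr x) (trajectory 0 (\<lambda>_. x))" by simp
        then show ?thesis using emeasure_le_1 by (intro antisym) auto
      qed
      moreover have "emeasure (Pr x) (trajectory 0 (\<lambda>_. ys 0)) = 0" if "ys 0 \<noteq> x"
      proof -
        have "emeasure (Pr x) (trajectory 0 (\<lambda>_. ys 0)) + emeasure (Pr x) (trajectory 0 (\<lambda>_. x))
          = emeasure (Pr x) (trajectory 0 (\<lambda>_. ys 0) \<union> trajectory 0 (\<lambda>_. x))"
          using that by (intro plus_emeasure) auto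
        also have "\<dots> \<le> 1" by (rule emeasure_le_1)
        finally have "1 + emeasure (Pr x) (trajectory 0 (\<lambda>_. ys 0)) \<le> 1 + 0"
          unfolding one by (simp add: add.commute)
        then have "emeasure (Pr x) (trajectory 0 (\<lambda>_. ys 0)) \<le> 0"
          by (subst (asm) ennreal_add_left_cancel_le) simp
        then show ?thesis by simp
      qed
      ultimately show ?thesis by auto
    qed
    also have "emeasure (Pr x) (trajectory 0 ys) * g x = (\<integral>\<^sup>+\<omega>. indicator (trajectory 0 ys) \<omega> * g x \<partial>Pr x)"
      by (subst nn_integral_multc) auto
    finally show "(\<integral>\<^sup>+\<omega>. indicator (trajectory 0 ys) \<omega> * (W 0 \<omega> * g (Y 0 \<omega>)) \<partial>Pr x)
       = (\<integral>\<^sup>+\<omega>. indicator (trajectory 0 ys) \<omega> * g x \<partial>Pr x)" .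
  qed auto
  then show ?thesis by (simp add: emeasure_space_1)
qed

lemma killed_step_eq:
  assumes "y \<in> S" "z \<in> S" "z \<noteq> y" "q y y \<noteq> 0"
  shows "ennreal (killed_step q \<beta> y z) = ennreal (q y z) * ennreal (1 / (\<bar>q y y\<bar> + \<beta>))"
  using assms beta_pos generator
  by (subst ennreal_mult[symmetric]) (auto simp: killed_step_def jump_prob_def conservative_generator_def)

text \<open>
  Iterating the one-step inequality that is equivalent to \<open>(\<beta> - Q) w \<le> \<beta> w + F\<close> gives
  \<open>w x \<le> \<Sum>n. E (\<theta> n * (w + F / \<beta>))\<close> up to a remainder \<open>E (W N * w)\<close>, which vanishes because \<open>w\<close> is bounded.
  The weights \<open>\<theta>\<close> are parts of the resolvent law; as \<open>w\<close> vanishes at \<open>y\<^sub>0\<close>, the bound \<open>c\<close> is only charged off \<open>y\<^sub>0\<close>.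
\<close>

lemma resolvent_subsolution_bound:
  fixes w F :: "'s \<Rightarrow> ennreal" and c :: real
  assumes rates: "\<And>y. y \<in> S \<Longrightarrow> q y y \<noteq> 0"
    and bounded: "\<And>y. y \<in> S \<Longrightarrow> w y \<le> ennreal c" and "w y\<^sub>0 = 0"
    and F: "\<And>y. y \<in> S \<Longrightarrow> F y \<le> 1"
    and sub: "\<And>y. y \<in> S \<Longrightarrow> ennreal \<bar>q y y\<bar> * w y \<le> F y + (\<integral>\<^sup>+z. ennreal (q y z) * w z \<partial>count_space (S - {y}))"
  shows "w x \<le> ennreal c * occ (- {y\<^sub>0}) + ennreal (1 / \<beta>)"
proof -
  define G where "G y = w y + F y * ennreal (1 / \<beta>)" for y
  have pt: "w y \<le> ennreal (\<beta> / (\<bar>q y y\<bar> + \<beta>)) * G y + (\<integral>\<^sup>+z. ennreal (killed_step q \<beta> y z) * w z \<partial>count_space S)"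
    if y: "y \<in> S" for y
  proof -
    let ?I = "\<integral>\<^sup>+z. ennreal (q y z) * w z \<partial>count_space (S - {y})" and ?e = "1 / (\<bar>q y y\<bar> + \<beta>)"
    have e: "0 \<le> ?e" using beta_pos by simp
    have "w y = ennreal (?e * (\<bar>q y y\<bar> + \<beta>)) * w y" using beta_pos by simp
    also have "\<dots> = ennreal ?e * (ennreal \<bar>q y y\<bar> * w y + ennreal \<beta> * w y)"
      using beta_pos e by (subst ennreal_mult) (auto simp: ennreal_plus distrib_right mult.assoc)
    also have "\<dots> \<le> ennreal ?e * ((F y + ?I) + ennreal \<beta> * w y)"
      by (intro mult_left_mono add_right_mono sub y) auto
    also have "\<dots> = ennreal ?e * (ennreal \<beta> * w y + F y) + ?I * ennreal ?e"
      by (simp only: distrib_left distrib_right mult_ac add_ac)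
    also have "ennreal ?e * (ennreal \<beta> * w y + F y) = ennreal (\<beta> / (\<bar>q y y\<bar> + \<beta>)) * G y"
    proof -
      have 1: "ennreal (\<beta> / (\<bar>q y y\<bar> + \<beta>)) = ennreal ?e * ennreal \<beta>"
        using beta_pos by (subst ennreal_mult[symmetric]) auto
      have 2: "ennreal \<beta> * ennreal (1 / \<beta>) = 1"
        using beta_pos by (subst ennreal_mult[symmetric]) auto
      have "ennreal \<beta> * G y = ennreal \<beta> * w y + (ennreal \<beta> * ennreal (1 / \<beta>)) * F y"
        by (simp add: G_def distrib_left mult_ac)
      then show ?thesis by (simp add: 1 2 mult.assoc)
    qed
    also have "?I * ennreal ?e = (\<integral>\<^sup>+z. ennreal (q y z) * w z * ennreal ?e \<partial>count_space (S - {y}))"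
      by (rule nn_integral_multc[symmetric]) simp
    also have "\<dots> = (\<integral>\<^sup>+z. ennreal (killed_step q \<beta> y z) * w z \<partial>count_space (S - {y}))"
      by (intro nn_integral_cong) (use y rates in \<open>auto simp: killed_step_eq mult_ac\<close>)
    also have "\<dots> \<le> (\<integral>\<^sup>+z. ennreal (killed_step q \<beta> y z) * w z \<partial>count_space S)"
      by (subst (1 2) nn_integral_count_space_indicator)
         (auto intro!: nn_integral_mono simp: indicator_def)
    finally show ?thesis by (simp add: add_left_mono)
  qed
  have iter: "w x \<le> (\<Sum>n<N. \<integral>\<^sup>+\<omega>. \<theta> n \<omega> * G (Y n \<omega>) \<partial>Pr x) + (\<integral>\<^sup>+\<omega>. W N \<omega> * w (Y N \<omega>) \<partial>Pr x)" for N
  proof (induction N)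
    case 0
    then show ?case using W_0[of w] by simp
  next
    case (Suc N)
    let ?K = "\<lambda>y. \<integral>\<^sup>+z. ennreal (killed_step q \<beta> y z) * w z \<partial>count_space S"
    have "(\<integral>\<^sup>+\<omega>. W N \<omega> * w (Y N \<omega>) \<partial>Pr x) \<le>
       (\<integral>\<^sup>+\<omega>. W N \<omega> * (ennreal (\<beta> / (\<bar>q (Y N \<omega>) (Y N \<omega>)\<bar> + \<beta>)) * G (Y N \<omega>)) + W N \<omega> * ?K (Y N \<omega>) \<partial>Pr x)"
      unfolding distrib_left[symmetric]
      by (intro nn_integral_mono mult_left_mono pt Y_in) auto
    also have "\<dots> = (\<integral>\<^sup>+\<omega>. \<theta> N \<omega> * G (Y N \<omega>) \<partial>Pr x) + (\<integral>\<^sup>+\<omega>. W (Suc N) \<omega> * w (Y (Suc N) \<omega>) \<partial>Pr x)"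
      unfolding W_step[of N w] \<theta>_eq_W by (rule nn_integral_add) measurable
    finally have "(\<integral>\<^sup>+\<omega>. W N \<omega> * w (Y N \<omega>) \<partial>Pr x) \<le> \<dots>" .
    then have "(\<Sum>n<N. \<integral>\<^sup>+\<omega>. \<theta> n \<omega> * G (Y n \<omega>) \<partial>Pr x) + (\<integral>\<^sup>+\<omega>. W N \<omega> * w (Y N \<omega>) \<partial>Pr x)
      \<le> (\<Sum>n<N. \<integral>\<^sup>+\<omega>. \<theta> n \<omega> * G (Y n \<omega>) \<partial>Pr x) + ((\<integral>\<^sup>+\<omega>. \<theta> N \<omega> * G (Y N \<omega>) \<partial>Pr x) + (\<integral>\<^sup>+\<omega>. W (Suc N) \<omega> * w (Y (Suc N) \<omega>) \<partial>Pr x))"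
      by (rule add_left_mono)
    with Suc have "w x \<le> (\<Sum>n<N. \<integral>\<^sup>+\<omega>. \<theta> n \<omega> * G (Y n \<omega>) \<partial>Pr x) + ((\<integral>\<^sup>+\<omega>. \<theta> N \<omega> * G (Y N \<omega>) \<partial>Pr x) + (\<integral>\<^sup>+\<omega>. W (Suc N) \<omega> * w (Y (Suc N) \<omega>) \<partial>Pr x))"
      by (rule order_trans)
    then show ?case by (simp only: add.assoc sum.lessThan_Suc)
  qed
  have bound: "w x \<le> (ennreal c * occ (- {y\<^sub>0}) + ennreal (1 / \<beta>)) + ennreal c * (\<integral>\<^sup>+\<omega>. W N \<omega> \<partial>Pr x)" for N
  proof -
    have "(\<Sum>n<N. \<integral>\<^sup>+\<omega>. \<theta> n \<omega> * G (Y n \<omega>) \<partial>Pr x)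
      \<le> (\<Sum>n<N. ennreal c * (\<integral>\<^sup>+\<omega>. \<theta> n \<omega> * indicator (- {y\<^sub>0}) (Y n \<omega>) \<partial>Pr x)
           + ennreal (1 / \<beta>) * (\<integral>\<^sup>+\<omega>. \<theta> n \<omega> * indicator UNIV (Y n \<omega>) \<partial>Pr x))"
    proof (rule sum_mono)
      fix n
      have "(\<integral>\<^sup>+\<omega>. \<theta> n \<omega> * G (Y n \<omega>) \<partial>Pr x) \<le> (\<integral>\<^sup>+\<omega>. ennreal c * (\<theta> n \<omega> * indicator (- {y\<^sub>0}) (Y n \<omega>))
           + ennreal (1 / \<beta>) * (\<theta> n \<omega> * indicator UNIV (Y n \<omega>)) \<partial>Pr x)"
      proof (rule nn_integral_mono)
        fix \<omega> assume "\<omega> \<in> space (Pr x)"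
        then have y: "Y n \<omega> \<in> S" by (rule Y_in)
        have "G (Y n \<omega>) \<le> ennreal c * indicator (- {y\<^sub>0}) (Y n \<omega>) + 1 * ennreal (1 / \<beta>)"
          unfolding G_def using bounded[OF y] \<open>w y\<^sub>0 = 0\<close>
          by (intro add_mono mult_right_mono F y) (auto simp: indicator_def)
        then have "\<theta> n \<omega> * G (Y n \<omega>) \<le> \<theta> n \<omega> * (ennreal c * indicator (- {y\<^sub>0}) (Y n \<omega>) + 1 * ennreal (1 / \<beta>))"
          by (rule mult_left_mono) simp
        also have "\<dots> = ennreal c * (\<theta> n \<omega> * indicator (- {y\<^sub>0}) (Y n \<omega>)) + ennreal (1 / \<beta>) * (\<theta> n \<omega> * indicator UNIV (Y n \<omega>))"
          by (simp only: distrib_left mult_ac indicator_UNIV mult_1)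
        finally show "\<theta> n \<omega> * G (Y n \<omega>) \<le> ennreal c * (\<theta> n \<omega> * indicator (- {y\<^sub>0}) (Y n \<omega>)) + ennreal (1 / \<beta>) * (\<theta> n \<omega> * indicator UNIV (Y n \<omega>))" .
      qed
      also have "\<dots> = ennreal c * (\<integral>\<^sup>+\<omega>. \<theta> n \<omega> * indicator (- {y\<^sub>0}) (Y n \<omega>) \<partial>Pr x)
           + ennreal (1 / \<beta>) * (\<integral>\<^sup>+\<omega>. \<theta> n \<omega> * indicator UNIV (Y n \<omega>) \<partial>Pr x)"
      proof -
        have A: "(\<integral>\<^sup>+\<omega>. d * (\<theta> n \<omega> * indicator B (Y n \<omega>)) \<partial>Pr x) = d * (\<integral>\<^sup>+\<omega>. \<theta> n \<omega> * indicator B (Y n \<omega>) \<partial>Pr x)" for d B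
          by (rule nn_integral_cmult) measurable
        show ?thesis unfolding A[symmetric] by (rule nn_integral_add) measurable
      qed
      finally show "(\<integral>\<^sup>+\<omega>. \<theta> n \<omega> * G (Y n \<omega>) \<partial>Pr x) \<le> ennreal c * (\<integral>\<^sup>+\<omega>. \<theta> n \<omega> * indicator (- {y\<^sub>0}) (Y n \<omega>) \<partial>Pr x)
           + ennreal (1 / \<beta>) * (\<integral>\<^sup>+\<omega>. \<theta> n \<omega> * indicator UNIV (Y n \<omega>) \<partial>Pr x)" .
    qed
    also have "\<dots> = ennreal c * (\<Sum>n<N. \<integral>\<^sup>+\<omega>. \<theta> n \<omega> * indicator (- {y\<^sub>0}) (Y n \<omega>) \<partial>Pr x)
        + ennreal (1 / \<beta>) * (\<Sum>n<N. \<integral>\<^sup>+\<omega>. \<theta> n \<omega> * indicator UNIV (Y n \<omega>) \<partial>Pr x)"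
      by (simp only: sum.distrib sum_distrib_left)
    also have "\<dots> \<le> ennreal c * occ (- {y\<^sub>0}) + ennreal (1 / \<beta>) * occ UNIV"
      by (intro add_mono mult_left_mono sum_\<theta>_le_occ) auto
    finally have 1: "(\<Sum>n<N. \<integral>\<^sup>+\<omega>. \<theta> n \<omega> * G (Y n \<omega>) \<partial>Pr x) \<le> ennreal c * occ (- {y\<^sub>0}) + ennreal (1 / \<beta>)"
      by (simp add: occ_UNIV)
    have "(\<integral>\<^sup>+\<omega>. W N \<omega> * w (Y N \<omega>) \<partial>Pr x) \<le> (\<integral>\<^sup>+\<omega>. W N \<omega> * ennreal c \<partial>Pr x)"
      by (intro nn_integral_mono mult_left_mono bounded Y_in) auto
    also have "\<dots> = ennreal c * (\<integral>\<^sup>+\<omega>. W N \<omega> \<partial>Pr x)"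
      by (subst nn_integral_multc) (auto simp: mult.commute)
    finally have 2: "(\<integral>\<^sup>+\<omega>. W N \<omega> * w (Y N \<omega>) \<partial>Pr x) \<le> ennreal c * (\<integral>\<^sup>+\<omega>. W N \<omega> \<partial>Pr x)" .
    show ?thesis by (rule order_trans[OF iter add_mono[OF 1 2]])
  qed
  have "(\<lambda>N. (ennreal c * occ (- {y\<^sub>0}) + ennreal (1 / \<beta>)) + ennreal c * (\<integral>\<^sup>+\<omega>. W N \<omega> \<partial>Pr x))
     \<longlonglongrightarrow> (ennreal c * occ (- {y\<^sub>0}) + ennreal (1 / \<beta>)) + ennreal c * 0"
    by (intro tendsto_add tendsto_const ennreal_tendsto_cmult W_tendsto_0) simp
  then show ?thesis
    using bound by (intro LIMSEQ_le_const) auto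
qed

text \<open>
  Along a path of positive rates each discounted step keeps a positive mass.
\<close>

lemma resolvent_pos:
  assumes reach: "(x, y) \<in> {(a, c). a \<in> S \<and> c \<in> S \<and> 0 < q a c}\<^sup>*"
    and rates: "\<And>y. y \<in> S \<Longrightarrow> q y y < 0"
  shows "0 < resolvent (transition_prob Pr Y H) \<beta> x y"
proof -
  have "y \<in> S \<and> (\<exists>n. 0 < (\<integral>\<^sup>+\<omega>. W n \<omega> * indicator {y} (Y n \<omega>) \<partial>Pr x))"
    using reach
  proof (induction rule: rtrancl_induct)
    case base
    then show ?case using W_0[of "indicator {x}"] start by (auto intro!: exI[of _ 0])
  next
    case (step y z)
    then obtain n where n: "0 < (\<integral>\<^sup>+\<omega>. W n \<omega> * indicator {y} (Y n \<omega>) \<partial>Pr x)" by auto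
    have yz: "y \<in> S" "z \<in> S" "0 < q y z" using step by auto
    then have "z \<noteq> y" using rates[of y] by auto
    have K: "0 < ennreal (killed_step q \<beta> y z)"
      using yz \<open>z \<noteq> y\<close> rates[of y] beta_pos by (auto simp: killed_step_def jump_prob_def)
    have "0 < ennreal (killed_step q \<beta> y z) * (\<integral>\<^sup>+\<omega>. W n \<omega> * indicator {y} (Y n \<omega>) \<partial>Pr x)"
      using n K by (simp add: ennreal_zero_less_mult_iff)
    also have "\<dots> = (\<integral>\<^sup>+\<omega>. W n \<omega> * (ennreal (killed_step q \<beta> y z) * indicator {y} (Y n \<omega>)) \<partial>Pr x)"
      by (subst nn_integral_cmult[symmetric]) (auto simp: mult_ac)
    also have "\<dots> \<le> (\<integral>\<^sup>+\<omega>. W n \<omega> * (\<integral>\<^sup>+u. ennreal (killed_step q \<beta> (Y n \<omega>) u) * indicator {z} u \<partial>count_space S) \<partial>Pr x)"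
    proof (intro nn_integral_mono mult_left_mono)
      fix \<omega>
      have "(\<integral>\<^sup>+u. ennreal (killed_step q \<beta> (Y n \<omega>) u) * indicator {z} u \<partial>count_space S)
        = (\<integral>\<^sup>+u. ennreal (killed_step q \<beta> (Y n \<omega>) z) * indicator {z} u \<partial>count_space S)"
        by (intro nn_integral_cong) (auto simp: indicator_def)
      also have "\<dots> = ennreal (killed_step q \<beta> (Y n \<omega>) z)"
        using yz by (subst nn_integral_cmult_indicator) auto
      finally show "ennreal (killed_step q \<beta> y z) * indicator {y} (Y n \<omega>) \<le>
         (\<integral>\<^sup>+u. ennreal (killed_step q \<beta> (Y n \<omega>) u) * indicator {z} u \<partial>count_space S)"
        by (auto simp: indicator_def)
    qed simp
    also have "\<dots> = (\<integral>\<^sup>+\<omega>. W (Suc n) \<omega> * indicator {z} (Y (Suc n) \<omega>) \<partial>Pr x)"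
      by (rule W_step[symmetric])
    finally show ?case using yz by auto
  qed
  then obtain n where y: "y \<in> S" and n: "0 < (\<integral>\<^sup>+\<omega>. W n \<omega> * indicator {y} (Y n \<omega>) \<partial>Pr x)" by auto
  have "0 < ennreal (\<beta> / (\<bar>q y y\<bar> + \<beta>)) * (\<integral>\<^sup>+\<omega>. W n \<omega> * indicator {y} (Y n \<omega>) \<partial>Pr x)"
    using n beta_pos by (simp add: ennreal_zero_less_mult_iff add_nonneg_pos)
  also have "\<dots> = (\<integral>\<^sup>+\<omega>. W n \<omega> * (ennreal (\<beta> / (\<bar>q (Y n \<omega>) (Y n \<omega>)\<bar> + \<beta>)) * indicator {y} (Y n \<omega>)) \<partial>Pr x)"
    by (subst nn_integral_cmult[symmetric]) (auto intro!: nn_integral_cong simp: indicator_def mult_ac)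
  also have "\<dots> = (\<integral>\<^sup>+\<omega>. \<theta> n \<omega> * indicator {y} (Y n \<omega>) \<partial>Pr x)"
    by (rule \<theta>_eq_W[symmetric])
  also have "\<dots> \<le> (\<Sum>m<Suc n. \<integral>\<^sup>+\<omega>. \<theta> m \<omega> * indicator {y} (Y m \<omega>) \<partial>Pr x)"
    by simp
  also have "\<dots> \<le> occ {y}" by (rule sum_\<theta>_le_occ)
  finally show ?thesis by (simp add: occ_resolvent)
qed

lemma occ_compl: "occ (- {y}) = ennreal (1 - resolvent (transition_prob Pr Y H) \<beta> x y)"
  and resolvent_le_1: "resolvent (transition_prob Pr Y H) \<beta> x y \<le> 1"
proof -
  let ?r = "resolvent (transition_prob Pr Y H) \<beta> x y"
  have r: "0 \<le> ?r"
    unfolding resolvent_def set_lebesgue_integral_def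
    using beta_pos by (intro integral_nonneg_AE) (auto simp: transition_prob_def)
  have sum: "ennreal ?r + occ (- {y}) = 1"
    using occ_insert[of y "- {y}"] occ_UNIV by (simp add: occ_resolvent Compl_eq_Diff_UNIV)
  have "ennreal ?r + 0 \<le> ennreal ?r + occ (- {y})" by (intro add_left_mono) simp
  then have "ennreal ?r \<le> 1" by (simp add: sum)
  then show le: "?r \<le> 1" by simp
  have "ennreal ?r + ennreal (1 - ?r) = 1" using r le by (subst ennreal_plus[symmetric]) auto
  with sum have "ennreal ?r + occ (- {y}) = ennreal ?r + ennreal (1 - ?r)" by (simp only:)
  then show "occ (- {y}) = ennreal (1 - ?r)"
    by (subst (asm) ennreal_add_left_cancel) simp
qed

end

section \<open>Hitting problems with a drift condition\<close>

lemma nn_integral_count_space_has_sum: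
  fixes f :: "'a \<Rightarrow> real"
  assumes f: "(f has_sum s) A" and nonneg: "\<And>x. x \<in> A \<Longrightarrow> 0 \<le> f x"
  shows "(\<integral>\<^sup>+x. ennreal (f x) \<partial>count_space A) = ennreal s"
proof -
  have "f summable_on A" using f by (rule has_sum_imp_summable)
  then have "(\<lambda>x. norm (f x)) summable_on A"
    using nonneg by (simp cong: summable_on_cong)
  then have abs: "Infinite_Set_Sum.abs_summable_on f A"
    using abs_summable_equivalent by blast
  then have "(\<integral>\<^sup>+x. ennreal (f x) \<partial>count_space A) = ennreal (infsetsum f A)"
    by (rule nn_integral_conv_infsetsum) (rule nonneg)
  then show ?thesis
    using infsetsum_infsum[OF abs] infsumI[OF f] by simp
qed

lemma has_sum_nn_integral_count_space:
  fixes f :: "'a \<Rightarrow> real"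
  assumes f: "(\<integral>\<^sup>+x. ennreal (f x) \<partial>count_space A) = ennreal s" and "0 \<le> s"
    and nonneg: "\<And>x. x \<in> A \<Longrightarrow> 0 \<le> f x"
  shows "(f has_sum s) A"
proof -
  have "integrable (count_space A) f"
    using f nonneg by (intro integrableI_nonneg) (auto simp: AE_count_space)
  then have abs: "Infinite_Set_Sum.abs_summable_on f A"
    by (simp add: Infinite_Set_Sum.abs_summable_on_def)
  then have "(\<lambda>x. norm (f x)) summable_on A"
    using abs_summable_equivalent by blast
  then have sum: "f summable_on A" by (rule abs_summable_summable)
  have "ennreal (infsum f A) = ennreal s"
    using nn_integral_count_space_has_sum[OF has_sum_infsum[OF sum] nonneg] f by simp
  moreover have "0 \<le> infsum f A" by (intro infsum_nonneg nonneg)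
  ultimately have "infsum f A = s" using \<open>0 \<le> s\<close> by simp
  then show ?thesis using has_sum_infsum[OF sum] by simp
qed

context infinite_generator
begin

text \<open>
  Increasing approximations, indexed by the number of jumps taken into account, of the mean integral of
  \<open>f\<close> along the chain until it hits \<open>y\<^sub>0\<close>. Working with extended values postpones all questions of
  summability to the point where an upper bound is known.
\<close>

primrec hit_iter :: "'s \<Rightarrow> ('s \<Rightarrow> ennreal) \<Rightarrow> nat \<Rightarrow> 's \<Rightarrow> ennreal" where
  "hit_iter y\<^sub>0 f 0 = (\<lambda>x. 0)"
| "hit_iter y\<^sub>0 f (Suc k) = (\<lambda>x. if x = y\<^sub>0 then 0 else
     (f x + (\<integral>\<^sup>+y. ennreal (q x y) * hit_iter y\<^sub>0 f k y \<partial>count_space (S - {x}))) * ennreal (1 / \<bar>q x x\<bar>))"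

lemma hit_iter_target [simp]: "hit_iter y\<^sub>0 f k y\<^sub>0 = 0"
  by (cases k) simp_all

lemma hit_iter_mono: "hit_iter y\<^sub>0 f k x \<le> hit_iter y\<^sub>0 f (Suc k) x"
proof (induction k arbitrary: x)
  case (Suc k)
  then show ?case
    by (auto intro!: mult_right_mono add_left_mono nn_integral_mono mult_left_mono simp del: hit_iter.simps(2)
        simp: hit_iter.simps(2)[of _ _ k] hit_iter.simps(2)[of _ _ "Suc k"])
qed simp

lemma incseq_hit_iter: "incseq (\<lambda>k. hit_iter y\<^sub>0 f k x)"
  by (intro incseq_SucI hit_iter_mono)

lemma rate_mult_cancel: "x \<in> S \<Longrightarrow> ennreal \<bar>q x x\<bar> * (a * ennreal (1 / \<bar>q x x\<bar>)) = a"
proof -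
  assume "x \<in> S"
  then have "ennreal \<bar>q x x\<bar> * ennreal (1 / \<bar>q x x\<bar>) = 1"
    using rate_neg[of x] by (subst ennreal_mult[symmetric]) auto
  then show ?thesis by (metis mult.assoc mult.commute mult_1)
qed

lemma hit_iter_Suc_eq:
  "x \<in> S \<Longrightarrow> x \<noteq> y\<^sub>0 \<Longrightarrow> ennreal \<bar>q x x\<bar> * hit_iter y\<^sub>0 f (Suc k) x =
    f x + (\<integral>\<^sup>+y. ennreal (q x y) * hit_iter y\<^sub>0 f k y \<partial>count_space (S - {x}))"
  by (simp add: rate_mult_cancel)

lemma hit_iter_subsolution:
  assumes "x \<in> S"
  shows "ennreal \<bar>q x x\<bar> * hit_iter y\<^sub>0 f k x \<le>
    f x + (\<integral>\<^sup>+y. ennreal (q x y) * hit_iter y\<^sub>0 f k y \<partial>count_space (S - {x}))"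
proof (cases "x = y\<^sub>0")
  case False
  then show ?thesis
    using mult_left_mono[OF hit_iter_mono[of y\<^sub>0 f k x], of "ennreal \<bar>q x x\<bar>"] hit_iter_Suc_eq[OF assms False, of f k]
    by simp
qed simp

lemma off_nn_integral: "x \<in> S \<Longrightarrow> (\<integral>\<^sup>+y. ennreal (q x y) \<partial>count_space (S - {x})) = ennreal \<bar>q x x\<bar>"
  using nn_integral_count_space_has_sum[OF off_has_sum[of x]] off_nonneg[of x] rate_neg[of x] by auto

lemma rate_le_cancel:
  assumes "x \<in> S" "ennreal \<bar>q x x\<bar> * a \<le> ennreal \<bar>q x x\<bar> * c" shows "a \<le> c"
proof -
  have "\<bar>q x x\<bar> > 0" using rate_neg[OF assms(1)] by simp
  then have "(ennreal \<bar>q x x\<bar> * a) * ennreal (1 / \<bar>q x x\<bar>) \<le> (ennreal \<bar>q x x\<bar> * c) * ennreal (1 / \<bar>q x x\<bar>)"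
    using assms(2) by (intro mult_right_mono) auto
  then show ?thesis using rate_mult_cancel[OF assms(1)] by (simp add: mult.assoc)
qed

text \<open>
  A maximum principle: outside \<open>C\<close> each approximation is an average of values of the preceding one.
\<close>

lemma hit_iter_le_on:
  assumes C: "finite C" "C \<subseteq> S" and x: "x \<in> S"
  shows "hit_iter y\<^sub>0 (indicator C) k x \<le> (SUP c\<in>C. hit_iter y\<^sub>0 (indicator C) k c)"
  using x
proof (induction k arbitrary: x)
  case (Suc k)
  let ?h = "hit_iter y\<^sub>0 (indicator C)"
  show ?case
  proof (cases "x = y\<^sub>0 \<or> x \<in> C")
    case True
    then show ?thesis by (metis SUP_upper hit_iter_target zero_le)
  next
    case False
    have "ennreal \<bar>q x x\<bar> * ?h (Suc k) x = (\<integral>\<^sup>+y. ennreal (q x y) * ?h k y \<partial>count_space (S - {x}))"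
      using False Suc.prems by (subst hit_iter_Suc_eq) auto
    also have "\<dots> \<le> (\<integral>\<^sup>+y. ennreal (q x y) * (SUP c\<in>C. ?h k c) \<partial>count_space (S - {x}))"
      using Suc.IH by (intro nn_integral_mono mult_left_mono) auto
    also have "\<dots> = ennreal \<bar>q x x\<bar> * (SUP c\<in>C. ?h k c)"
      using Suc.prems by (subst nn_integral_multc) (auto simp: off_nn_integral)
    finally have "?h (Suc k) x \<le> (SUP c\<in>C. ?h k c)"
      by (rule rate_le_cancel[OF Suc.prems])
    also have "\<dots> \<le> (SUP c\<in>C. ?h (Suc k) c)"
      by (intro SUP_mono) (use hit_iter_mono in blast)
    finally show ?thesis .
  qed
qed simp

lemma hit_iter_finite:
  assumes C: "finite C" "C \<subseteq> S"
  shows "(SUP c\<in>C. hit_iter y\<^sub>0 (indicator C) k c) < \<top>"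
proof (cases "C = {}")
  case False
  let ?h = "hit_iter y\<^sub>0 (indicator C)"
  show ?thesis
  proof (induction k)
    case (Suc k)
    have "?h (Suc k) x < \<top>" if x: "x \<in> C" for x
    proof -
      have "(\<integral>\<^sup>+y. ennreal (q x y) * ?h k y \<partial>count_space (S - {x}))
        \<le> (\<integral>\<^sup>+y. ennreal (q x y) * (SUP c\<in>C. ?h k c) \<partial>count_space (S - {x}))"
        using hit_iter_le_on[OF C] by (intro nn_integral_mono mult_left_mono) auto
      also have "\<dots> = ennreal \<bar>q x x\<bar> * (SUP c\<in>C. ?h k c)"
        using x C by (subst nn_integral_multc) (auto simp: off_nn_integral)
      also have "\<dots> < \<top>" using Suc by (simp add: ennreal_mult_less_top)
      finally show ?thesis by (auto simp: ennreal_mult_less_top indicator_def)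
    qed
    moreover have "(SUP c\<in>C. ?h (Suc k) c) = Max (?h (Suc k) ` C)"
      using False C by (intro cSup_eq_Max) auto
    ultimately show ?case using False C by (simp del: hit_iter.simps)
  qed (use False in simp)
qed (simp add: bot_ennreal)

text \<open>
  The maximum \<open>c\<close> over \<open>C\<close> of a subsolution satisfies \<open>c \<le> c * (1 - \<psi>) + 1 / \<beta>\<close>, which can be
  solved for \<open>c\<close> because the approximations are finite on the finite set \<open>C\<close>. The hypothesis on \<open>w\<close> is what
  the resolvent provides.
\<close>

lemma hit_iter_bound:
  fixes \<psi> \<beta> :: real
  assumes C: "finite C" "C \<subseteq> S" and \<psi>: "0 < \<psi>" "\<psi> \<le> 1" and \<beta>: "0 < \<beta>"
    and resolvent: "\<And>w c x. (\<And>y. y \<in> S \<Longrightarrow> w y \<le> ennreal c) \<Longrightarrow> w y\<^sub>0 = 0 \<Longrightarrow>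
      (\<And>y. y \<in> S \<Longrightarrow> ennreal \<bar>q y y\<bar> * w y \<le> indicator C y + (\<integral>\<^sup>+z. ennreal (q y z) * w z \<partial>count_space (S - {y}))) \<Longrightarrow>
      x \<in> C \<Longrightarrow> 0 \<le> c \<Longrightarrow> w x \<le> ennreal (c * (1 - \<psi>) + 1 / \<beta>)"
    and x: "x \<in> S"
  shows "hit_iter y\<^sub>0 (indicator C) k x \<le> ennreal (1 / (\<beta> * \<psi>))"
proof -
  let ?h = "hit_iter y\<^sub>0 (indicator C) k"
  define c where "c = enn2real (SUP c\<in>C. ?h c)"
  have c: "(SUP c\<in>C. ?h c) = ennreal c"
    using hit_iter_finite[OF C, of y\<^sub>0 k] by (simp add: c_def)
  have c0: "0 \<le> c" by (simp add: c_def)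
  have le: "?h y \<le> ennreal c" if "y \<in> S" for y
    using hit_iter_le_on[OF C that, of y\<^sub>0 k] by (simp add: c)
  have "?h x \<le> ennreal (c * (1 - \<psi>) + 1 / \<beta>)" if "x \<in> C" for x
    using le that c0 by (intro resolvent) (auto intro: hit_iter_subsolution)
  then have "ennreal c \<le> ennreal (c * (1 - \<psi>) + 1 / \<beta>)"
    unfolding c[symmetric] by (intro SUP_least)
  then have "c \<le> c * (1 - \<psi>) + 1 / \<beta>"
    using c0 \<psi> \<beta> by (subst (asm) ennreal_le_iff) auto
  then have "c * \<psi> \<le> 1 / \<beta>" by (simp add: algebra_simps)
  then have "c \<le> 1 / (\<beta> * \<psi>)" using \<psi> \<beta> by (simp add: field_simps)
  then show ?thesis using le[OF x] by (meson ennreal_leI order_trans)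
qed

text \<open>
  Time spent in \<open>C\<close> is what the drift condition fails to control, so adding \<open>b\<close> times it to \<open>v\<close>
  restores a supersolution; comparison goes through approximation by approximation.
\<close>

lemma hit_iter_le_drift:
  fixes v :: "'s \<Rightarrow> real" and b :: real
  assumes drift: "\<And>x. x \<in> S \<Longrightarrow> 1 + (\<integral>\<^sup>+y. ennreal (q x y) * ennreal (v y) \<partial>count_space (S - {x}))
      \<le> ennreal b * indicator C x + ennreal \<bar>q x x\<bar> * ennreal (v x)"
    and f: "\<And>x. x \<in> S \<Longrightarrow> f x \<le> 2" and x: "x \<in> S"
  shows "hit_iter y\<^sub>0 f k x \<le> 2 * (ennreal (v x) + ennreal b * hit_iter y\<^sub>0 (indicator C) k x)"
  using x
proof (induction k arbitrary: x)
  case (Suc k)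
  let ?w = "hit_iter y\<^sub>0 (indicator C)"
  show ?case
  proof (cases "x = y\<^sub>0")
    case False
    let ?A = "count_space (S - {x})"
    have "ennreal \<bar>q x x\<bar> * hit_iter y\<^sub>0 f (Suc k) x = f x + (\<integral>\<^sup>+y. ennreal (q x y) * hit_iter y\<^sub>0 f k y \<partial>?A)"
      by (rule hit_iter_Suc_eq[OF Suc.prems False])
    also have "\<dots> \<le> 2 + (\<integral>\<^sup>+y. ennreal (q x y) * (2 * (ennreal (v y) + ennreal b * ?w k y)) \<partial>?A)"
      using Suc.IH f[OF Suc.prems] by (intro add_mono nn_integral_mono mult_left_mono) auto
    also have "(\<integral>\<^sup>+y. ennreal (q x y) * (2 * (ennreal (v y) + ennreal b * ?w k y)) \<partial>?A)
      = (\<integral>\<^sup>+y. 2 * (ennreal (q x y) * ennreal (v y)) + (2 * ennreal b) * (ennreal (q x y) * ?w k y) \<partial>?A)"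
      by (intro nn_integral_cong) (simp add: distrib_left mult_ac)
    also have "\<dots> = 2 * (\<integral>\<^sup>+y. ennreal (q x y) * ennreal (v y) \<partial>?A) + (2 * ennreal b) * (\<integral>\<^sup>+y. ennreal (q x y) * ?w k y \<partial>?A)"
      by (subst nn_integral_add) (auto simp: nn_integral_cmult)
    also have "2 + \<dots> = 2 * (1 + (\<integral>\<^sup>+y. ennreal (q x y) * ennreal (v y) \<partial>?A)) + (2 * ennreal b) * (\<integral>\<^sup>+y. ennreal (q x y) * ?w k y \<partial>?A)"
      by (simp add: distrib_left add.assoc)
    also have "\<dots> \<le> 2 * (ennreal b * indicator C x + ennreal \<bar>q x x\<bar> * ennreal (v x)) + (2 * ennreal b) * (\<integral>\<^sup>+y. ennreal (q x y) * ?w k y \<partial>?A)"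
      by (intro add_right_mono mult_left_mono drift Suc.prems) auto
    also have "\<dots> = 2 * (ennreal \<bar>q x x\<bar> * ennreal (v x) + ennreal b * (indicator C x + (\<integral>\<^sup>+y. ennreal (q x y) * ?w k y \<partial>?A)))"
      by (simp add: distrib_left mult_ac add_ac)
    also have "indicator C x + (\<integral>\<^sup>+y. ennreal (q x y) * ?w k y \<partial>?A) = ennreal \<bar>q x x\<bar> * ?w (Suc k) x"
      by (rule hit_iter_Suc_eq[OF Suc.prems False, symmetric])
    also have "2 * (ennreal \<bar>q x x\<bar> * ennreal (v x) + ennreal b * (ennreal \<bar>q x x\<bar> * ?w (Suc k) x))
      = ennreal \<bar>q x x\<bar> * (2 * (ennreal (v x) + ennreal b * ?w (Suc k) x))"
      by (simp only: distrib_left mult_ac)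
    finally show ?thesis by (rule rate_le_cancel[OF Suc.prems])
  qed simp
qed simp

text \<open>
  The supremum of the approximations is finite by the two preceding bounds, and by monotone convergence it solves the
  equation \<open>Q h = - f\<close> off the target.
\<close>

lemma hitting_solution:
  fixes v :: "'s \<Rightarrow> real" and b \<kappa> :: real and f :: "'s \<Rightarrow> real"
  assumes drift: "\<And>x. x \<in> S \<Longrightarrow> 1 + (\<integral>\<^sup>+y. ennreal (q x y) * ennreal (v y) \<partial>count_space (S - {x}))
      \<le> ennreal b * indicator C x + ennreal \<bar>q x x\<bar> * ennreal (v x)"
    and v: "\<And>x. x \<in> S \<Longrightarrow> 0 \<le> v x" and b: "0 \<le> b" and \<kappa>: "0 \<le> \<kappa>"
    and hit: "\<And>x k. x \<in> S \<Longrightarrow> hit_iter y\<^sub>0 (indicator C) k x \<le> ennreal \<kappa>"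
    and f: "\<And>x. x \<in> S \<Longrightarrow> 0 \<le> f x \<and> f x \<le> 2"
  obtains h where "\<And>x. x \<in> S \<Longrightarrow> 0 \<le> h x \<and> h x \<le> 2 * (v x + b * \<kappa>)"
    "\<And>x. x \<in> S \<Longrightarrow> x \<noteq> y\<^sub>0 \<Longrightarrow> ((\<lambda>y. q x y * h y) has_sum - f x) S"
proof -
  let ?u = "hit_iter y\<^sub>0 (\<lambda>x. ennreal (f x))"
  define g where "g x = (SUP k. ?u k x)" for x
  define h where "h x = enn2real (g x)" for x
  have g_le: "g x \<le> ennreal (2 * (v x + b * \<kappa>))" if x: "x \<in> S" for x
    unfolding g_def
  proof (rule SUP_least)
    fix k
    have "?u k x \<le> 2 * (ennreal (v x) + ennreal b * hit_iter y\<^sub>0 (indicator C) k x)"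
      using f x by (intro hit_iter_le_drift[OF drift]) (auto simp: ennreal_numeral[symmetric] simp del: ennreal_numeral)
    also have "\<dots> \<le> 2 * (ennreal (v x) + ennreal b * ennreal \<kappa>)"
      by (intro mult_left_mono add_left_mono hit x) auto
    also have "\<dots> = ennreal (2 * (v x + b * \<kappa>))"
      using v[OF x] b \<kappa> by (simp add: ennreal_mult ennreal_plus)
    finally show "?u k x \<le> ennreal (2 * (v x + b * \<kappa>))" .
  qed
  have g_h: "g x = ennreal (h x)" if "x \<in> S" for x
    using g_le[OF that] unfolding h_def by (subst ennreal_enn2real) (auto intro: le_less_trans)
  have h0: "0 \<le> h x" for x by (simp add: h_def)
  have h_le: "h x \<le> 2 * (v x + b * \<kappa>)" if "x \<in> S" for x
    using g_le[OF that] v[OF that] b \<kappa> unfolding g_h[OF that] by (subst (asm) ennreal_le_iff) auto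
  have "((\<lambda>y. q x y * h y) has_sum - f x) S" if x: "x \<in> S" "x \<noteq> y\<^sub>0" for x
  proof -
    let ?A = "count_space (S - {x})"
    have lim: "(\<lambda>k. ?u k y) \<longlonglongrightarrow> g y" for y
      unfolding g_def by (rule LIMSEQ_SUP[OF incseq_hit_iter])
    have "(\<lambda>k. ennreal \<bar>q x x\<bar> * ?u (Suc k) x) \<longlonglongrightarrow> ennreal \<bar>q x x\<bar> * g x"
      by (intro ennreal_tendsto_cmult LIMSEQ_Suc lim) auto
    moreover have "(\<lambda>k. ennreal \<bar>q x x\<bar> * ?u (Suc k) x) \<longlonglongrightarrow> ennreal (f x) + (\<integral>\<^sup>+y. ennreal (q x y) * g y \<partial>?A)"
    proof -
      have inc: "incseq (\<lambda>k y. ennreal (q x y) * ?u k y)"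
        using incseq_hit_iter by (auto simp: incseq_def le_fun_def intro!: mult_left_mono)
      have "(\<lambda>k. \<integral>\<^sup>+y. ennreal (q x y) * ?u k y \<partial>?A) \<longlonglongrightarrow> (SUP k. \<integral>\<^sup>+y. ennreal (q x y) * ?u k y \<partial>?A)"
        by (intro LIMSEQ_SUP) (auto simp: incseq_def intro!: nn_integral_mono mult_left_mono incseq_hit_iter[unfolded incseq_def, rule_format])
      also have "(SUP k. \<integral>\<^sup>+y. ennreal (q x y) * ?u k y \<partial>?A) = (\<integral>\<^sup>+y. (SUP k. ennreal (q x y) * ?u k y) \<partial>?A)"
        by (rule nn_integral_monotone_convergence_SUP[OF inc, symmetric]) simp
      also have "\<dots> = (\<integral>\<^sup>+y. ennreal (q x y) * g y \<partial>?A)"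
        unfolding g_def by (simp add: SUP_mult_left_ennreal)
      finally have "(\<lambda>k. ennreal (f x) + (\<integral>\<^sup>+y. ennreal (q x y) * ?u k y \<partial>?A)) \<longlonglongrightarrow> ennreal (f x) + (\<integral>\<^sup>+y. ennreal (q x y) * g y \<partial>?A)"
        by (intro tendsto_add tendsto_const)
      then show ?thesis by (simp only: hit_iter_Suc_eq[OF x])
    qed
    ultimately have eq: "ennreal \<bar>q x x\<bar> * g x = ennreal (f x) + (\<integral>\<^sup>+y. ennreal (q x y) * g y \<partial>?A)"
      by (rule LIMSEQ_unique)
    let ?I = "\<integral>\<^sup>+y. ennreal (q x y * h y) \<partial>?A"
    have I: "(\<integral>\<^sup>+y. ennreal (q x y) * g y \<partial>?A) = ?I"
      using x off_nonneg[of x] h0 by (intro nn_integral_cong) (auto simp: g_h ennreal_mult)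
    have eq': "ennreal (\<bar>q x x\<bar> * h x) = ennreal (f x) + ?I"
      using eq h0 by (simp add: I g_h x ennreal_mult)
    have I_eq: "?I = ennreal (\<bar>q x x\<bar> * h x - f x)"
    proof -
      have "?I = (ennreal (f x) + ?I) - ennreal (f x)" by simp
      also have "\<dots> = ennreal (\<bar>q x x\<bar> * h x) - ennreal (f x)" by (simp only: eq')
      also have "\<dots> = ennreal (\<bar>q x x\<bar> * h x - f x)" using f[OF x(1)] by (simp add: ennreal_minus)
      finally show ?thesis .
    qed
    have "ennreal (f x) \<le> ennreal (\<bar>q x x\<bar> * h x)" unfolding eq' by simp
    then have nonneg: "0 \<le> \<bar>q x x\<bar> * h x - f x"
      using h0 by (subst (asm) ennreal_le_iff) auto
    have "((\<lambda>y. q x y * h y) has_sum (\<bar>q x x\<bar> * h x - f x)) (S - {x})"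
      using x off_nonneg[of x] h0 by (intro has_sum_nn_integral_count_space[OF I_eq nonneg]) auto
    then have "((\<lambda>y. q x y * h y) has_sum (q x x * h x + (\<bar>q x x\<bar> * h x - f x))) (insert x (S - {x}))"
      by (intro has_sum_insert) auto
    then show ?thesis using x rate_neg[of x] by (simp add: insert_absorb)
  qed
  then show ?thesis using that[of h] h0 h_le by auto
qed

end

section \<open>The error of an augmented truncation\<close>

lemma has_sum_diff:
  fixes f g :: "'a \<Rightarrow> 'b :: real_normed_vector"
  assumes "(f has_sum a) A" "(g has_sum b) A"
  shows "((\<lambda>x. f x - g x) has_sum (a - b)) A"
  using has_sum_add[OF assms(1), of "\<lambda>x. - g x" "- b"] assms(2) by (simp add: has_sum_uminus)

lemma has_sum_sum:
  fixes f :: "'i \<Rightarrow> 'a \<Rightarrow> 'b :: topological_comm_monoid_add"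
  assumes "\<And>i. i \<in> I \<Longrightarrow> (f i has_sum s i) A"
  shows "((\<lambda>x. \<Sum>i\<in>I. f i x) has_sum (\<Sum>i\<in>I. s i)) A"
  using assms by (induction I rule: infinite_finite_induct) (auto intro: has_sum_add)

context infinite_generator
begin

text \<open>
  In each column of \<open>Q\<close>, weighted by \<open>p\<close>, the off-diagonal mass equals the diagonal mass
  \<open>p y * \<bar>q y y\<bar>\<close>; so one moment of \<open>h\<close> dominates the whole double series.
\<close>

lemma product_summable:
  fixes p :: "'s \<Rightarrow> real" and h :: "'s \<Rightarrow> real"
  assumes p: "\<And>x. x \<in> S \<Longrightarrow> 0 \<le> p x" "\<And>y. y \<in> S \<Longrightarrow> ((\<lambda>x. p x * q x y) has_sum 0) S"
    and h: "(\<lambda>y. p y * \<bar>q y y\<bar> * \<bar>h y\<bar>) summable_on S"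
  shows "(\<lambda>(y, x). p x * q x y * h y) summable_on S \<times> S"
proof -
  have col: "((\<lambda>x. norm (p x * q x y * h y)) has_sum 2 * (p y * \<bar>q y y\<bar> * \<bar>h y\<bar>)) S" if y: "y \<in> S" for y
  proof -
    have "((\<lambda>x. p x * q x y) has_sum 0 - p y * q y y) (S - {y})"
      using has_sum_Diff[OF p(2)[OF y], of "{y}" "p y * q y y"] y by (simp add: has_sum_finite_iff)
    then have "((\<lambda>x. norm (p x * q x y)) has_sum p y * \<bar>q y y\<bar>) (S - {y})"
      using y p(1) off_nonneg rate_neg[OF y] by (subst has_sum_cong[where g = "\<lambda>x. p x * q x y"]) auto
    then have "((\<lambda>x. norm (p x * q x y)) has_sum norm (p y * q y y) + p y * \<bar>q y y\<bar>) (insert y (S - {y}))"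
      by (intro has_sum_insert) auto
    then have "((\<lambda>x. norm (p x * q x y)) has_sum 2 * (p y * \<bar>q y y\<bar>)) S"
      using y p(1)[OF y] by (simp add: insert_absorb abs_mult)
    then have "((\<lambda>x. norm (p x * q x y) * \<bar>h y\<bar>) has_sum 2 * (p y * \<bar>q y y\<bar>) * \<bar>h y\<bar>) S"
      by (rule has_sum_cmult_left)
    then show ?thesis by (simp add: abs_mult mult.assoc)
  qed
  have "(\<lambda>z. norm ((\<lambda>(y, x). p x * q x y * h y) z)) summable_on S \<times> S"
  proof (rule Infinite_Sum.abs_summable_on_Sigma_iff[THEN iffD2], intro conjI ballI)
    show "(\<lambda>x. norm (case (y, x) of (y, x) \<Rightarrow> p x * q x y * h y)) summable_on S" if "y \<in> S" for y
      using has_sum_imp_summable[OF col[OF that]] by simp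
    have "(\<lambda>y. 2 * (p y * \<bar>q y y\<bar> * \<bar>h y\<bar>)) summable_on S"
      by (intro summable_on_cmult_right h)
    also have "(\<lambda>y. 2 * (p y * \<bar>q y y\<bar> * \<bar>h y\<bar>)) summable_on S \<longleftrightarrow>
      (\<lambda>y. norm (\<Sum>\<^sub>\<infinity>x\<in>S. norm (case (y, x) of (y, x) \<Rightarrow> p x * q x y * h y))) summable_on S"
    proof (intro summable_on_cong)
      fix y assume y: "y \<in> S"
      have "0 \<le> 2 * (p y * \<bar>q y y\<bar> * \<bar>h y\<bar>)" using p(1)[OF y] by simp
      moreover have "(\<Sum>\<^sub>\<infinity>x\<in>S. norm (p x * q x y * h y)) = 2 * (p y * \<bar>q y y\<bar> * \<bar>h y\<bar>)"
        by (rule infsumI[OF col[OF y]])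
      ultimately show "2 * (p y * \<bar>q y y\<bar> * \<bar>h y\<bar>) = norm (\<Sum>\<^sub>\<infinity>x\<in>S. norm (case (y, x) of (y, x) \<Rightarrow> p x * q x y * h y))"
        by simp
    qed
    finally show "(\<lambda>y. norm (\<Sum>\<^sub>\<infinity>x\<in>S. norm (case (y, x) of (y, x) \<Rightarrow> p x * q x y * h y))) summable_on S" .
  qed
  then show ?thesis by (rule abs_summable_summable)
qed

text \<open>
  Stationarity tested against an unbounded \<open>h\<close>: the double series converges absolutely, so the order of
  summation may be exchanged.
\<close>

lemma stationary_infsum_zero:
  fixes p :: "'s \<Rightarrow> real" and h :: "'s \<Rightarrow> real"
  assumes p: "\<And>x. x \<in> S \<Longrightarrow> 0 \<le> p x" "\<And>y. y \<in> S \<Longrightarrow> ((\<lambda>x. p x * q x y) has_sum 0) S"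
    and h: "(\<lambda>y. p y * \<bar>q y y\<bar> * \<bar>h y\<bar>) summable_on S"
    and Qh: "\<And>x. x \<in> S \<Longrightarrow> ((\<lambda>y. q x y * h y) has_sum Qh x) S"
  shows "((\<lambda>x. p x * Qh x) has_sum 0) S"
proof -
  have sum: "(\<lambda>(y, x). p x * q x y * h y) summable_on S \<times> S"
    by (rule product_summable[OF p h])
  then have sum': "(\<lambda>(x, y). p x * q x y * h y) summable_on S \<times> S"
    by (subst summable_on_swap) simp
  have in1: "(\<Sum>\<^sub>\<infinity>y\<in>S. p x * q x y * h y) = p x * Qh x" if "x \<in> S" for x
    using has_sum_cmult_right[OF Qh[OF that], of "p x"] by (auto dest!: infsumI simp: mult.assoc)
  have in2: "(\<Sum>\<^sub>\<infinity>x\<in>S. p x * q x y * h y) = 0" if "y \<in> S" for y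
    using has_sum_cmult_left[OF p(2)[OF that], of "h y"] by (auto dest!: infsumI)
  have "(\<lambda>x. \<Sum>\<^sub>\<infinity>y\<in>S. p x * q x y * h y) summable_on S"
    using summable_on_Sigma_banach[OF sum'] by simp
  then have "(\<lambda>x. p x * Qh x) summable_on S"
    by (rule summable_on_cong[THEN iffD1, rotated]) (rule in1)
  moreover have "(\<Sum>\<^sub>\<infinity>x\<in>S. p x * Qh x) = 0"
  proof -
    have "(\<Sum>\<^sub>\<infinity>x\<in>S. p x * Qh x) = (\<Sum>\<^sub>\<infinity>x\<in>S. \<Sum>\<^sub>\<infinity>y\<in>S. p x * q x y * h y)"
      by (intro infsum_cong) (simp add: in1)
    also have "\<dots> = (\<Sum>\<^sub>\<infinity>y\<in>S. \<Sum>\<^sub>\<infinity>x\<in>S. p x * q x y * h y)"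
      using sum' by (rule infsum_swap_banach)
    also have "\<dots> = 0" by (rule infsum_0) (rule in2)
    finally show ?thesis .
  qed
  ultimately show ?thesis by (metis has_sum_infsum)
qed

text \<open>
  The row \<open>X / u\<close> of the inverse is the stationary distribution of the truncation whose outflow is
  redirected to the state \<open>i\<close>. The hypothesis on \<open>f\<close> provides solutions of \<open>Q h = - f\<close> off \<open>y\<^sub>0\<close>; the positive and
  the negative part of \<open>g - p g\<close> are solved separately, which keeps \<open>\<bar>h\<bar>\<close> below the same bound, and
  stationarity of \<open>p\<close> extends the equation to \<open>y\<^sub>0\<close>. The constant \<open>\<kappa>\<close> is counted twice, once at \<open>i\<close> and once in
  the total outflow, which is \<open>1\<close>.
\<close>

lemma augmentation_error:
  fixes p v :: "'s \<Rightarrow> real" and \<kappa> :: real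
  assumes p: "\<And>x. x \<in> S \<Longrightarrow> 0 < p x" "(p has_sum 1) S" "\<And>y. y \<in> S \<Longrightarrow> ((\<lambda>x. p x * q x y) has_sum 0) S"
    and v: "\<And>x. x \<in> S \<Longrightarrow> 0 \<le> v x" "\<And>x. x \<in> S \<Longrightarrow> (\<lambda>y. q x y * v y) summable_on S"
    and weights: "(\<lambda>y. p y * \<bar>q y y\<bar>) summable_on S" "(\<lambda>y. p y * \<bar>q y y\<bar> * v y) summable_on S"
    and \<kappa>: "0 \<le> \<kappa>" and y0: "y\<^sub>0 \<in> S"
    and solve: "\<And>f. (\<And>x. x \<in> S \<Longrightarrow> 0 \<le> f x \<and> f x \<le> 2) \<Longrightarrow>
       \<exists>h. (\<forall>x\<in>S. 0 \<le> h x \<and> h x \<le> 2 * (v x + \<kappa>)) \<and> (\<forall>x\<in>S - {y\<^sub>0}. ((\<lambda>y. q x y * h y) has_sum - f x) S)"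
    and A: "finite A" "A \<subseteq> S" and i: "i \<in> A"
  defines "X \<equiv> inverse_on A (\<lambda>x y. - q x y) i"
  defines "u \<equiv> sum X A"
  shows "norm1 S (\<lambda>x. (if x \<in> A then X x / u else 0) - p x) \<le>
     2 * ((v i + (\<Sum>x\<in>A. X x * (\<Sum>\<^sub>\<infinity>z\<in>S - A. q x z * v z))) / u + 1 / u * (2 * \<kappa>))"
proof -
  have inv: "(\<Sum>k\<in>A. X k * - q k j) = (if i = j then 1 else 0)" if "j \<in> A" for j
    using truncated_inverse[OF A] i that by (auto simp: is_inverse_on_def X_def)
  have X0: "0 \<le> X x" for x unfolding X_def by (rule truncated_inverse_nonneg[OF A])
  have u: "0 < u" unfolding u_def X_def by (rule truncated_row_sum_pos[OF A i])
  define ph where "ph x = (if x \<in> A then X x / u else 0)" for x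
  have ph_sum: "(\<Sum>x\<in>A. ph x) = 1" using u by (simp add: ph_def sum_divide_distrib[symmetric] u_def)
  have ph_has_sum: "((\<lambda>x. ph x * g x) has_sum (\<Sum>x\<in>A. ph x * g x)) S" for g
    using A by (intro has_sum_finite_neutralI) (auto simp: ph_def)
  \<comment> \<open>The test function that turns the norm into a linear functional.\<close>
  define g where "g x = sgn (ph x - p x)" for x
  have g_le: "\<bar>g x\<bar> \<le> 1" for x by (simp add: g_def sgn_if)
  have "(\<lambda>x. p x * g x) summable_on S"
  proof (rule abs_summable_summable, rule summable_on_comparison_test)
    show "p summable_on S" using p(2) by (rule has_sum_imp_summable)
    show "norm (p x * g x) \<le> p x" if "x \<in> S" for x
      using g_le[of x] p(1)[OF that] by (simp add: abs_mult mult_left_le)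
  qed auto
  then obtain a where a: "((\<lambda>x. p x * g x) has_sum a) S" by (auto simp: summable_on_def)
  have "a \<le> 1" using g_le p by (intro has_sum_mono[OF a p(2)]) (auto simp: abs_le_iff mult_left_le)
  moreover have "-1 \<le> a"
  proof -
    have "((\<lambda>x. - p x) has_sum -1) S" using p(2) by (simp add: has_sum_uminus)
    then show ?thesis
    proof (rule has_sum_mono[OF _ a])
      fix x assume "x \<in> S"
      then show "- p x \<le> p x * g x"
        using g_le[of x] p(1)[of x] mult_left_mono[of "-1" "g x" "p x"] by auto
    qed
  qed
  ultimately have a_le: "\<bar>a\<bar> \<le> 1" by simp
  define f where "f x = g x - a" for x
  have f_le: "\<bar>f x\<bar> \<le> 2" for x using g_le[of x] a_le by (simp add: f_def)
  obtain h1 where h1: "\<And>x. x \<in> S \<Longrightarrow> 0 \<le> h1 x \<and> h1 x \<le> 2 * (v x + \<kappa>)"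
    "\<And>x. x \<in> S - {y\<^sub>0} \<Longrightarrow> ((\<lambda>y. q x y * h1 y) has_sum - max 0 (f x)) S"
    using solve[of "\<lambda>x. max 0 (f x)"] f_le by (auto simp: abs_le_iff)
  obtain h2 where h2: "\<And>x. x \<in> S \<Longrightarrow> 0 \<le> h2 x \<and> h2 x \<le> 2 * (v x + \<kappa>)"
    "\<And>x. x \<in> S - {y\<^sub>0} \<Longrightarrow> ((\<lambda>y. q x y * h2 y) has_sum - max 0 (- f x)) S"
    using solve[of "\<lambda>x. max 0 (- f x)"] f_le by (auto simp: abs_le_iff)
  define h where "h x = h1 x - h2 x" for x
  have h_le: "\<bar>h x\<bar> \<le> 2 * (v x + \<kappa>)" if "x \<in> S" for x
    using h1(1)[OF that] h2(1)[OF that] by (auto simp: h_def)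
  have Qh_off: "((\<lambda>y. q x y * h y) has_sum - f x) S" if "x \<in> S" "x \<noteq> y\<^sub>0" for x
  proof -
    have "((\<lambda>y. q x y * h1 y - q x y * h2 y) has_sum (- max 0 (f x)) - (- max 0 (- f x))) S"
      using that by (intro has_sum_diff h1 h2) auto
    moreover have "(- max 0 (f x)) - (- max 0 (- f x)) = - f x" by (simp add: max_def)
    ultimately show ?thesis by (simp add: h_def right_diff_distrib)
  qed
  have abs_q: "(\<lambda>y. norm (q x y * w y)) summable_on S" if "(\<lambda>y. q x y * w y) summable_on S" for x w
    using summable_on_iff_abs_summable_on_real[THEN iffD1, OF that] .
  have qv: "(\<lambda>y. \<bar>q x y\<bar> * (v y + \<kappa>)) summable_on S" if x: "x \<in> S" for x
  proof -
    have "(\<lambda>y. norm (q x y * v y) + norm (q x y * \<kappa>)) summable_on S"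
      using v(2)[OF x] has_sum_imp_summable[OF row_has_sum[OF x]]
      by (intro summable_on_add abs_q summable_on_cmult_left)
    then show ?thesis
      by (rule summable_on_cong[THEN iffD1, rotated]) (use v(1) \<kappa> in \<open>auto simp: abs_mult distrib_left\<close>)
  qed
  have qh: "(\<lambda>y. q x y * h y) summable_on S" if x: "x \<in> S" for x
  proof (rule abs_summable_summable, rule summable_on_comparison_test)
    show "(\<lambda>y. 2 * (\<bar>q x y\<bar> * (v y + \<kappa>))) summable_on S"
      by (intro summable_on_cmult_right qv x)
    show "norm (q x y * h y) \<le> 2 * (\<bar>q x y\<bar> * (v y + \<kappa>))" if "y \<in> S" for y
      using mult_left_mono[OF h_le[OF that], of "\<bar>q x y\<bar>"] by (simp add: abs_mult algebra_simps)
  qed auto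
  define Qh where "Qh x = (\<Sum>\<^sub>\<infinity>y\<in>S. q x y * h y)" for x
  have Qh: "((\<lambda>y. q x y * h y) has_sum Qh x) S" if "x \<in> S" for x
    unfolding Qh_def by (intro has_sum_infsum qh that)
  have "(\<lambda>y. p y * \<bar>q y y\<bar> * \<bar>h y\<bar>) summable_on S"
  proof (rule summable_on_comparison_test)
    show "(\<lambda>y. 2 * (p y * \<bar>q y y\<bar> * v y + p y * \<bar>q y y\<bar> * \<kappa>)) summable_on S"
      by (intro summable_on_cmult_right summable_on_add summable_on_cmult_left weights)
    show "p y * \<bar>q y y\<bar> * \<bar>h y\<bar> \<le> 2 * (p y * \<bar>q y y\<bar> * v y + p y * \<bar>q y y\<bar> * \<kappa>)" if "y \<in> S" for y
    proof -
      have "p y * \<bar>q y y\<bar> * \<bar>h y\<bar> \<le> p y * \<bar>q y y\<bar> * (2 * (v y + \<kappa>))"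
        using p(1)[OF that] by (intro mult_left_mono h_le that) auto
      then show ?thesis by (simp add: algebra_simps)
    qed
    show "0 \<le> p y * \<bar>q y y\<bar> * \<bar>h y\<bar>" if "y \<in> S" for y using p(1)[OF that] by simp
  qed
  then have pQh: "((\<lambda>x. p x * Qh x) has_sum 0) S"
    using p by (intro stationary_infsum_zero[OF _ p(3) _ Qh]) (auto intro: less_imp_le)
  have "((\<lambda>x. p x * g x - a * p x) has_sum a - a * 1) S"
    by (intro has_sum_diff a has_sum_cmult_right p(2))
  then have pf: "((\<lambda>x. p x * f x) has_sum 0) S"
    by (simp add: f_def right_diff_distrib mult.commute)
  \<comment> \<open>Off \<open>y\<^sub>0\<close> all terms of this series vanish, so the term at \<open>y\<^sub>0\<close> does too.\<close>
  have "((\<lambda>x. p x * Qh x + p x * f x) has_sum 0 + 0) S"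
    by (intro has_sum_add pQh pf)
  moreover have "((\<lambda>x. p x * Qh x + p x * f x) has_sum p y\<^sub>0 * (Qh y\<^sub>0 + f y\<^sub>0)) S"
  proof (rule has_sum_finite_neutralI[of "{y\<^sub>0}"])
    fix x assume x: "x \<in> S - {y\<^sub>0}"
    have "Qh x = - f x" using infsumI[OF Qh_off] x by (auto simp: Qh_def)
    then show "p x * Qh x + p x * f x = 0" by simp
  qed (use y0 in \<open>auto simp: distrib_left\<close>)
  ultimately have "p y\<^sub>0 * (Qh y\<^sub>0 + f y\<^sub>0) = 0"
    using has_sum_unique by fastforce
  then have "Qh y\<^sub>0 = - f y\<^sub>0" using p(1)[OF y0] by simp
  then have Qh_eq: "((\<lambda>y. q x y * h y) has_sum - f x) S" if "x \<in> S" for x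
    using Qh[OF that] Qh_off[OF that] by (cases "x = y\<^sub>0") auto
  have tail: "((\<lambda>z. q x z * h z) has_sum - f x - (\<Sum>y\<in>A. q x y * h y)) (S - A)" if "x \<in> S" for x
    using A by (intro has_sum_Diff[OF Qh_eq[OF that] has_sum_finite]) auto
  have "norm1 S (\<lambda>x. ph x - p x) = (\<Sum>\<^sub>\<infinity>x\<in>S. ph x * g x - p x * g x)"
    unfolding norm1_def by (intro infsum_cong) (auto simp: g_def sgn_if)
  also have "\<dots> = (\<Sum>x\<in>A. ph x * g x) - a"
    by (intro infsumI has_sum_diff a ph_has_sum)
  also have "\<dots> = (\<Sum>x\<in>A. ph x * f x)"
    using ph_sum by (simp add: f_def right_diff_distrib sum_subtractf sum_distrib_right[symmetric])
  also have "\<dots> = (\<Sum>x\<in>A. X x * f x) / u"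
    by (simp add: ph_def sum_divide_distrib)
  also have "(\<Sum>x\<in>A. X x * f x) = h i - (\<Sum>x\<in>A. X x * (\<Sum>\<^sub>\<infinity>z\<in>S - A. q x z * h z))"
  proof -
    have "X x * f x = (\<Sum>y\<in>A. X x * - q x y * h y) - X x * (\<Sum>\<^sub>\<infinity>z\<in>S - A. q x z * h z)" if "x \<in> A" for x
    proof -
      have "f x = - (\<Sum>y\<in>A. q x y * h y) - (\<Sum>\<^sub>\<infinity>z\<in>S - A. q x z * h z)"
        using infsumI[OF tail[of x]] that A by auto
      then show ?thesis by (simp add: right_diff_distrib sum_negf sum_distrib_left mult.assoc)
    qed
    then have "(\<Sum>x\<in>A. X x * f x) = (\<Sum>x\<in>A. \<Sum>y\<in>A. X x * - q x y * h y) - (\<Sum>x\<in>A. X x * (\<Sum>\<^sub>\<infinity>z\<in>S - A. q x z * h z))"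
      by (simp add: sum_subtractf)
    also have "(\<Sum>x\<in>A. \<Sum>y\<in>A. X x * - q x y * h y) = (\<Sum>y\<in>A. (\<Sum>x\<in>A. X x * - q x y) * h y)"
      unfolding sum_distrib_right by (rule sum.swap)
    also have "\<dots> = (\<Sum>y\<in>A. (if i = y then 1 else 0) * h y)"
      by (intro sum.cong refl) (simp only: inv)
    also have "\<dots> = h i" using A i by (simp add: if_distrib if_distribR cong: if_cong)
    finally show ?thesis .
  qed
  also have "\<dots> \<le> 2 * (v i + \<kappa>) + (\<Sum>x\<in>A. X x * (2 * ((\<Sum>\<^sub>\<infinity>z\<in>S - A. q x z * v z) - \<kappa> * (\<Sum>y\<in>A. q x y))))"
  proof -
    have "- (X x * (\<Sum>\<^sub>\<infinity>z\<in>S - A. q x z * h z)) \<le> X x * (2 * ((\<Sum>\<^sub>\<infinity>z\<in>S - A. q x z * v z) - \<kappa> * (\<Sum>y\<in>A. q x y)))" if x: "x \<in> A" for x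
    proof -
      have xS: "x \<in> S" using x A by auto
      have s1: "((\<lambda>z. q x z * v z) has_sum (\<Sum>\<^sub>\<infinity>z\<in>S - A. q x z * v z)) (S - A)"
        by (intro has_sum_infsum summable_on_subset_banach[OF v(2)[OF xS]]) auto
      have s2: "(q x has_sum 0 - (\<Sum>y\<in>A. q x y)) (S - A)"
        using A by (intro has_sum_Diff[OF row_has_sum[OF xS] has_sum_finite]) auto
      have s3: "((\<lambda>z. 2 * (q x z * v z + \<kappa> * q x z)) has_sum 2 * ((\<Sum>\<^sub>\<infinity>z\<in>S - A. q x z * v z) + \<kappa> * (0 - (\<Sum>y\<in>A. q x y)))) (S - A)"
        by (intro has_sum_cmult_right has_sum_add s1 s2)
      have s4: "((\<lambda>z. - (q x z * h z)) has_sum - (\<Sum>\<^sub>\<infinity>z\<in>S - A. q x z * h z)) (S - A)"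
        using tail[OF xS] by (simp only: infsumI[OF tail[OF xS]] has_sum_uminus minus_minus)
      have "- (\<Sum>\<^sub>\<infinity>z\<in>S - A. q x z * h z) \<le> 2 * ((\<Sum>\<^sub>\<infinity>z\<in>S - A. q x z * v z) + \<kappa> * (0 - (\<Sum>y\<in>A. q x y)))"
      proof (rule has_sum_mono[OF s4 s3])
        fix z assume z: "z \<in> S - A"
        then have "0 \<le> q x z" using x xS by (intro off_nonneg) auto
        then have "q x z * - h z \<le> q x z * (2 * (v z + \<kappa>))"
          using h_le[of z] z by (intro mult_left_mono) auto
        then show "- (q x z * h z) \<le> 2 * (q x z * v z + \<kappa> * q x z)" by (simp add: algebra_simps)
      qed
      from mult_left_mono[OF this X0[of x]] show ?thesis by (simp add: algebra_simps)
    qed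
    then have "(\<Sum>x\<in>A. - (X x * (\<Sum>\<^sub>\<infinity>z\<in>S - A. q x z * h z))) \<le> (\<Sum>x\<in>A. X x * (2 * ((\<Sum>\<^sub>\<infinity>z\<in>S - A. q x z * v z) - \<kappa> * (\<Sum>y\<in>A. q x y))))"
      by (rule sum_mono)
    moreover have "h i \<le> 2 * (v i + \<kappa>)" using h_le[of i] i A by auto
    ultimately show ?thesis by (simp add: sum_negf)
  qed
  also have "(\<Sum>x\<in>A. X x * (2 * ((\<Sum>\<^sub>\<infinity>z\<in>S - A. q x z * v z) - \<kappa> * (\<Sum>y\<in>A. q x y))))
     = 2 * (\<Sum>x\<in>A. X x * (\<Sum>\<^sub>\<infinity>z\<in>S - A. q x z * v z)) + 2 * \<kappa> * (\<Sum>x\<in>A. \<Sum>y\<in>A. X x * - q x y)"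
    by (simp add: sum_distrib_left sum_negf sum_subtractf algebra_simps)
  also have "(\<Sum>x\<in>A. \<Sum>y\<in>A. X x * - q x y) = (\<Sum>y\<in>A. \<Sum>x\<in>A. X x * - q x y)"
    by (rule sum.swap)
  also have "\<dots> = (\<Sum>y\<in>A. if i = y then 1 else 0)"
    by (intro sum.cong refl) (rule inv)
  also have "\<dots> = 1" using A i by simp
  finally have "norm1 S (\<lambda>x. ph x - p x) \<le>
      (2 * (v i + \<kappa>) + (2 * (\<Sum>x\<in>A. X x * (\<Sum>\<^sub>\<infinity>z\<in>S - A. q x z * v z)) + 2 * \<kappa> * 1)) / u"
    using u by (simp add: divide_right_mono)
  then show ?thesis
    by (simp add: ph_def add_divide_distrib algebra_simps)
qed

lemma column_off_has_sum:
  fixes p :: "'s \<Rightarrow> real"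
  assumes p: "\<And>y. y \<in> S \<Longrightarrow> ((\<lambda>x. p x * q x y) has_sum 0) S" and y: "y \<in> S"
  shows "((\<lambda>x. p x * q x y) has_sum p y * \<bar>q y y\<bar>) (S - {y})"
  using has_sum_Diff[OF p[OF y], of "{y}" "p y * q y y"] y rate_neg[OF y] by (simp add: has_sum_finite_iff)

lemma column_partial_le:
  fixes p :: "'s \<Rightarrow> real"
  assumes p: "\<And>x. x \<in> S \<Longrightarrow> 0 < p x" "\<And>y. y \<in> S \<Longrightarrow> ((\<lambda>x. p x * q x y) has_sum 0) S"
    and y: "y \<in> S" and D: "D \<subseteq> S - {y}"
  shows "(\<Sum>\<^sub>\<infinity>x\<in>D. p x * q x y) \<le> p y * \<bar>q y y\<bar>"
proof (rule has_sum_mono2[OF has_sum_infsum column_off_has_sum[OF p(2) y] D])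
  show "(\<lambda>x. p x * q x y) summable_on D"
    using has_sum_imp_summable[OF p(2)[OF y]] D by (intro summable_on_subset_banach[of _ S D]) auto
  show "0 \<le> p x * q x y" if "x \<in> S - {y} - D" for x
    using that y p(1)[of x] off_nonneg[of x y] by auto
qed

text \<open>
  Let \<open>\<eta>\<close> be the stationary flow from outside \<open>A\<close> into \<open>L\<close>, the only part of \<open>A\<close> that can be entered from
  outside. The balance equations read \<open>p (-Q\<^sub>A) = \<eta>\<close> on \<open>A\<close>, hence \<open>p = \<eta> X\<close> there. The minimal ratio is at
  most the \<open>\<eta>\<close>-weighted one, whose denominator is \<open>sum p A\<close> and whose numerator
  consists of stationary flows, each bounded by the total flow \<open>p z * \<bar>q z z\<bar>\<close> through its target.
\<close>

lemma minimal_ratio_bound: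
  fixes p v :: "'s \<Rightarrow> real"
  assumes p: "\<And>x. x \<in> S \<Longrightarrow> 0 < p x" "\<And>y. y \<in> S \<Longrightarrow> ((\<lambda>x. p x * q x y) has_sum 0) S"
    and v: "\<And>x. x \<in> S \<Longrightarrow> 0 \<le> v x" "\<And>x. x \<in> S \<Longrightarrow> (\<lambda>y. q x y * v y) summable_on S"
    and weights: "(\<lambda>y. p y * \<bar>q y y\<bar> * v y) summable_on S"
    and A: "finite A" "A \<subseteq> S" and L: "L \<subseteq> A"
    and entrance: "\<And>x y. x \<in> S - A \<Longrightarrow> y \<in> A - L \<Longrightarrow> q x y = 0"
  defines "X \<equiv> inverse_on A (\<lambda>x y. - q x y)"
  defines "w i \<equiv> v i + (\<Sum>x\<in>A. X i x * (\<Sum>\<^sub>\<infinity>z\<in>S - A. q x z * v z))"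
  assumes pos: "\<And>i. i \<in> A \<Longrightarrow> 0 < sum (X i) A"
    and i: "i \<in> L" and minimal: "\<And>j. j \<in> L \<Longrightarrow> w i / sum (X i) A \<le> w j / sum (X j) A"
  shows "w i / sum (X i) A * sum p A \<le> (\<Sum>j\<in>L. p j * \<bar>q j j\<bar> * v j) + (\<Sum>\<^sub>\<infinity>z\<in>S - A. p z * \<bar>q z z\<bar> * v z)"
proof -
  have inv: "(\<Sum>k\<in>A. - q i k * X k j) = (if i = j then 1 else 0)" if "i \<in> A" "j \<in> A" for i j
    using truncated_inverse[OF A] that by (auto simp: is_inverse_on_def X_def)
  have finL: "finite L" using A L finite_subset by auto
  define \<eta> where "\<eta> y = (\<Sum>\<^sub>\<infinity>x\<in>S - A. p x * q x y)" for y
  have \<eta>0: "0 \<le> \<eta> y" if "y \<in> A" for y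
    unfolding \<eta>_def using that A p(1) off_nonneg[of _ y]
    by (intro infsum_nonneg mult_nonneg_nonneg) (auto intro: less_imp_le)
  have \<eta>_eq: "(\<Sum>x\<in>A. p x * - q x y) = \<eta> y" if y: "y \<in> A" for y
  proof -
    have yS: "y \<in> S" using y A by auto
    have "((\<lambda>x. p x * q x y) has_sum 0 - (\<Sum>x\<in>A. p x * q x y)) (S - A)"
      using A by (intro has_sum_Diff[OF p(2)[OF yS] has_sum_finite]) auto
    then show ?thesis unfolding \<eta>_def by (simp add: infsumI sum_negf)
  qed
  have p_eq: "p y = (\<Sum>j\<in>L. \<eta> j * X j y)" if y: "y \<in> A" for y
  proof -
    have "p y = (\<Sum>x\<in>A. p x * (if x = y then 1 else 0))"
      using y A by (simp add: if_distrib cong: if_cong)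
    also have "\<dots> = (\<Sum>x\<in>A. p x * (\<Sum>k\<in>A. - q x k * X k y))"
      by (intro sum.cong refl) (simp only: inv y)
    also have "\<dots> = (\<Sum>x\<in>A. \<Sum>k\<in>A. p x * - q x k * X k y)"
      by (simp only: sum_distrib_left mult.assoc)
    also have "\<dots> = (\<Sum>k\<in>A. \<Sum>x\<in>A. p x * - q x k * X k y)"
      by (rule sum.swap)
    also have "\<dots> = (\<Sum>k\<in>A. \<eta> k * X k y)"
      unfolding sum_distrib_right[symmetric] by (intro sum.cong refl) (simp only: \<eta>_eq)
    also have "\<dots> = (\<Sum>k\<in>L. \<eta> k * X k y)"
    proof (rule sum.mono_neutral_right[OF A(1) L], rule ballI)
      fix k assume k: "k \<in> A - L"
      have "\<eta> k = 0" unfolding \<eta>_def using entrance[OF _ k] by (intro infsum_0) auto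
      then show "\<eta> k * X k y = 0" by simp
    qed
    finally show ?thesis .
  qed
  let ?t = "\<lambda>x. \<Sum>\<^sub>\<infinity>z\<in>S - A. q x z * v z"
  let ?R = "w i / sum (X i) A"
  have swap: "(\<Sum>x\<in>A. p x * g x) = (\<Sum>j\<in>L. \<eta> j * (\<Sum>x\<in>A. X j x * g x))" for g
  proof -
    have "(\<Sum>x\<in>A. p x * g x) = (\<Sum>x\<in>A. \<Sum>j\<in>L. \<eta> j * X j x * g x)"
      by (intro sum.cong refl) (simp add: p_eq sum_distrib_right)
    also have "\<dots> = (\<Sum>j\<in>L. \<Sum>x\<in>A. \<eta> j * X j x * g x)" by (rule sum.swap)
    finally show ?thesis by (simp only: sum_distrib_left mult.assoc)
  qed
  have "?R * sum p A = (\<Sum>j\<in>L. \<eta> j * (?R * sum (X j) A))"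
  proof -
    have "sum p A = (\<Sum>j\<in>L. \<eta> j * sum (X j) A)" using swap[of "\<lambda>_. 1"] by (simp only: mult_1_right)
    moreover have "r * (\<Sum>j\<in>L. \<eta> j * s j) = (\<Sum>j\<in>L. \<eta> j * (r * s j))" for r s
      by (simp add: sum_distrib_left mult.left_commute)
    ultimately show ?thesis by (simp only:)
  qed
  also have "\<dots> \<le> (\<Sum>j\<in>L. \<eta> j * w j)"
  proof (intro sum_mono mult_left_mono)
    fix j assume j: "j \<in> L"
    show "?R * sum (X j) A \<le> w j" using minimal[OF j] pos[of j] j L by (auto simp: pos_le_divide_eq)
    show "0 \<le> \<eta> j" using j L by (intro \<eta>0) auto
  qed
  also have "\<dots> = (\<Sum>j\<in>L. \<eta> j * v j) + (\<Sum>x\<in>A. p x * ?t x)"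
    unfolding swap[of ?t] by (simp add: w_def distrib_left sum.distrib)
  also have "(\<Sum>j\<in>L. \<eta> j * v j) \<le> (\<Sum>j\<in>L. p j * \<bar>q j j\<bar> * v j)"
  proof (intro sum_mono mult_right_mono)
    fix j assume j: "j \<in> L"
    then have jS: "j \<in> S" and "j \<in> A" using L A by auto
    show "\<eta> j \<le> p j * \<bar>q j j\<bar>" unfolding \<eta>_def
      using \<open>j \<in> A\<close> by (intro column_partial_le[OF p jS]) auto
    show "0 \<le> v j" using v jS by simp
  qed
  also have "(\<Sum>x\<in>A. p x * ?t x) \<le> (\<Sum>\<^sub>\<infinity>z\<in>S - A. p z * \<bar>q z z\<bar> * v z)"
  proof (rule has_sum_mono)
    show "((\<lambda>z. \<Sum>x\<in>A. p x * (q x z * v z)) has_sum (\<Sum>x\<in>A. p x * ?t x)) (S - A)"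
    proof (intro has_sum_sum has_sum_cmult_right has_sum_infsum)
      fix x assume "x \<in> A"
      then have "x \<in> S" using A by auto
      then show "(\<lambda>z. q x z * v z) summable_on S - A"
        by (intro summable_on_subset_banach[OF v(2)]) auto
    qed
    show "((\<lambda>z. p z * \<bar>q z z\<bar> * v z) has_sum (\<Sum>\<^sub>\<infinity>z\<in>S - A. p z * \<bar>q z z\<bar> * v z)) (S - A)"
      by (intro has_sum_infsum summable_on_subset_banach[OF weights]) auto
    fix z assume z: "z \<in> S - A"
    then have "(\<Sum>x\<in>A. p x * q x z) \<le> p z * \<bar>q z z\<bar>"
      using column_partial_le[OF p, of z A] A by auto
    then have "(\<Sum>x\<in>A. p x * q x z) * v z \<le> p z * \<bar>q z z\<bar> * v z"
      using v(1)[of z] z by (intro mult_right_mono) auto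
    then show "(\<Sum>x\<in>A. p x * (q x z * v z)) \<le> p z * \<bar>q z z\<bar> * v z"
      by (simp add: sum_distrib_right mult.assoc)
  qed
  finally show ?thesis by simp
qed

end

section \<open>Block structure\<close>

lemma states_Sigma: "states M = Sigma UNIV (\<lambda>k. {1..M k})"
  by (auto simp: states_def level_def)

lemma states_upto_Sigma: "states_upto M n = Sigma {..n} (\<lambda>k. {1..M k})"
  by (auto simp: states_upto_def level_def)

lemma finite_states_upto [simp]: "finite (states_upto M n)"
  by (simp add: states_upto_Sigma)

lemma states_upto_subset: "states_upto M n \<subseteq> states M"
  by (auto simp: states_upto_Sigma states_Sigma)

lemma states_diff_upto: "states M - states_upto M n = (\<Union>l\<in>{n+1..}. level M l)"
  by (auto simp: states_upto_Sigma states_Sigma level_def)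

lemma infinite_states:
  assumes "\<And>k. 1 \<le> M k" shows "infinite (states M)"
proof
  assume "finite (states M)"
  then have "finite (fst ` states M)" by simp
  moreover have "fst ` states M = UNIV"
    using assms by (force simp: states_Sigma image_iff)
  ultimately show False by simp
qed

lemma sum_states_upto: "(\<Sum>x\<in>states_upto M n. g x) = (\<Sum>k\<le>n. \<Sum>i=1..M k. g (k, i))"
  by (simp add: states_upto_Sigma sum.Sigma)

lemma phase_prod_unit_mass:
  "j \<in> {1..M n} \<Longrightarrow> phase_prod M n (unit_mass j) w = w j"
  by (simp add: phase_prod_def unit_mass_def if_distrib if_distribR cong: if_cong)

locale level_chain = infinite_generator "states M" q for M q +
  assumes hessenberg: "upper_block_Hessenberg M q"
begin

lemma trunc_inverse: "is_inverse_on (states_upto M n) (\<lambda>x y. - q x y) (trunc_inv M q n)"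
  unfolding trunc_inv_def by (intro truncated_inverse states_upto_subset) simp

lemma jump_down_zero: "(k, i) \<in> states M \<Longrightarrow> (l, j) \<in> states M \<Longrightarrow> l + 1 < k \<Longrightarrow> q (k, i) (l, j) = 0"
  using hessenberg by (fastforce simp: upper_block_Hessenberg_def level_def states_Sigma)

text \<open>
  For \<open>k < n\<close>: the columns of \<open>X (-Q) = I\<close> below level \<open>n\<close> express the row of \<open>X\<close> on the lower levels
  through its level-\<open>n\<close> block and the inverse on these levels; since downward jumps skip
  no level, only \<open>q\<close> from level \<open>n\<close> to level \<open>n - 1\<close> remains, which is the recursion that defines \<open>U_mat\<close>.
\<close>

lemma U_star_eq:
  assumes j: "j \<in> {1..M n}" and k: "k \<le> n" and i: "i \<in> {1..M k}"
  shows "U_star M q n k j i = trunc_inv M q n (n, j) (k, i)"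
proof (cases "k = n")
  case True
  have U: "U_mat M q n n h i = (if h = i then 1 else 0)" for h by (simp add: U_mat_def)
  have "U_star M q n k j i = (\<Sum>h=1..M n. trunc_inv M q n (n, j) (n, h) * (if h = i then 1 else 0))"
    by (simp only: U_star_def True U)
  then show ?thesis using True i by (simp add: if_distrib cong: if_cong)
next
  case False
  then obtain m where n: "n = Suc m" using k by (cases n) auto
  let ?A = "states_upto M n" and ?B = "states_upto M m"
  let ?r = "trunc_inv M q n (n, j)" and ?X = "trunc_inv M q m"
  have iB: "(k, i) \<in> ?B" and jA: "(n, j) \<in> ?A" using False k i j n by (auto simp: states_upto_Sigma)
  have A_split: "(\<Sum>x\<in>?A. g x) = (\<Sum>x\<in>?B. g x) + (\<Sum>h=1..M n. g (n, h))" for g :: "state \<Rightarrow> real"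
    by (simp add: sum_states_upto n)
  have bal: "(\<Sum>x\<in>?B. ?r x * - q x y) = (\<Sum>h=1..M n. ?r (n, h) * q (n, h) y)" if y: "y \<in> ?B" for y
  proof -
    have "y \<in> ?A" "(n, j) \<noteq> y" using y by (auto simp: n states_upto_Sigma)
    then have "(\<Sum>x\<in>?A. ?r x * - q x y) = 0"
      using trunc_inverse[of n] jA by (auto simp: is_inverse_on_def)
    then show ?thesis by (simp add: A_split sum_negf)
  qed
  have "?r (k, i) = (\<Sum>x\<in>?B. ?r x * (if x = (k, i) then 1 else 0))"
    using iB by (simp add: if_distrib cong: if_cong)
  also have "\<dots> = (\<Sum>x\<in>?B. ?r x * (\<Sum>y\<in>?B. - q x y * ?X y (k, i)))"
    using trunc_inverse[of m] iB by (intro sum.cong) (auto simp: is_inverse_on_def)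
  also have "\<dots> = (\<Sum>x\<in>?B. \<Sum>y\<in>?B. ?r x * - q x y * ?X y (k, i))"
    by (simp only: sum_distrib_left mult.assoc)
  also have "\<dots> = (\<Sum>y\<in>?B. \<Sum>x\<in>?B. ?r x * - q x y * ?X y (k, i))"
    by (rule sum.swap)
  also have "\<dots> = (\<Sum>y\<in>?B. (\<Sum>h=1..M n. ?r (n, h) * q (n, h) y) * ?X y (k, i))"
    unfolding sum_distrib_right[symmetric] by (intro sum.cong refl) (simp only: bal)
  also have "\<dots> = (\<Sum>h=1..M n. ?r (n, h) * (\<Sum>y\<in>?B. q (n, h) y * ?X y (k, i)))"
    unfolding sum_distrib_right sum_distrib_left by (subst sum.swap) (simp only: mult.assoc)
  also have "\<dots> = (\<Sum>h=1..M n. ?r (n, h) * U_mat M q n k h i)"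
  proof (intro sum.cong refl arg_cong2[where f = "(*)"])
    fix h assume h: "h \<in> {1..M n}"
    have "(\<Sum>y\<in>?B. q (n, h) y * ?X y (k, i)) = (\<Sum>y\<in>level M m. q (n, h) y * ?X y (k, i))"
    proof (rule sum.mono_neutral_right)
      show "\<forall>y\<in>?B - level M m. q (n, h) y * ?X y (k, i) = 0"
      proof
        fix y assume y: "y \<in> ?B - level M m"
        then obtain a c where ac: "y = (a, c)" "a < m" "c \<in> {1..M a}"
          by (cases y) (auto simp: states_upto_Sigma level_def le_less)
        then have "q (n, h) (a, c) = 0"
          using h by (intro jump_down_zero) (auto simp: states_Sigma n)
        then show "q (n, h) y * ?X y (k, i) = 0" by (simp add: ac)
      qed
      show "level M m \<subseteq> ?B" by (auto simp: states_upto_def)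
    qed simp
    also have "\<dots> = (\<Sum>g=1..M m. q (n, h) (m, g) * ?X (m, g) (k, i))"
      unfolding level_def using sum.cartesian_product[of "\<lambda>a g. q (n, h) (a, g) * ?X (a, g) (k, i)" "{1..M m}" "{m}"]
      by (simp add: case_prod_beta)
    finally show "(\<Sum>y\<in>?B. q (n, h) y * ?X y (k, i)) = U_mat M q n k h i"
      using False by (simp add: U_mat_def n)
  qed
  finally show ?thesis by (simp add: U_star_def)
qed

lemma u_star_eq: "j \<in> {1..M n} \<Longrightarrow> u_star M q n j = (\<Sum>x\<in>states_upto M n. trunc_inv M q n (n, j) x)"
  by (simp add: u_star_def sum_states_upto U_star_eq)

lemma y_vec_eq: "j \<in> {1..M n} \<Longrightarrow> y_vec M q v n j =
    v (n, j) + (\<Sum>x\<in>states_upto M n. trunc_inv M q n (n, j) x * (\<Sum>\<^sub>\<infinity>z\<in>states M - states_upto M n. q x z * v z))"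
  by (simp add: y_vec_def sum_states_upto U_star_eq states_diff_upto)

lemma pi_hat_eq:
  assumes j: "j \<in> {1..M n}"
  shows "pi_hat M q n (unit_mass j) x =
    (if x \<in> states_upto M n then trunc_inv M q n (n, j) x / (\<Sum>x\<in>states_upto M n. trunc_inv M q n (n, j) x) else 0)"
  using j by (cases x) (auto simp: pi_hat_def phase_prod_unit_mass u_star_eq U_star_eq states_upto_Sigma)

lemma y_vec_lower:
  assumes j: "j \<in> {1..M n}" and v: "\<And>x. x \<in> states M \<Longrightarrow> 0 \<le> v x"
  shows "v (n, j) \<le> y_vec M q v n j"
proof -
  have "0 \<le> trunc_inv M q n (n, j) x * (\<Sum>\<^sub>\<infinity>z\<in>states M - states_upto M n. q x z * v z)"
    if x: "x \<in> states_upto M n" for x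
  proof (intro mult_nonneg_nonneg infsum_nonneg)
    show "0 \<le> trunc_inv M q n (n, j) x"
      unfolding trunc_inv_def by (intro truncated_inverse_nonneg states_upto_subset) simp
    fix z assume z: "z \<in> states M - states_upto M n"
    show "0 \<le> q x z" using x z states_upto_subset by (intro off_nonneg) auto
    show "0 \<le> v z" using v z by simp
  qed
  then show ?thesis by (simp add: y_vec_eq[OF j] sum_nonneg)
qed

end

section \<open>Convergence under the drift and moment conditions\<close>

locale drift_level_chain = level_chain M q for M q +
  fixes p v :: "state \<Rightarrow> real" and b :: real and C :: "state set"
  assumes levels: "\<And>k. 1 \<le> M k"
    and stationary: "stationary_distribution (states M) q p"
    and drift_condition: "condition1 (states M) q b C v"
    and moment_condition: "condition2 M q p v"
begin

lemma p_pos: "x \<in> states M \<Longrightarrow> 0 < p x"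
  and p_has_sum: "(p has_sum 1) (states M)"
  and p_balance: "y \<in> states M \<Longrightarrow> ((\<lambda>x. p x * q x y) has_sum 0) (states M)"
  using stationary by (auto simp: stationary_distribution_def)

lemma v_pos: "x \<in> states M \<Longrightarrow> 0 < v x"
  and b_pos: "0 < b"
  and C: "finite C" "C \<subseteq> states M"
  and v_summable: "x \<in> states M \<Longrightarrow> (\<lambda>y. q x y * v y) summable_on states M"
  and drift: "x \<in> states M \<Longrightarrow> (\<Sum>\<^sub>\<infinity>y\<in>states M. q x y * v y) \<le> - 1 + b * indicator C x"
  using drift_condition by (auto simp: condition1_def)

lemma v_lower: obtains c where "0 < c" "\<And>x. x \<in> states M \<Longrightarrow> c \<le> v x"
proof
  show "0 < (INF x\<in>states M. v x)" using drift_condition by (simp add: condition1_def)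
  show "(INF x\<in>states M. v x) \<le> v x" if "x \<in> states M" for x
    using that v_pos by (intro cINF_lower bdd_belowI2[where m = 0]) (auto intro: less_imp_le)
qed

definition level_moment :: "nat \<Rightarrow> real" where
  "level_moment n = (\<Sum>i=1..M n. p (n, i) * \<bar>q (n, i) (n, i)\<bar> * v (n, i))"

lemma summable_level_moment: "summable level_moment"
  using moment_condition by (simp add: condition2_def level_moment_def[abs_def])

lemma moment_nonneg: "x \<in> states M \<Longrightarrow> 0 \<le> p x * \<bar>q x x\<bar> * v x"
  using p_pos[of x] v_pos[of x] by simp

lemma level_moment_nonneg: "0 \<le> level_moment n"
  unfolding level_moment_def by (intro sum_nonneg moment_nonneg) (auto simp: states_Sigma)

lemma moment_partial_sum:
  assumes "finite F" "F \<subseteq> states M"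
  shows "(\<Sum>x\<in>F. p x * \<bar>q x x\<bar> * v x) \<le> suminf level_moment"
proof -
  define n where "n = Max (insert 0 (fst ` F))"
  have "F \<subseteq> states_upto M n"
  proof
    fix x assume "x \<in> F"
    then have "fst x \<le> n" unfolding n_def using assms(1) by (intro Max_ge) auto
    then show "x \<in> states_upto M n" using \<open>x \<in> F\<close> assms(2) by (cases x) (auto simp: states_Sigma states_upto_Sigma)
  qed
  then have "(\<Sum>x\<in>F. p x * \<bar>q x x\<bar> * v x) \<le> (\<Sum>x\<in>states_upto M n. p x * \<bar>q x x\<bar> * v x)"
    using states_upto_subset[of M n] by (intro sum_mono2 moment_nonneg) auto
  also have "\<dots> = sum level_moment {..n}" by (simp add: sum_states_upto level_moment_def)
  also have "\<dots> \<le> suminf level_moment"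
    by (intro sum_le_suminf summable_level_moment) (auto intro: level_moment_nonneg)
  finally show ?thesis .
qed

lemma moment_summable: "(\<lambda>x. p x * \<bar>q x x\<bar> * v x) summable_on states M"
proof (rule nonneg_bdd_above_summable_on[OF moment_nonneg])
  show "bdd_above (sum (\<lambda>x. p x * \<bar>q x x\<bar> * v x) ` {F. F \<subseteq> states M \<and> finite F})"
    using moment_partial_sum by (intro bdd_aboveI2[where M = "suminf level_moment"]) auto
qed

lemma rate_summable: "(\<lambda>x. p x * \<bar>q x x\<bar>) summable_on states M"
proof -
  obtain c where c: "0 < c" "\<And>x. x \<in> states M \<Longrightarrow> c \<le> v x" using v_lower by blast
  show ?thesis
  proof (rule summable_on_comparison_test)
    show "(\<lambda>x. 1 / c * (p x * \<bar>q x x\<bar> * v x)) summable_on states M"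
      by (intro summable_on_cmult_right moment_summable)
    show "p x * \<bar>q x x\<bar> \<le> 1 / c * (p x * \<bar>q x x\<bar> * v x)" if "x \<in> states M" for x
    proof -
      have "p x * \<bar>q x x\<bar> * c \<le> p x * \<bar>q x x\<bar> * v x"
        using c(2)[OF that] p_pos[OF that] by (intro mult_left_mono) auto
      then show ?thesis using c(1) by (simp add: pos_le_divide_eq)
    qed
    show "0 \<le> p x * \<bar>q x x\<bar>" if "x \<in> states M" for x using p_pos[OF that] by simp
  qed
qed

lemma moment_tail:
  "(\<Sum>\<^sub>\<infinity>z\<in>states M - states_upto M n. p z * \<bar>q z z\<bar> * v z) \<le> suminf level_moment - sum level_moment {..n}"
proof -
  have "(\<Sum>\<^sub>\<infinity>z\<in>states M - states_upto M n. p z * \<bar>q z z\<bar> * v z)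
     = (\<Sum>\<^sub>\<infinity>z\<in>states M. p z * \<bar>q z z\<bar> * v z) - sum level_moment {..n}"
    using has_sum_Diff[OF has_sum_infsum[OF moment_summable] has_sum_finite[of "states_upto M n"] states_upto_subset]
    by (intro infsumI) (simp add: sum_states_upto level_moment_def)
  moreover have "(\<Sum>\<^sub>\<infinity>z\<in>states M. p z * \<bar>q z z\<bar> * v z) \<le> suminf level_moment"
    by (intro infsum_le_finite_sums moment_summable moment_partial_sum)
  ultimately show ?thesis by simp
qed

text \<open>
  Were \<open>C\<close> empty, \<open>Q v \<le> -1\<close> would hold everywhere, in conflict with \<open>p Q v = 0\<close>.
\<close>

lemma C_nonempty: "C \<noteq> {}"
proof
  assume "C = {}"
  let ?Qv = "\<lambda>x. \<Sum>\<^sub>\<infinity>y\<in>states M. q x y * v y"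
  have "(\<lambda>y. p y * \<bar>q y y\<bar> * \<bar>v y\<bar>) summable_on states M"
    using moment_summable by (rule summable_on_cong[THEN iffD1, rotated]) (simp add: less_imp_le[OF v_pos])
  then have "((\<lambda>x. p x * ?Qv x) has_sum 0) (states M)"
    by (intro stationary_infsum_zero[OF less_imp_le[OF p_pos] p_balance _ has_sum_infsum[OF v_summable]])
  moreover have "((\<lambda>x. - p x) has_sum - 1) (states M)"
    using p_has_sum by (simp add: has_sum_uminus)
  moreover have "p x * ?Qv x \<le> - p x" if "x \<in> states M" for x
    using mult_left_mono[OF drift[OF that], of "p x"] p_pos[OF that] \<open>C = {}\<close> by simp
  ultimately have "(0::real) \<le> -1" by (rule has_sum_mono)
  then show False by simp
qed

lemma drift_nn_integral:
  assumes x: "x \<in> states M"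
  shows "1 + (\<integral>\<^sup>+y. ennreal (q x y) * ennreal (v y) \<partial>count_space (states M - {x}))
      \<le> ennreal b * indicator C x + ennreal \<bar>q x x\<bar> * ennreal (v x)"
proof -
  let ?s = "(\<Sum>\<^sub>\<infinity>y\<in>states M. q x y * v y) - q x x * v x"
  have sum: "((\<lambda>y. q x y * v y) has_sum ?s) (states M - {x})"
    using has_sum_Diff[OF has_sum_infsum[OF v_summable[OF x]], of "{x}" "q x x * v x"] x by (simp add: has_sum_finite_iff)
  have nonneg: "0 \<le> q x y * v y" if "y \<in> states M - {x}" for y
    using off_nonneg[of x y] v_pos[of y] x that by auto
  have s0: "0 \<le> ?s" using has_sum_nonneg[OF sum] nonneg by auto
  have "(\<integral>\<^sup>+y. ennreal (q x y) * ennreal (v y) \<partial>count_space (states M - {x}))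
      = (\<integral>\<^sup>+y. ennreal (q x y * v y) \<partial>count_space (states M - {x}))"
    using v_pos by (intro nn_integral_cong) (auto simp: ennreal_mult'' less_imp_le)
  also have "\<dots> = ennreal ?s" by (rule nn_integral_count_space_has_sum[OF sum nonneg])
  finally have "1 + (\<integral>\<^sup>+y. ennreal (q x y) * ennreal (v y) \<partial>count_space (states M - {x})) = ennreal (1 + ?s)"
    using s0 by (simp add: ennreal_plus)
  also have "\<dots> \<le> ennreal (b * indicator C x + \<bar>q x x\<bar> * v x)"
    using drift[OF x] rate_neg[OF x] by (intro ennreal_leI) (simp add: abs_if)
  also have "\<dots> = ennreal b * indicator C x + ennreal \<bar>q x x\<bar> * ennreal (v x)"
    using b_pos v_pos[OF x] by (auto simp: ennreal_plus ennreal_mult indicator_def)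
  finally show ?thesis .
qed

text \<open>
  The stationary mass of the states up to level \<open>n\<close> is bounded below by \<open>p (0, 1)\<close>, so the bound on the
  minimal ratio is a constant times a remainder of the moment series.
\<close>

lemma ratio_tendsto_0:
  assumes opt: "\<And>n. optimal_phase M q v n (jstar n)"
  shows "(\<lambda>n. y_vec M q v n (jstar n) / u_star M q n (jstar n)) \<longlonglongrightarrow> 0"
    and "(\<lambda>n. 1 / u_star M q n (jstar n)) \<longlonglongrightarrow> 0"
proof -
  let ?r = "\<lambda>n. y_vec M q v n (jstar n) / u_star M q n (jstar n)"
  let ?e = "\<lambda>n. level_moment n + (suminf level_moment - sum level_moment {..n})"
  have j: "jstar n \<in> {1..M n}" and min: "\<And>i. i \<in> {1..M n} \<Longrightarrow>
      y_vec M q v n (jstar n) / u_star M q n (jstar n) \<le> y_vec M q v n i / u_star M q n i" for n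
    using opt[of n] by (auto simp: optimal_phase_def is_arg_min_linorder)
  have u_pos: "0 < u_star M q n i" if "i \<in> {1..M n}" for n i
    using that truncated_row_sum_pos[of "states_upto M n" "(n, i)"] states_upto_subset[of M n]
    by (simp add: u_star_eq trunc_inv_def states_upto_Sigma)
  have y_vec_le: "v (n, jstar n) \<le> y_vec M q v n (jstar n)" for n
    using v_pos by (intro y_vec_lower j) (auto intro: less_imp_le)
  have bound: "?r n * p (0, 1) \<le> ?e n" for n
  proof -
    let ?A = "states_upto M n"
    have L: "level M n \<subseteq> ?A" by (auto simp: states_upto_def)
    have levelE: "\<exists>i. x = (n, i) \<and> i \<in> {1..M n}" if "x \<in> level M n" for x using that by (auto simp: level_def)
    let ?w = "\<lambda>i. v i + (\<Sum>x\<in>?A. trunc_inv M q n i x * (\<Sum>\<^sub>\<infinity>z\<in>states M - ?A. q x z * v z))"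
    have "?w (n, jstar n) / sum (trunc_inv M q n (n, jstar n)) ?A * sum p ?A
       \<le> (\<Sum>j\<in>level M n. p j * \<bar>q j j\<bar> * v j) + (\<Sum>\<^sub>\<infinity>z\<in>states M - ?A. p z * \<bar>q z z\<bar> * v z)"
      unfolding trunc_inv_def
    proof (rule minimal_ratio_bound)
      show "q x y = 0" if xy: "x \<in> states M - ?A" "y \<in> ?A - level M n" for x y
      proof -
        obtain k i where x: "x = (k, i)" "n < k" "i \<in> {1..M k}"
          using xy(1) by (cases x) (auto simp: states_upto_Sigma states_Sigma)
        obtain l j where y: "y = (l, j)" "l < n" "j \<in> {1..M l}"
          using xy(2) by (cases y) (auto simp: states_upto_Sigma level_def le_less)
        show ?thesis unfolding x(1) y(1) using x y by (intro jump_down_zero) (auto simp: states_Sigma)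
      qed
      show "0 < sum (inverse_on ?A (\<lambda>x y. - q x y) i) ?A" if "i \<in> ?A" for i
        using that states_upto_subset by (intro truncated_row_sum_pos) auto
      show "0 \<le> v x" if "x \<in> states M" for x using v_pos[OF that] by simp
      show "(n, jstar n) \<in> level M n" using j by (simp add: level_def)
      fix i assume "i \<in> level M n"
      then obtain k where k: "i = (n, k)" "k \<in> {1..M n}" using levelE by blast
      show "(v (n, jstar n) + (\<Sum>x\<in>?A. inverse_on ?A (\<lambda>x y. - q x y) (n, jstar n) x * (\<Sum>\<^sub>\<infinity>z\<in>states M - ?A. q x z * v z))) /
          sum (inverse_on ?A (\<lambda>x y. - q x y) (n, jstar n)) ?A
        \<le> (v i + (\<Sum>x\<in>?A. inverse_on ?A (\<lambda>x y. - q x y) i x * (\<Sum>\<^sub>\<infinity>z\<in>states M - ?A. q x z * v z))) /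
          sum (inverse_on ?A (\<lambda>x y. - q x y) i) ?A"
        using min[OF k(2)] unfolding k(1) y_vec_eq[OF k(2)] y_vec_eq[OF j] u_star_eq[OF k(2)] u_star_eq[OF j]
        by (simp only: trunc_inv_def)
    qed (rule p_pos p_balance v_summable moment_summable finite_states_upto states_upto_subset L; assumption)+
    also have "(\<Sum>j\<in>level M n. p j * \<bar>q j j\<bar> * v j) = level_moment n"
      unfolding level_def level_moment_def
      using sum.cartesian_product[of "\<lambda>a g. p (a, g) * \<bar>q (a, g) (a, g)\<bar> * v (a, g)" "{1..M n}" "{n}"]
      by (simp add: case_prod_beta)
    finally have "?r n * sum p ?A \<le> level_moment n + (\<Sum>\<^sub>\<infinity>z\<in>states M - ?A. p z * \<bar>q z z\<bar> * v z)"
      by (simp only: y_vec_eq[OF j] u_star_eq[OF j])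
    moreover have "?r n * p (0, 1) \<le> ?r n * sum p ?A"
    proof (intro mult_left_mono)
      have "(0, 1) \<in> ?A" using levels by (auto simp: states_upto_Sigma)
      then show "p (0, 1) \<le> sum p ?A"
        using states_upto_subset[of M n] p_pos by (intro member_le_sum) (auto intro: less_imp_le)
      show "0 \<le> ?r n" using y_vec_le[of n] u_pos[OF j] v_pos[of "(n, jstar n)"] j[of n]
        by (intro divide_nonneg_pos) (auto simp: states_Sigma)
    qed
    ultimately show ?thesis using moment_tail[of n] by linarith
  qed
  have "?e \<longlonglongrightarrow> 0 + (suminf level_moment - suminf level_moment)"
    using summable_LIMSEQ'[OF summable_level_moment] summable_LIMSEQ_zero[OF summable_level_moment]
    by (intro tendsto_intros)
  then have e0: "(\<lambda>n. ?e n / p (0, 1)) \<longlonglongrightarrow> 0"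
    using tendsto_divide_zero by force
  have p0: "0 < p (0, 1)" using levels by (intro p_pos) (auto simp: states_Sigma)
  obtain c where c: "0 < c" "\<And>x. x \<in> states M \<Longrightarrow> c \<le> v x" using v_lower by blast
  have r_lower: "c * (1 / u_star M q n (jstar n)) \<le> ?r n" for n
  proof -
    have "c \<le> y_vec M q v n (jstar n)"
      using c(2)[of "(n, jstar n)"] y_vec_le[of n] j[of n] by (auto simp: states_Sigma)
    then show ?thesis using u_pos[OF j[of n]] by (simp add: divide_right_mono)
  qed
  have inv0: "0 \<le> 1 / u_star M q n (jstar n)" for n using u_pos[OF j[of n]] by simp
  have r0: "0 \<le> ?r n" for n
    using r_lower[of n] mult_nonneg_nonneg[OF less_imp_le[OF c(1)] inv0[of n]] by linarith
  show r_lim: "?r \<longlonglongrightarrow> 0"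
  proof (rule tendsto_sandwich[OF _ _ tendsto_const e0])
    show "\<forall>\<^sub>F n in sequentially. 0 \<le> ?r n" using r0 by simp
    show "\<forall>\<^sub>F n in sequentially. ?r n \<le> ?e n / p (0, 1)"
      using bound p0 by (simp add: pos_le_divide_eq)
  qed
  show "(\<lambda>n. 1 / u_star M q n (jstar n)) \<longlonglongrightarrow> 0"
  proof (rule tendsto_sandwich[OF _ _ tendsto_const])
    show "\<forall>\<^sub>F n in sequentially. 0 \<le> 1 / u_star M q n (jstar n)" using inv0 by simp
    show "\<forall>\<^sub>F n in sequentially. 1 / u_star M q n (jstar n) \<le> ?r n / c"
    proof (intro always_eventually allI)
      show "1 / u_star M q n (jstar n) \<le> ?r n / c" for n
        using r_lower[of n] by (subst pos_le_divide_eq[OF c(1)]) (simp only: mult.commute)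
    qed
    show "(\<lambda>n. ?r n / c) \<longlonglongrightarrow> 0" using r_lim tendsto_divide_zero by blast
  qed
qed

text \<open>
  The error estimate is available for each target \<open>y\<close>. For a fixed error it bounds the minimum over
  \<open>C\<close> of the resolvent at \<open>y\<close> from above, so it passes to the supremum over \<open>y\<close>.
\<close>

lemma norm1_le_error_bound:
  fixes Pr :: "state \<Rightarrow> 'w measure"
  assumes chain: "markov_chain_with_generator (states M) q Pr Y H"
    and regular: "regular_jump (states M) Pr H"
    and \<beta>: "0 < \<beta>" and j: "j \<in> {1..M n}"
  shows "norm1 (states M) (\<lambda>x. pi_hat M q n (unit_mass j) x - p x)
    \<le> error_bound M q (transition_prob Pr Y H) b C v \<beta> n (unit_mass j)"
proof -
  let ?S = "states M" and ?A = "states_upto M n"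
  let ?\<phi> = "resolvent (transition_prob Pr Y H) \<beta>"
  let ?\<psi> = "\<lambda>y. Min ((\<lambda>x. ?\<phi> x y) ` C)"
  let ?N = "norm1 ?S (\<lambda>x. pi_hat M q n (unit_mass j) x - p x)"
  define r where "r = y_vec M q v n j / u_star M q n j"
  define u where "u = u_star M q n j"
  have iA: "(n, j) \<in> ?A" using j by (simp add: states_upto_Sigma)
  have u: "0 < u"
    using truncated_row_sum_pos[of ?A "(n, j)"] iA states_upto_subset[of M n]
    by (simp add: u_def u_star_eq[OF j] trunc_inv_def)
  have mc: "markov_jump_chain ?S q Pr Y H \<beta> x" if "x \<in> ?S" for x
    using generator chain regular \<beta> that by unfold_locales
  have \<psi>_le: "?\<psi> y \<le> ?\<phi> x y" if "x \<in> C" for x y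
    using C that by (intro Min_le) auto
  have \<psi>_pos: "0 < ?\<psi> y" and \<psi>_1: "?\<psi> y \<le> 1" if y: "y \<in> ?S" for y
  proof -
    have "0 < ?\<phi> x y" if "x \<in> C" for x
    proof -
      have xS: "x \<in> ?S" using that C by auto
      show ?thesis
      proof (rule markov_jump_chain.resolvent_pos[OF mc[OF xS]])
        show "(x, y) \<in> {(a, c). a \<in> ?S \<and> c \<in> ?S \<and> 0 < q a c}\<^sup>*"
          using irreducible y xS by (auto simp: irreducible_generator_def)
      qed (rule rate_neg)
    qed
    then show "0 < ?\<psi> y" using C C_nonempty by simp
    obtain x where x: "x \<in> C" using C_nonempty by auto
    then have xS: "x \<in> ?S" using C by auto
    have "?\<phi> x y \<le> 1" by (rule markov_jump_chain.resolvent_le_1[OF mc[OF xS]])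
    with \<psi>_le[OF x, of y] show "?\<psi> y \<le> 1" by (rule order_trans)
  qed
  have bound: "?N \<le> 2 * (r + 1 / u * (2 * (b * (1 / (\<beta> * ?\<psi> y)))))" if y: "y \<in> ?S" for y
  proof -
    let ?\<kappa> = "1 / (\<beta> * ?\<psi> y)"
    have \<kappa>0: "0 \<le> ?\<kappa>" using \<beta> \<psi>_pos[OF y] by simp
    have hit: "hit_iter y (indicator C) k x \<le> ennreal ?\<kappa>" if x: "x \<in> ?S" for x k
    proof (rule hit_iter_bound[where \<psi> = "?\<psi> y" and \<beta> = \<beta> and C = C and y\<^sub>0 = y, OF C \<psi>_pos[OF y] \<psi>_1[OF y] \<beta> _ x])
      fix w :: "state \<Rightarrow> ennreal" and c x
      assume w: "\<And>z. z \<in> ?S \<Longrightarrow> w z \<le> ennreal c" "w y = 0"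
        "\<And>z. z \<in> ?S \<Longrightarrow> ennreal \<bar>q z z\<bar> * w z \<le> indicator C z + (\<integral>\<^sup>+z'. ennreal (q z z') * w z' \<partial>count_space (?S - {z}))"
        and x: "x \<in> C" and c: "0 \<le> c"
      have xS: "x \<in> ?S" using x C by auto
      interpret markov_jump_chain ?S q Pr Y H \<beta> x by (rule mc[OF xS])
      have "w x \<le> ennreal c * occ (- {y}) + ennreal (1 / \<beta>)"
      proof (rule resolvent_subsolution_bound[where F = "indicator C" and y\<^sub>0 = y, OF _ w(1) w(2) _ w(3)])
        show "q z z \<noteq> 0" if "z \<in> ?S" for z using rate_neg[OF that] by simp
        show "indicator C z \<le> (1 :: ennreal)" for z by (simp add: indicator_def)
      qed
      also have "\<dots> = ennreal (c * (1 - ?\<phi> x y) + 1 / \<beta>)"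
        using c \<beta> resolvent_le_1[of y] by (simp add: occ_compl ennreal_mult ennreal_plus)
      also have "\<dots> \<le> ennreal (c * (1 - ?\<psi> y) + 1 / \<beta>)"
        using c \<psi>_le[OF x, of y] by (intro ennreal_leI add_right_mono mult_left_mono) auto
      finally show "w x \<le> ennreal (c * (1 - ?\<psi> y) + 1 / \<beta>)" .
    qed
    have "norm1 ?S (\<lambda>x. (if x \<in> ?A then inverse_on ?A (\<lambda>x y. - q x y) (n, j) x / sum (inverse_on ?A (\<lambda>x y. - q x y) (n, j)) ?A else 0) - p x)
      \<le> 2 * ((v (n, j) + (\<Sum>x\<in>?A. inverse_on ?A (\<lambda>x y. - q x y) (n, j) x * (\<Sum>\<^sub>\<infinity>z\<in>?S - ?A. q x z * v z)))
          / sum (inverse_on ?A (\<lambda>x y. - q x y) (n, j)) ?A + 1 / sum (inverse_on ?A (\<lambda>x y. - q x y) (n, j)) ?A * (2 * (b * ?\<kappa>)))"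
    proof (rule augmentation_error[where p = p and v = v and \<kappa> = "b * ?\<kappa>" and y\<^sub>0 = y and A = ?A and i = "(n, j)"])
      show "0 \<le> b * ?\<kappa>" using b_pos \<kappa>0 by simp
      fix f :: "state \<Rightarrow> real" assume f: "\<And>x. x \<in> ?S \<Longrightarrow> 0 \<le> f x \<and> f x \<le> 2"
      show "\<exists>h. (\<forall>x\<in>?S. 0 \<le> h x \<and> h x \<le> 2 * (v x + b * ?\<kappa>)) \<and> (\<forall>x\<in>?S - {y}. ((\<lambda>y. q x y * h y) has_sum - f x) ?S)"
      proof (rule hitting_solution[where v = v and b = b and \<kappa> = ?\<kappa> and f = f and y\<^sub>0 = y and C = C])
        fix h
        assume "\<And>x. x \<in> ?S \<Longrightarrow> 0 \<le> h x \<and> h x \<le> 2 * (v x + b * ?\<kappa>)"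
          "\<And>x. x \<in> ?S \<Longrightarrow> x \<noteq> y \<Longrightarrow> ((\<lambda>y. q x y * h y) has_sum - f x) ?S"
        then show ?thesis by (intro exI[of _ h]) auto
      qed (fact drift_nn_integral less_imp_le[OF v_pos] less_imp_le[OF b_pos] \<kappa>0 hit f)+
    qed (fact p_pos p_has_sum p_balance less_imp_le[OF v_pos] v_summable rate_summable moment_summable y
          finite_states_upto states_upto_subset iA)+
    then show ?thesis
      unfolding r_def u_def y_vec_eq[OF j] u_star_eq[OF j] pi_hat_eq[OF j] trunc_inv_def .
  qed
  let ?\<Phi> = "phi_bar ?S C (transition_prob Pr Y H) \<beta>"
  have one: "(0, 1) \<in> ?S" using levels by (auto simp: states_Sigma)
  have bdd: "bdd_above (?\<psi> ` ?S)" using \<psi>_1 by (intro bdd_aboveI2[where M = 1])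
  have \<Phi>_pos: "0 < ?\<Phi>"
    using \<psi>_pos[OF one] cSUP_upper[OF one bdd] unfolding phi_bar_def by linarith
  have eq: "error_bound M q (transition_prob Pr Y H) b C v \<beta> n (unit_mass j) = 2 * (r + 1 / u * (2 * b / (\<beta> * ?\<Phi>)))"
    by (simp add: error_bound_def r_fun_def phase_prod_unit_mass[where M = M, OF j] r_def u_def)
  define D where "D = ?N - 2 * r"
  have D: "D * ?\<psi> y \<le> 4 * b / (u * \<beta>)" if "y \<in> ?S" for y
  proof -
    have "D \<le> 4 * b / (u * \<beta>) / ?\<psi> y"
      using bound[OF that] by (simp add: D_def)
    then show ?thesis using \<psi>_pos[OF that] by (simp only: pos_le_divide_eq)
  qed
  have "D * ?\<Phi> \<le> 4 * b / (u * \<beta>)"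
  proof (cases "0 < D")
    case True
    have "?\<Phi> \<le> 4 * b / (u * \<beta>) / D"
      unfolding phi_bar_def
    proof (rule cSUP_least)
      show "?\<psi> y \<le> 4 * b / (u * \<beta>) / D" if "y \<in> ?S" for y
        using D[OF that] True by (simp only: pos_le_divide_eq mult.commute)
    qed (use one in auto)
    then show ?thesis using True by (simp only: pos_le_divide_eq mult.commute)
  next
    case False
    then have "D * ?\<Phi> \<le> 0" using \<Phi>_pos by (intro mult_nonpos_nonneg) auto
    also have "0 \<le> 4 * b / (u * \<beta>)" using u \<beta> b_pos by simp
    finally show ?thesis .
  qed
  then have "D \<le> 4 * b / (u * \<beta>) / ?\<Phi>" using \<Phi>_pos by (simp only: pos_le_divide_eq)
  then show ?thesis unfolding eq by (simp add: D_def)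
qed

end

theorem theorem3p2:
  fixes M :: "nat \<Rightarrow> nat"
    and q :: "state \<Rightarrow> state \<Rightarrow> real"
    and Pr :: "state \<Rightarrow> 'w measure"
    and Y :: "nat \<Rightarrow> 'w \<Rightarrow> state"
    and H :: "nat \<Rightarrow> 'w \<Rightarrow> real"
    and p v :: "state \<Rightarrow> real"
    and b :: real
    and C :: "state set"
    and jstar :: "nat \<Rightarrow> nat"
  assumes "\<And>k. 1 \<le> M k"
    and "conservative_generator (states M) q"
    and "upper_block_Hessenberg M q"
    and "markov_chain_with_generator (states M) q Pr Y H"
    and "regular_jump (states M) Pr H"
    and "irreducible_generator (states M) q"
    and "positive_recurrent (states M) Pr Y H"
    and "stationary_distribution (states M) q p"
    and "condition1 (states M) q b C v"
    and "condition2 M q p v"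
    and "\<And>n. optimal_phase M q v n (jstar n)"
  shows "(\<forall>\<beta>>0.
           (\<lambda>n. error_bound M q (transition_prob Pr Y H) b C v \<beta> n (unit_mass (jstar n)))
             \<longlonglongrightarrow> 0) \<and>
         (\<forall>\<beta>>0. \<forall>n.
           norm1 (states M) (\<lambda>x. pi_hat M q n (unit_mass (jstar n)) x - p x)
             \<le> error_bound M q (transition_prob Pr Y H) b C v \<beta> n (unit_mass (jstar n))) \<and>
         (\<lambda>n. norm1 (states M) (\<lambda>x. pi_hat M q n (unit_mass (jstar n)) x - p x))
           \<longlonglongrightarrow> 0"
proof -
  interpret drift_level_chain M q p v b C
    using assms infinite_states[OF assms(1)] by unfold_locales auto
  let ?E = "\<lambda>\<beta> n. error_bound M q (transition_prob Pr Y H) b C v \<beta> n (unit_mass (jstar n))"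
  let ?N = "\<lambda>n. norm1 (states M) (\<lambda>x. pi_hat M q n (unit_mass (jstar n)) x - p x)"
  have j: "jstar n \<in> {1..M n}" for n
    using assms(11)[of n] by (simp add: optimal_phase_def is_arg_min_def)
  have phase: "phase_prod M n (unit_mass (jstar n)) w = w (jstar n)" for n w
    by (rule phase_prod_unit_mass) (rule j)
  have lim: "?E \<beta> \<longlonglongrightarrow> 0" for \<beta>
  proof -
    let ?k = "2 * b / (\<beta> * phi_bar (states M) C (transition_prob Pr Y H) \<beta>)"
    have "?E \<beta> = (\<lambda>n. 2 * (y_vec M q v n (jstar n) / u_star M q n (jstar n) + 1 / u_star M q n (jstar n) * ?k))"
      by (simp add: error_bound_def r_fun_def phase)
    moreover have "(\<lambda>n. 2 * (y_vec M q v n (jstar n) / u_star M q n (jstar n) + 1 / u_star M q n (jstar n) * ?k)) \<longlonglongrightarrow> 2 * (0 + 0 * ?k)"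
      by (intro tendsto_mult tendsto_add tendsto_const ratio_tendsto_0 assms(11))
    ultimately show ?thesis by simp
  qed
  have le: "?N n \<le> ?E \<beta> n" if "0 < \<beta>" for \<beta> n
    by (rule norm1_le_error_bound[OF assms(4,5) that j])
  have "?N \<longlonglongrightarrow> 0"
  proof (rule tendsto_sandwich[OF _ _ tendsto_const lim[of 1]])
    show "\<forall>\<^sub>F n in sequentially. 0 \<le> ?N n" by (simp add: norm1_def infsum_nonneg)
    show "\<forall>\<^sub>F n in sequentially. ?N n \<le> ?E 1 n" using le by simp
  qed
  with lim le show ?thesis by blast
qed

end
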